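(* For any $m\ge1$ and any two unit interval graphs $\Gamma$ and $\Gamma'$, $$\mathbf X^{(m)}_{\Gamma\cup\Gamma'}(q,t)=\mathbf X^{(m)}_{\Gamma}(q,t)\star\mathbf X^{(m)}_{\Gamma'}(q,t),$$ where $\Gamma\cup\Gamma'$ is the ordered disjoint union, $\mathbf X^{(m)}$ denotes the $m$-truncated $(q,t)$-chromatic symmetric function and $\star$ is the quantum multiplication on $\mathbb Q_{q,t}[X^{\pm1}]_{(m)}$.
   Context: Let $q,t$ be indeterminates and $\mathbb Q_{q,t}=\mathbb Q(q,t)$. For $m\ge1$ put $\mathbb Q_{q,t}[X^{\pm1}]_{(m)}=\mathbb Q_{q,t}[X_1^{\pm1},\dots,X_m^{\pm1}]$, with the convention $X_{i+km}=q^{-k}X_i$ for $1\le i\le m$, $k\in\mathbb Z$ (so $X_0=qX_m$, $X_{m+1}=q^{-1}X_1$). Affine Hecke algebra: $\mathscr H_m$ is the $\mathbb Q_{q,t}$-algebra generated by $T_i$ ($i\in\mathbb Z/m\mathbb Z$) and $\Pi^{\pm1}$ with relations $(T_i-t)(T_i+1)=0$; $T_iT_{i+1}T_i=T_{i+1}T_iT_{i+1}$ if $m>2$; $T_iT_j=T_jT_i$ if $j\ne i\pm1$; $\Pi T_i=T_{i+1}\Pi$. (For $m=1$ no $T_i$ are present: $\mathscr H_1$ is generated by $\Pi^{\pm1}$.) It acts (action denoted $\bullet$) on $\mathbb Q_{q,t}[X^{\pm1}]_{(m)}$ by $$T_i\bullet F=t\,s_i(F)+(t-1)\frac{F-s_i(F)}{1-X_iX_{i+1}^{-1}},\qquad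 \Pi\bullet F=X_1F(X_2,\dots,X_m,X_{m+1}),$$ where for $1\le i\le m-1$ $s_i$ swaps $X_i$ and $X_{i+1}$, and $s_0(F)=X_1X_0^{-1}F(X_0,X_2,\dots,X_{m-1},X_{m+1})$. For $1\le i\le m$, $Y_i:=t^{m-i}T_{i-1}\cdots T_1\,\Pi\,T_{m-1}^{-1}\cdots T_i^{-1}\in\mathscr H_m$; these commute and generate a Laurent polynomial subalgebra $\mathbb Q_{q,t}[Y^{\pm1}]_{(m)}\subset\mathscr H_m$. The map $\mathsf q_{(m)}:\mathbb Q_{q,t}[Y^{\pm1}]_{(m)}\to\mathbb Q_{q,t}[X^{\pm1}]_{(m)}$, $F(Y)\mapsto F(Y)\bullet1$, is a linear isomorphism, and $F\star G:=\mathsf q_{(m)}(\mathsf q_{(m)}^{-1}(F)\cdot\mathsf q_{(m)}^{-1}(G))$. $\mathbb E_n=\{\mathsf e:\{1,\dots,n\}\to\mathbb Z\mid 0\le\mathsf e(i)<i,\ \mathsf e(i)\le\mathsf e(i+1)\}$. The unit interval graph $\Gamma_{\mathsf e}$ ($\mathsf e\in\mathbb E_n$) has vertex set $\{1,\dots,n\}$ and an oriented edge $j\to i$ exactly when $\mathsf e(i)<j<i$. For $\Gamma=\Gamma_{\mathsf e}$, $\Gamma'=\Gamma_{\mathsf e'}$ with $\mathsf e\in\mathbb E_n$, $\mathsf e'\in\mathbb E_{n'}$, the ordered disjoint union is $\Gamma\cup\Gamma'=\Gamma_{\mathsf e\cup\mathsf e'}$ with $(\mathsf e\cup\mathsf e')(i)=\mathsf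 e(i)$ for $1\le i\le n$ and $(\mathsf e\cup\mathsf e')(i)=n+\mathsf e'(i-n)$ for $n+1\le i\le n+n'$. For integers $i,e$ with $e<i$, $\mathsf S^{(m)}_{i,e}:=1+T_i^{-1}+T_{i+1}^{-1}T_i^{-1}+\cdots+T_{m+e-1}^{-1}\cdots T_i^{-1}\in\mathscr H_m$ if $e\ge i-m$ ($m+e-i+1$ terms, indices modulo $m$), and $\mathsf S^{(m)}_{i,e}:=0$ if $e<i-m$. For $\Gamma=\Gamma_{\mathsf e}$ with $\mathsf e\in\mathbb E_n$, $\mathbf X^{(m)}_\Gamma(q,t):=t^{n(m-1)}\mathsf S^{(m)}_{1,\mathsf e(1)}\cdots\mathsf S^{(m)}_{n,\mathsf e(n)}\Pi^n\bullet1$. *)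

theory Defs
  imports
    "HOL-Library.Poly_Mapping"
    "HOL-Computational_Algebra.Polynomial"
    "HOL-Computational_Algebra.Fraction_Field"
    "HOL-Algebra.QuotRing"
    "HOL-Algebra.Generated_Rings"
    "Graph_Theory.Pair_Digraph"
begin

section \<open>Laurent polynomials over the field of rational functions in q and t\<close>

text \<open>The field of fractions of \<open>\<rat>[q][t]\<close>.\<close>

type_synonym qt = "rat poly poly fract"

definition qq :: qt where "qq = Fract [:[:0, 1:]:] 1"
definition tt :: qt where "tt = Fract [:0, 1:] 1"

text \<open>
  Laurent polynomials in variables indexed by all integers: a monomial is the finitely
  supported function giving the exponents. \<open>laurent m\<close> is the ring in \<open>X\<^sub>1, \<dots>, X\<^sub>m\<close>.
\<close>

type_synonym lpoly = "(int \<Rightarrow>\<^sub>0 int) \<Rightarrow>\<^sub>0 qt"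

definition laurent :: "nat \<Rightarrow> lpoly set" where
  "laurent m = {F. \<forall>a \<in> Poly_Mapping.keys F. Poly_Mapping.keys a \<subseteq> {1..int m}}"

definition lconst :: "qt \<Rightarrow> lpoly" where
  "lconst c = Poly_Mapping.single 0 c"

text \<open>
  \<open>Xpow m j e\<close> is \<open>X\<^sub>j\<close> to the power \<open>e\<close>, for any integer \<open>j\<close>, under the convention
  that \<open>X\<^sub>i\<^sub>+\<^sub>k\<^sub>m\<close> is \<open>X\<^sub>i\<close> times the \<open>(-k)\<close>-th power of \<open>q\<close> for \<open>1 \<le> i \<le> m\<close>.
\<close>

definition Xpow :: "nat \<Rightarrow> int \<Rightarrow> int \<Rightarrow> lpoly" where
  "Xpow m j e =
    (let i = (j - 1) mod int m + 1; k = (j - 1) div int m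
     in Poly_Mapping.single (Poly_Mapping.single i e) (qq powi (- k * e)))"

text \<open>\<open>lsubst m \<sigma> F\<close> is \<open>F(X\<^bsub>\<sigma>(1)\<^esub>, \<dots>, X\<^bsub>\<sigma>(m)\<^esub>)\<close>.\<close>

definition lsubst :: "nat \<Rightarrow> (int \<Rightarrow> int) \<Rightarrow> lpoly \<Rightarrow> lpoly" where
  "lsubst m \<sigma> F =
    (\<Sum>a\<in>Poly_Mapping.keys F. lconst (Poly_Mapping.lookup F a) *
       (\<Prod>j\<in>{1..int m}. Xpow m (\<sigma> j) (Poly_Mapping.lookup a j)))"


section \<open>The affine Hecke algebra\<close>

text \<open>\<open>GPiInv\<close> is the generator inverse to \<open>GPi\<close>.\<close>

datatype hgen = GT int | GPi | GPiInv

text \<open>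
  Words in the generators form a (noncommutative) monoid, written additively so that
  \<open>hword \<Rightarrow>\<^sub>0 qt\<close> with its convolution product is the free algebra.
\<close>

datatype hword = Word (letters: "hgen list")

instantiation hword :: monoid_add
begin

definition zero_hword :: hword where "zero_hword = Word []"

definition plus_hword :: "hword \<Rightarrow> hword \<Rightarrow> hword" where
  "plus_hword u v = Word (letters u @ letters v)"

instance
  by standard (simp_all add: zero_hword_def plus_hword_def)

end

type_synonym falg = "hword \<Rightarrow>\<^sub>0 qt"

text \<open>Representatives of \<open>\<int>/m\<int>\<close> indexing the \<open>T\<^sub>i\<close>; there is no \<open>T\<^sub>i\<close> if \<open>m = 1\<close>.\<close>

definition T_index :: "nat \<Rightarrow> int set" where
  "T_index m = (if m = 1 then {} else {0..<int m})"

definition hgens :: "nat \<Rightarrow> hgen set" where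
  "hgens m = GT ` T_index m \<union> {GPi, GPiInv}"

definition free_algebra :: "nat \<Rightarrow> falg ring" where
  "free_algebra m =
    \<lparr>carrier = {a. \<forall>w \<in> Poly_Mapping.keys a. set (letters w) \<subseteq> hgens m},
     mult = (*), one = 1, zero = 0, add = (+)\<rparr>"

definition fgen :: "hgen \<Rightarrow> falg" where
  "fgen g = Poly_Mapping.single (Word [g]) 1"

definition fconst :: "qt \<Rightarrow> falg" where
  "fconst c = Poly_Mapping.single 0 c"

definition fT :: "nat \<Rightarrow> int \<Rightarrow> falg" where
  "fT m i = fgen (GT (i mod int m))"

definition hecke_relations :: "nat \<Rightarrow> falg set" where
  "hecke_relations m =
     {(fT m i - fconst tt) * (fT m i + 1) | i. i \<in> T_index m}
   \<union> {fT m i * fT m (i + 1) * fT m i - fT m (i + 1) * fT m i * fT m (i + 1)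
       | i. i \<in> T_index m \<and> m > 2}
   \<union> {fT m i * fT m j - fT m j * fT m i
       | i j. i \<in> T_index m \<and> j \<in> T_index m
            \<and> j \<noteq> (i + 1) mod int m \<and> j \<noteq> (i - 1) mod int m}
   \<union> {fgen GPi * fT m i - fT m (i + 1) * fgen GPi | i. i \<in> T_index m}
   \<union> {fgen GPi * fgen GPiInv - 1, fgen GPiInv * fgen GPi - 1}"

definition hecke_ideal :: "nat \<Rightarrow> falg set" where
  "hecke_ideal m = Idl\<^bsub>free_algebra m\<^esub> (hecke_relations m)"

definition hecke :: "nat \<Rightarrow> falg set ring" where
  "hecke m = free_algebra m Quot hecke_ideal m"

definition hclass :: "nat \<Rightarrow> falg \<Rightarrow> falg set" where
  "hclass m a = hecke_ideal m +>\<^bsub>free_algebra m\<^esub> a"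

definition hconst :: "nat \<Rightarrow> qt \<Rightarrow> falg set" where
  "hconst m c = hclass m (fconst c)"

definition hT :: "nat \<Rightarrow> int \<Rightarrow> falg set" where
  "hT m i = hclass m (fT m i)"

definition hTinv :: "nat \<Rightarrow> int \<Rightarrow> falg set" where
  "hTinv m i = inv\<^bsub>hecke m\<^esub> (hT m i)"

definition hPi :: "nat \<Rightarrow> falg set" where
  "hPi m = hclass m (fgen GPi)"

definition mult_list :: "('a, 'b) monoid_scheme \<Rightarrow> 'a list \<Rightarrow> 'a" where
  "mult_list R xs = foldr (\<lambda>x y. x \<otimes>\<^bsub>R\<^esub> y) xs \<one>\<^bsub>R\<^esub>"


section \<open>The polynomial representation\<close>

definition s_op :: "nat \<Rightarrow> int \<Rightarrow> lpoly \<Rightarrow> lpoly" where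
  "s_op m i F =
    (if i = 0
     then Xpow m 1 1 * Xpow m 0 (- 1) * lsubst m (id(1 := 0, int m := int m + 1)) F
     else lsubst m (id(i := i + 1, i + 1 := i)) F)"

text \<open>The quotient in the Demazure-Lusztig operator is an exact division of Laurent polynomials.\<close>

definition T_op :: "nat \<Rightarrow> int \<Rightarrow> lpoly \<Rightarrow> lpoly" where
  "T_op m i F =
    lconst tt * s_op m i F +
    lconst (tt - 1) *
      (THE G. G \<in> laurent m \<and>
              G * (1 - Xpow m i 1 * Xpow m (i + 1) (- 1)) = F - s_op m i F)"

definition Pi_op :: "nat \<Rightarrow> lpoly \<Rightarrow> lpoly" where
  "Pi_op m F = Xpow m 1 1 * lsubst m (\<lambda>j. j + 1) F"

fun gen_op :: "nat \<Rightarrow> hgen \<Rightarrow> lpoly \<Rightarrow> lpoly" where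
  "gen_op m (GT i) F = T_op m i F"
| "gen_op m GPi F = Pi_op m F"
| "gen_op m GPiInv F = inv_into (laurent m) (Pi_op m) F"

definition free_act :: "nat \<Rightarrow> falg \<Rightarrow> lpoly \<Rightarrow> lpoly" where
  "free_act m a F =
    (\<Sum>w\<in>Poly_Mapping.keys a.
       lconst (Poly_Mapping.lookup a w) * foldr (gen_op m) (letters w) F)"

text \<open>
  The common value of the action of all representatives of a class (the operators satisfy the
  defining relations on \<open>laurent m\<close>).
\<close>

definition hecke_act :: "nat \<Rightarrow> falg set \<Rightarrow> lpoly \<Rightarrow> lpoly" where
  "hecke_act m h F = the_elem ((\<lambda>a. free_act m a F) ` h)"


section \<open>Quantum multiplication\<close>

definition hY :: "nat \<Rightarrow> int \<Rightarrow> falg set" where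
  "hY m i =
    hconst m (tt powi (int m - i)) \<otimes>\<^bsub>hecke m\<^esub>
    mult_list (hecke m)
      (map (hT m) (rev [1..i - 1]) @ [hPi m] @ map (hTinv m) (rev [i..int m - 1]))"

text \<open>The subalgebra of Laurent polynomials in \<open>Y\<^sub>1, \<dots>, Y\<^sub>m\<close>.\<close>

definition Y_subalgebra :: "nat \<Rightarrow> falg set set" where
  "Y_subalgebra m =
    generate_ring (hecke m)
      (range (hconst m) \<union> hY m ` {1..int m} \<union> (\<lambda>i. inv\<^bsub>hecke m\<^esub> (hY m i)) ` {1..int m})"

definition q_map :: "nat \<Rightarrow> falg set \<Rightarrow> lpoly" where
  "q_map m h = hecke_act m h 1"

definition q_inv :: "nat \<Rightarrow> lpoly \<Rightarrow> falg set" where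
  "q_inv m = inv_into (Y_subalgebra m) (q_map m)"

definition quantum_mult :: "nat \<Rightarrow> lpoly \<Rightarrow> lpoly \<Rightarrow> lpoly" where
  "quantum_mult m F G = q_map m (q_inv m F \<otimes>\<^bsub>hecke m\<^esub> q_inv m G)"


section \<open>Unit interval graphs\<close>

definition EE :: "nat \<Rightarrow> (int \<Rightarrow> int) set" where
  "EE n = {e \<in> extensional {1..int n}.
             (\<forall>i\<in>{1..int n}. 0 \<le> e i \<and> e i < i) \<and>
             (\<forall>i. 1 \<le> i \<and> i < int n \<longrightarrow> e i \<le> e (i + 1))}"

definition ui_graph :: "nat \<Rightarrow> (int \<Rightarrow> int) \<Rightarrow> int pair_pre_digraph" where
  "ui_graph n e =
    \<lparr>pverts = {1..int n},
     parcs = {(j, i). i \<in> {1..int n} \<and> j \<in> {1..int n} \<and> e i < j \<and> j < i}\<rparr>"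

definition unit_interval_graph :: "int pair_pre_digraph \<Rightarrow> bool" where
  "unit_interval_graph \<Gamma> \<longleftrightarrow> (\<exists>n. \<exists>e\<in>EE n. \<Gamma> = ui_graph n e)"

definition union_fun :: "nat \<Rightarrow> (int \<Rightarrow> int) \<Rightarrow> nat \<Rightarrow> (int \<Rightarrow> int) \<Rightarrow> int \<Rightarrow> int" where
  "union_fun n e n' e' =
    (\<lambda>i\<in>{1..int (n + n')}. if i \<le> int n then e i else int n + e' (i - int n))"

text \<open>
  A unit interval graph determines \<open>n\<close> and \<open>e\<close>, so that the descriptions here and in
  \<open>chromatic\<close> below are unique.
\<close>

definition ordered_union ::
  "int pair_pre_digraph \<Rightarrow> int pair_pre_digraph \<Rightarrow> int pair_pre_digraph" where
  "ordered_union \<Gamma> \<Gamma>' =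
    (THE \<Delta>. \<exists>n n'. \<exists>e\<in>EE n. \<exists>e'\<in>EE n'.
       \<Gamma> = ui_graph n e \<and> \<Gamma>' = ui_graph n' e' \<and>
       \<Delta> = ui_graph (n + n') (union_fun n e n' e'))"


section \<open>Truncated chromatic symmetric functions\<close>

text \<open>
  The summand for \<open>k\<close> is the product of the inverses of \<open>T\<^sub>i\<^sub>+\<^sub>k\<^sub>-\<^sub>1, \<dots>, T\<^sub>i\<close> in this order.
\<close>

definition hS :: "nat \<Rightarrow> int \<Rightarrow> int \<Rightarrow> falg set" where
  "hS m i e =
    (if e \<ge> i - int m
     then (\<Oplus>\<^bsub>hecke m\<^esub>k\<in>{0..int m + e - i}. mult_list (hecke m) (map (hTinv m) (rev [i..i + k - 1])))
     else \<zero>\<^bsub>hecke m\<^esub>)"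

definition chromatic_fun :: "nat \<Rightarrow> nat \<Rightarrow> (int \<Rightarrow> int) \<Rightarrow> lpoly" where
  "chromatic_fun m n e =
    hecke_act m
      (hconst m (tt ^ (n * (m - 1))) \<otimes>\<^bsub>hecke m\<^esub>
       mult_list (hecke m) (map (\<lambda>i. hS m i (e i)) [1..int n]) \<otimes>\<^bsub>hecke m\<^esub>
       hPi m [^]\<^bsub>hecke m\<^esub> n) 1"

definition chromatic :: "nat \<Rightarrow> int pair_pre_digraph \<Rightarrow> lpoly" where
  "chromatic m \<Gamma> = (THE F. \<exists>n. \<exists>e\<in>EE n. \<Gamma> = ui_graph n e \<and> F = chromatic_fun m n e)"

end

theory Submission
  imports Defs "HOL-Computational_Algebra.Polynomial_Factorial"
begin

text \<open>
  Write \<open>a\<close>, \<open>a'\<close> for the Hecke algebra elements defining the two chromatic functions. Conjugation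
  by \<open>\<Pi>\<^sup>n\<close> shifts all indices by \<open>n\<close>, so the function of the union is \<open>a a' \<bullet> 1\<close>. The vector
  \<open>v = a' \<bullet> 1\<close> is symmetric, that is \<open>T\<^sub>i v = t v\<close> for \<open>1 \<le> i < m\<close>, and so is \<open>1\<close>. Hence in the
  direct sum of two copies of the representation the span of the pairs
  \<open>(Y\<^sup>\<lambda> \<bullet> 1, Y\<^sup>\<lambda> \<bullet> v)\<close> is stable under the \<open>T\<^sub>i\<close> (Bernstein relations), hence under the whole
  Hecke algebra, and contains \<open>(h \<bullet> 1, h \<bullet> v)\<close> for every \<open>h\<close>. Since the \<open>Y\<^sup>\<lambda> \<bullet> 1\<close> are linearly
  independent, this span is the graph of a function \<open>h \<bullet> 1 \<mapsto> h \<bullet> v\<close>; so \<open>a\<close> may be replaced by the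
  element of the \<open>Y\<close>-subalgebra with the same value at \<open>1\<close>, which computes the quantum product.
  Independence is checked modulo \<open>t - 1\<close>, where \<open>T\<^sub>i\<close> becomes \<open>s\<^sub>i\<close> and \<open>Y\<^sup>\<lambda> \<bullet> 1\<close> becomes a power of
  \<open>q\<close> times \<open>X\<^sup>\<lambda>\<close>.
\<close>

text \<open>The Hecke algebra is given by generators and relations, with no basis at hand, and
  \<open>q_inv\<close> is just some right inverse of \<open>q_map\<close>. Working inside one module
  of pairs gets around both: an element \<open>h\<close> enters only through words in the
  generators, and any choice of preimage yields the same product. The action itself has to be
  justified, because \<open>hecke_act\<close> is well defined only if the operators satisfy the
  defining relations. Since \<open>T 0\<close> carries a twisted reflection, these relations are
  computed at \<open>i = 1\<close> and transported around the cycle by conjugation with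
  \<open>P\<close>. The value \<open>t = 1\<close> cannot be substituted in the coefficient field.
  It is substituted in the local ring of fractions regular at \<open>t = 1\<close>; a vanishing
  combination is first scaled so that all its coefficients lie there and one of them survives modulo
  \<open>t - 1\<close>. Symmetry of a chromatic vector comes from following, one factor at a time
  from the right, an interval of indices \<open>j\<close> on which \<open>T j\<close> acts by
  \<open>t\<close>; after the last factor this interval is \<open>1, ..., m - 1\<close>.\<close>

abbreviation "lookup \<equiv> Poly_Mapping.lookup"
abbreviation "single \<equiv> Poly_Mapping.single"
abbreviation "keys \<equiv> Poly_Mapping.keys"

section \<open>Linear extension from a basis\<close>

lemma lconst_simps [simp]:
  "lconst 0 = 0" "lconst 1 = 1"
  by (simp_all add: lconst_def)

lemma lconst_add: "lconst (c + d) = lconst c + lconst d"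
  by (simp add: lconst_def single_add)

lemma lconst_diff: "lconst (c - d) = lconst c - lconst d"
  by (simp add: lconst_def single_diff)

lemma lconst_uminus: "lconst (- c) = - lconst c"
  by (simp add: lconst_def single_uminus)

lemma lconst_mult: "lconst (c * d) = lconst c * lconst d"
  by (simp add: lconst_def mult_single)

lemma lconst_eq_0_iff [simp]: "lconst c = 0 \<longleftrightarrow> c = 0"
  unfolding lconst_def by (metis lookup_single_eq lookup_zero single_zero)

lemma lconst_single: "lconst c * single a d = single a (c * d)"
  by (simp add: lconst_def mult_single)

lemma poly_mapping_expansion: "(F :: 'k \<Rightarrow>\<^sub>0 'c::comm_monoid_add) = (\<Sum>a\<in>keys F. single a (lookup F a))"
  by (rule poly_mapping_eqI)
     (auto simp: lookup_sum lookup_single when_def in_keys_iff sum.delta'[OF finite_keys])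

text \<open>The single case is restricted to \<open>keys F\<close>, so that support conditions on
  \<open>F\<close>, such as membership in \<open>laurent m\<close> or in the free algebra, remain
  available there.\<close>

lemma keys_induct:
  fixes F :: "'k \<Rightarrow>\<^sub>0 'c::comm_monoid_add"
  assumes "P 0" and "\<And>a c. a \<in> keys F \<Longrightarrow> P (single a c)" and "\<And>G H. P G \<Longrightarrow> P H \<Longrightarrow> P (G + H)"
  shows "P F"
proof -
  have "P (\<Sum>a\<in>A. single a (lookup F a))" if "finite A" "A \<subseteq> keys F" for A
    using that by (induction A) (auto intro: assms)
  then show ?thesis by (metis poly_mapping_expansion finite_keys order_refl)
qed

lemma lookup_lconst_mult: "lookup (lconst c * F) a = c * lookup F a"
  by (rule keys_induct[of _ F]) (simp_all add: lconst_single lookup_single when_def lookup_add distrib_left)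

text \<open>Common form of \<open>lsubst\<close>, of \<open>free_act\<close> and of expansions in
  monomials of the operators \<open>Y i\<close>.\<close>

definition lin_ext :: "('k \<Rightarrow> lpoly) \<Rightarrow> ('k \<Rightarrow>\<^sub>0 qt) \<Rightarrow> lpoly" where
  "lin_ext \<phi> F = (\<Sum>a\<in>keys F. lconst (lookup F a) * \<phi> a)"

lemma lin_ext_0 [simp]: "lin_ext \<phi> 0 = 0"
  by (simp add: lin_ext_def)

lemma lin_ext_add: "lin_ext \<phi> (F + G) = lin_ext \<phi> F + lin_ext \<phi> G"
  unfolding lin_ext_def
  by (rule setsum_keys_plus_distrib[where f = "\<lambda>a c. lconst c * \<phi> a"])
     (simp_all add: lconst_add algebra_simps)

lemma lin_ext_single [simp]: "lin_ext \<phi> (single a c) = lconst c * \<phi> a"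
  by (cases "c = 0") (simp_all add: lin_ext_def)

lemma lin_ext_uminus: "lin_ext \<phi> (- F) = - lin_ext \<phi> F"
  by (metis add.right_inverse lin_ext_0 lin_ext_add minus_unique)

lemma lin_ext_diff: "lin_ext \<phi> (F - G) = lin_ext \<phi> F - lin_ext \<phi> G"
  by (metis diff_conv_add_uminus lin_ext_add lin_ext_uminus)

lemma lin_ext_lconst: "lin_ext \<phi> (lconst c * F) = lconst c * lin_ext \<phi> F"
  by (rule keys_induct[of _ F])
     (simp_all add: lconst_single lconst_mult lin_ext_add algebra_simps)

section \<open>Laurent polynomials\<close>

lemma laurent_0 [simp]: "0 \<in> laurent m"
  and laurent_1 [simp]: "1 \<in> laurent m"
  and laurent_lconst [simp]: "lconst c \<in> laurent m"
  by (auto simp: laurent_def lconst_def split: if_splits)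

lemma laurent_add [simp]: "F \<in> laurent m \<Longrightarrow> G \<in> laurent m \<Longrightarrow> F + G \<in> laurent m"
  unfolding laurent_def using keys_add[of F G] by fast

lemma laurent_uminus [simp]: "F \<in> laurent m \<Longrightarrow> - F \<in> laurent m"
  unfolding laurent_def by (simp add: in_keys_iff)

lemma laurent_diff [simp]: "F \<in> laurent m \<Longrightarrow> G \<in> laurent m \<Longrightarrow> F - G \<in> laurent m"
  using laurent_add[of F m "- G"] by simp

lemma laurent_mult [simp]:
  assumes "F \<in> laurent m" "G \<in> laurent m" shows "F * G \<in> laurent m"
proof -
  have "keys (a + b) \<subseteq> {1..int m}" if "a \<in> keys F" "b \<in> keys G" for a b
    using assms that keys_add[of a b] unfolding laurent_def by fast
  then show ?thesis
    using keys_mult[of F G] unfolding laurent_def by blast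
qed

lemma laurent_single: "keys a \<subseteq> {1..int m} \<Longrightarrow> single a c \<in> laurent m"
  by (auto simp: laurent_def split: if_splits)

lemma laurent_sum: "(\<And>x. x \<in> A \<Longrightarrow> f x \<in> laurent m) \<Longrightarrow> sum f A \<in> laurent m"
  by (induction A rule: infinite_finite_induct) auto

lemma laurent_prod: "(\<And>x. x \<in> A \<Longrightarrow> f x \<in> laurent m) \<Longrightarrow> prod f A \<in> laurent m"
  by (induction A rule: infinite_finite_induct) auto

lemma lin_ext_laurent: "(\<And>a. a \<in> keys F \<Longrightarrow> \<phi> a \<in> laurent m) \<Longrightarrow> lin_ext \<phi> F \<in> laurent m"
  unfolding lin_ext_def by (intro laurent_sum) auto

lemma laurent_induct [consumes 1, case_names zero single add]:
  assumes "F \<in> laurent m" "P 0" "\<And>a c. keys a \<subseteq> {1..int m} \<Longrightarrow> P (single a c)"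
    "\<And>G H. P G \<Longrightarrow> P H \<Longrightarrow> P (G + H)"
  shows "P F"
  by (rule keys_induct[of _ F]) (use assms in \<open>auto simp: laurent_def\<close>)

lemma qq_nonzero [simp]: "qq \<noteq> 0"
  by (simp add: qq_def Zero_fract_def eq_fract)

lemma tt_nonzero [simp]: "tt \<noteq> 0"
  by (simp add: tt_def Zero_fract_def eq_fract)

lemma Xpow_0 [simp]: "Xpow m j 0 = 1"
  by (simp add: Xpow_def Let_def)

lemma Xpow_add: "Xpow m j (e + e') = Xpow m j e * Xpow m j e'"
  by (simp add: Xpow_def Let_def mult_single single_add power_int_add[symmetric] algebra_simps)

lemma Xpow_inverse [simp]: "Xpow m j e * Xpow m j (- e) = 1" "Xpow m j (- e) * Xpow m j e = 1"
  by (simp_all flip: Xpow_add)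

lemma Xpow_nonzero [simp]: "Xpow m j e \<noteq> 0"
  using Xpow_inverse(1)[of m j e] by (metis mult_zero_left zero_neq_one)

lemma Xpow_basic: "1 \<le> j \<Longrightarrow> j \<le> int m \<Longrightarrow> Xpow m j e = single (single j e) 1"
  by (simp add: Xpow_def)

lemma Xpow_periodic:
  assumes "m \<ge> 1"
  shows "Xpow m (j + int m * k) e = lconst (qq powi (- k * e)) * Xpow m j e"
proof -
  have "(j + int m * k - 1) mod int m = (j - 1) mod int m"
    by (metis add_diff_eq add.commute diff_add_eq mod_mult_self2)
  moreover have "(j + int m * k - 1) div int m = k + (j - 1) div int m"
    using assms by (metis add.commute add_diff_eq div_mult_self2 nat_int_comparison(1) not_one_le_zero of_nat_0)
  ultimately show ?thesis
    by (simp add: Xpow_def Let_def lconst_single power_int_add[symmetric] algebra_simps)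
qed

lemma Xpow_laurent [simp]: "m \<ge> 1 \<Longrightarrow> Xpow m j e \<in> laurent m"
  unfolding Xpow_def Let_def
  by (rule laurent_single) (auto split: if_splits simp: add1_zle_eq)

definition Xmonomial :: "nat \<Rightarrow> (int \<Rightarrow> int) \<Rightarrow> (int \<Rightarrow>\<^sub>0 int) \<Rightarrow> lpoly" where
  "Xmonomial m \<sigma> a = (\<Prod>j\<in>{1..int m}. Xpow m (\<sigma> j) (lookup a j))"

lemma lsubst_lin_ext: "lsubst m \<sigma> = lin_ext (Xmonomial m \<sigma>)"
  by (simp add: lsubst_def lin_ext_def Xmonomial_def fun_eq_iff)

lemma Xmonomial_add: "Xmonomial m \<sigma> (a + b) = Xmonomial m \<sigma> a * Xmonomial m \<sigma> b"
  by (simp add: Xmonomial_def lookup_add Xpow_add prod.distrib)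

lemma Xmonomial_0 [simp]: "Xmonomial m \<sigma> 0 = 1"
  by (simp add: Xmonomial_def)

lemma lsubst_0 [simp]: "lsubst m \<sigma> 0 = 0"
  and lsubst_1 [simp]: "lsubst m \<sigma> 1 = 1"
  and lsubst_lconst [simp]: "lsubst m \<sigma> (lconst c) = lconst c"
  by (simp_all add: lsubst_lin_ext lconst_def single_one[symmetric] del: single_one)

lemmas lsubst_add = lin_ext_add[of "Xmonomial m \<sigma>" for m \<sigma>, folded lsubst_lin_ext]
lemmas lsubst_diff = lin_ext_diff[of "Xmonomial m \<sigma>" for m \<sigma>, folded lsubst_lin_ext]

lemma lsubst_mult: "lsubst m \<sigma> (F * G) = lsubst m \<sigma> F * lsubst m \<sigma> G"
proof (rule keys_induct[of _ F])
  fix a c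
  show "lsubst m \<sigma> (single a c * G) = lsubst m \<sigma> (single a c) * lsubst m \<sigma> G"
    by (rule keys_induct[of _ G])
       (simp_all add: lsubst_lin_ext mult_single lin_ext_add Xmonomial_add lconst_mult algebra_simps)
qed (simp_all add: lsubst_add algebra_simps)

lemma lsubst_prod: "lsubst m \<sigma> (prod f A) = (\<Prod>x\<in>A. lsubst m \<sigma> (f x))"
  by (induction A rule: infinite_finite_induct) (simp_all add: lsubst_mult)

lemma lsubst_laurent [simp]: "m \<ge> 1 \<Longrightarrow> lsubst m \<sigma> F \<in> laurent m"
  unfolding lsubst_lin_ext Xmonomial_def
  by (intro lin_ext_laurent laurent_prod) auto

lemma lsubst_cong:
  "(\<And>j. 1 \<le> j \<Longrightarrow> j \<le> int m \<Longrightarrow> \<sigma> j = \<tau> j) \<Longrightarrow> lsubst m \<sigma> F = lsubst m \<tau> F"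
  by (simp add: lsubst_def)

text \<open>Compatibility with the convention \<open>X_{j+m} = q^{-1} X_j\<close>. Since
  \<open>lsubst\<close> reads an index map only on \<open>1, ..., m\<close>, this is what makes its
  effect on \<open>Xpow m j\<close> the expected one for every integer \<open>j\<close>.\<close>

definition periodic :: "nat \<Rightarrow> (int \<Rightarrow> int) \<Rightarrow> bool" where
  "periodic m \<sigma> \<longleftrightarrow> (\<forall>j k. \<sigma> (j + int m * k) = \<sigma> j + int m * k)"

lemma lsubst_Xpow:
  assumes "m \<ge> 1" "periodic m \<sigma>"
  shows "lsubst m \<sigma> (Xpow m j e) = Xpow m (\<sigma> j) e"
proof -
  have basic: "lsubst m \<sigma> (Xpow m i e) = Xpow m (\<sigma> i) e" if "1 \<le> i" "i \<le> int m" for i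
  proof -
    have "(\<Prod>j\<in>{1..int m}. Xpow m (\<sigma> j) (lookup (single i e) j)) =
          (\<Prod>j\<in>{1..int m}. if j = i then Xpow m (\<sigma> j) e else 1)"
      by (rule prod.cong) (auto simp: lookup_single_not_eq)
    then show ?thesis
      using that by (simp add: Xpow_basic lsubst_lin_ext Xmonomial_def prod.delta)
  qed
  define i k where "i = (j - 1) mod int m + 1" and "k = (j - 1) div int m"
  have j: "j = i + int m * k"
    by (simp add: i_def k_def)
  have i: "1 \<le> i" "i \<le> int m"
    using assms(1) pos_mod_bound[of "int m" "j - 1"] unfolding i_def by (simp, linarith)
  have "lsubst m \<sigma> (Xpow m j e) = lconst (qq powi (- k * e)) * Xpow m (\<sigma> i) e"
    using assms(1) by (simp only: j Xpow_periodic lsubst_mult lsubst_lconst basic[OF i])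
  also have "\<dots> = Xpow m (\<sigma> j) e"
    using assms unfolding j periodic_def by (simp only: Xpow_periodic)
  finally show ?thesis .
qed

text \<open>Only the outer map has to be periodic: the inner one may send an index outside
  \<open>1, ..., m\<close>, and the outer one must then be evaluated there.\<close>

lemma lsubst_comp:
  assumes "m \<ge> 1" "periodic m \<sigma>"
  shows "lsubst m \<sigma> (lsubst m \<tau> F) = lsubst m (\<lambda>j. \<sigma> (\<tau> j)) F"
proof (rule keys_induct[of _ F])
  fix a c
  show "lsubst m \<sigma> (lsubst m \<tau> (single a c)) = lsubst m (\<lambda>j. \<sigma> (\<tau> j)) (single a c)"
    unfolding lsubst_lin_ext lin_ext_single
    unfolding Xmonomial_def lsubst_lin_ext[symmetric] lsubst_mult lsubst_prod lsubst_lconst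
    by (simp add: assms lsubst_Xpow)
qed (simp_all add: lsubst_add)

lemma single_sum: "single (sum f A) (1::qt) = (\<Prod>x\<in>A. single (f x) 1)"
proof (induction A rule: infinite_finite_induct)
  case (insert x A)
  then show ?case by (simp add: mult_single[of _ 1 _ 1, simplified] flip: insert.IH)
qed simp_all

lemma Xmonomial_id:
  assumes a: "keys a \<subseteq> {1..int m}"
  shows "Xmonomial m (\<lambda>j. j) a = single a 1"
proof -
  have "Xmonomial m (\<lambda>j. j) a = single (\<Sum>j\<in>{1..int m}. single j (lookup a j)) 1"
    by (simp add: Xmonomial_def Xpow_basic single_sum)
  also have "(\<Sum>j\<in>{1..int m}. single j (lookup a j)) = (\<Sum>j\<in>keys a. single j (lookup a j))"
    using a by (intro sum.mono_neutral_right) (auto simp: in_keys_iff)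
  also have "\<dots> = a"
    by (rule poly_mapping_expansion[symmetric])
  finally show ?thesis .
qed

lemma lsubst_id:
  assumes "F \<in> laurent m" shows "lsubst m (\<lambda>j. j) F = F"
  using assms
proof (induction F rule: laurent_induct)
  case (single a c)
  then have "lsubst m (\<lambda>j. j) (single a c) = lconst c * single a 1"
    by (simp only: lsubst_lin_ext lin_ext_single Xmonomial_id)
  then show ?case
    by (simp only: lconst_single mult_1_right)
qed (simp_all only: lsubst_0 lsubst_add)

section \<open>The polynomial representation\<close>

definition subring_set :: "qt set \<Rightarrow> bool" where
  "subring_set A \<longleftrightarrow> 1 \<in> A \<and> (\<forall>x\<in>A. \<forall>y\<in>A. x - y \<in> A \<and> x * y \<in> A)"

lemma subring_setD:
  assumes "subring_set A"
  shows "0 \<in> A" "1 \<in> A" "x \<in> A \<Longrightarrow> y \<in> A \<Longrightarrow> x + y \<in> A" "x \<in> A \<Longrightarrow> y \<in> A \<Longrightarrow> x - y \<in> A"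
    "x \<in> A \<Longrightarrow> y \<in> A \<Longrightarrow> x * y \<in> A"
proof -
  show 0: "0 \<in> A" using assms unfolding subring_set_def by (metis diff_self)
  show "x \<in> A \<Longrightarrow> y \<in> A \<Longrightarrow> x + y \<in> A"
    using assms 0 unfolding subring_set_def by (metis diff_0 diff_minus_eq_add)
qed (use assms in \<open>auto simp: subring_set_def\<close>)

text \<open>The subring is left arbitrary so that one exact division argument serves both the full
  coefficient field and the local ring at \<open>t = 1\<close>.\<close>

definition laurent_over :: "qt set \<Rightarrow> nat \<Rightarrow> lpoly set" where
  "laurent_over A m = {F \<in> laurent m. \<forall>a. lookup F a \<in> A}"

lemma laurent_overD: "F \<in> laurent_over A m \<Longrightarrow> F \<in> laurent m"
  by (simp add: laurent_over_def)

lemma laurent_over_UNIV [simp]: "laurent_over UNIV m = laurent m"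
  by (simp add: laurent_over_def)

lemma subring_set_UNIV [simp]: "subring_set UNIV"
  by (simp add: subring_set_def)

context
  fixes A :: "qt set" assumes A: "subring_set A"
begin

lemma laurent_over_single: "keys a \<subseteq> {1..int m} \<Longrightarrow> c \<in> A \<Longrightarrow> single a c \<in> laurent_over A m"
  using subring_setD(1)[OF A] by (simp add: laurent_over_def laurent_single lookup_single when_def)

lemma laurent_over_lconst: "c \<in> A \<Longrightarrow> lconst c \<in> laurent_over A m"
  unfolding lconst_def by (rule laurent_over_single) auto

lemma laurent_over_0: "0 \<in> laurent_over A m" and laurent_over_1: "1 \<in> laurent_over A m"
  using laurent_over_lconst[of 0] laurent_over_lconst[of 1] subring_setD(1,2)[OF A] by auto

lemma laurent_over_add: "F \<in> laurent_over A m \<Longrightarrow> G \<in> laurent_over A m \<Longrightarrow> F + G \<in> laurent_over A m"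
  and laurent_over_diff: "F \<in> laurent_over A m \<Longrightarrow> G \<in> laurent_over A m \<Longrightarrow> F - G \<in> laurent_over A m"
  using subring_setD(3,4)[OF A] by (simp_all add: laurent_over_def lookup_add lookup_minus)

lemma laurent_over_sum: "(\<And>x. x \<in> B \<Longrightarrow> f x \<in> laurent_over A m) \<Longrightarrow> sum f B \<in> laurent_over A m"
  by (induction B rule: infinite_finite_induct) (auto intro: laurent_over_add laurent_over_0)

lemma laurent_over_mult:
  assumes "F \<in> laurent_over A m" "G \<in> laurent_over A m"
  shows "F * G \<in> laurent_over A m"
proof -
  have "F * G = (\<Sum>a\<in>keys F. \<Sum>b\<in>keys G. single (a + b) (lookup F a * lookup G b))"
    by (subst poly_mapping_expansion[of F], subst poly_mapping_expansion[of G])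
       (simp add: sum_product mult_single)
  moreover have "single (a + b) (lookup F a * lookup G b) \<in> laurent_over A m"
    if "a \<in> keys F" "b \<in> keys G" for a b
  proof (rule laurent_over_single)
    show "keys (a + b) \<subseteq> {1..int m}"
      using assms that keys_add[of a b] unfolding laurent_over_def laurent_def by fast
    show "lookup F a * lookup G b \<in> A"
      using assms subring_setD(5)[OF A] by (simp add: laurent_over_def)
  qed
  ultimately show ?thesis by (simp add: laurent_over_sum)
qed

lemma laurent_over_prod: "(\<And>x. x \<in> B \<Longrightarrow> f x \<in> laurent_over A m) \<Longrightarrow> prod f B \<in> laurent_over A m"
  by (induction B rule: infinite_finite_induct) (auto intro: laurent_over_mult laurent_over_1)

lemma laurent_over_Xpow: "1 \<le> j \<Longrightarrow> j \<le> int m \<Longrightarrow> Xpow m j e \<in> laurent_over A m"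
  by (auto simp: Xpow_basic intro!: laurent_over_single subring_setD(2)[OF A] split: if_splits)

lemma laurent_over_lsubst:
  assumes F: "F \<in> laurent_over A m"
    and \<sigma>: "\<And>j e. 1 \<le> j \<Longrightarrow> j \<le> int m \<Longrightarrow> Xpow m (\<sigma> j) e \<in> laurent_over A m"
  shows "lsubst m \<sigma> F \<in> laurent_over A m"
  unfolding lsubst_def
  using F by (intro laurent_over_sum laurent_over_mult laurent_over_prod laurent_over_lconst \<sigma>)
     (auto simp: laurent_over_def)

end

text \<open>The simple reflection of the affine symmetric group: the transposition of
  \<open>i\<close> and \<open>i + 1\<close> extended periodically, so that
  \<open>lsubst_Xpow\<close> and \<open>lsubst_comp\<close> apply to it.\<close>

definition aff_swap :: "nat \<Rightarrow> int \<Rightarrow> int \<Rightarrow> int" where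
  "aff_swap m i j =
    (if (j - i) mod int m = 0 then j + 1 else if (j - i) mod int m = 1 then j - 1 else j)"

lemma periodic_aff_swap: "periodic m (aff_swap m i)"
proof -
  have "(j + int m * k - i) mod int m = (j - i) mod int m" for j k
    by (metis add_diff_eq add.commute diff_add_eq mod_mult_self2)
  then show ?thesis by (simp add: periodic_def aff_swap_def)
qed

lemma periodic_shift: "periodic m (\<lambda>j. j + k)"
  by (simp add: periodic_def)

lemma aff_swap_shift: "aff_swap m (i + 1) (j + 1) = aff_swap m i j + 1"
  by (simp add: aff_swap_def)

lemma aff_swap_mod: "aff_swap m (i mod int m) = aff_swap m i"
  by (simp add: aff_swap_def mod_diff_right_eq fun_eq_iff)

lemma aff_swap_basic:
  assumes "1 \<le> i" "i < int m" "1 \<le> j" "j \<le> int m"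
  shows "aff_swap m i j = (if j = i then i + 1 else if j = i + 1 then i else j)"
proof (cases "j \<ge> i")
  case True
  then have "(j - i) mod int m = j - i" using assms by (intro mod_pos_pos_trivial) auto
  then show ?thesis by (auto simp: aff_swap_def)
next
  case False
  have "(j - i) mod int m = (j - i + int m) mod int m" by simp
  also have "\<dots> = j - i + int m" using assms False by (intro mod_pos_pos_trivial) auto
  finally show ?thesis using assms False by (auto simp: aff_swap_def)
qed

section \<open>Operators of the polynomial representation, indexed by all integers\<close>

locale laurent_rep =
  fixes m :: nat
  assumes m_pos: "1 \<le> m"
begin

lemma m_pos_simps [simp]: "Suc 0 \<le> m" "m > 0" "m \<noteq> 0"
  using m_pos by auto

abbreviation "L \<equiv> laurent m"
abbreviation "X \<equiv> Xpow m"
abbreviation "P \<equiv> Pi_op m"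

definition Q :: "lpoly \<Rightarrow> lpoly" where "Q F = inv_into L P F"
definition s :: "int \<Rightarrow> lpoly \<Rightarrow> lpoly" where "s i = s_op m (i mod int m)"
definition T :: "int \<Rightarrow> lpoly \<Rightarrow> lpoly" where "T i = T_op m (i mod int m)"
text \<open>The inverse of \<open>T i\<close> read off from the quadratic relation:
  \<open>T (T + 1 - t) = t\<close>.\<close>

definition R :: "int \<Rightarrow> lpoly \<Rightarrow> lpoly" where
  "R i F = lconst (inverse tt) * (T i F + lconst (1 - tt) * F)"
definition u :: "int \<Rightarrow> lpoly" where "u i = X i 1 * X (i + 1) (- 1)"

lemma P_laurent [simp]: "P F \<in> L"
  by (simp add: Pi_op_def)

lemma P_add: "P (F + G) = P F + P G"
  and P_diff: "P (F - G) = P F - P G"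
  and P_lconst: "P (lconst c * F) = lconst c * P F"
  and P_mult: "P (G * F) = lsubst m (\<lambda>j. j + 1) G * P F"
  by (simp_all add: Pi_op_def lsubst_add lsubst_diff lsubst_mult algebra_simps)

lemma P_left: "F \<in> L \<Longrightarrow> lsubst m (\<lambda>j. j + (- 1)) (X 1 (- 1) * P F) = F"
proof -
  assume "F \<in> L"
  have "X 1 (- 1) * P F = lsubst m (\<lambda>j. j + 1) F"
    by (simp add: Pi_op_def mult.assoc[symmetric])
  then show ?thesis
    using \<open>F \<in> L\<close> by (simp only: lsubst_comp[OF m_pos periodic_shift]) (simp add: lsubst_id)
qed

lemma P_surj: "F \<in> L \<Longrightarrow> P (lsubst m (\<lambda>j. j + (- 1)) (X 1 (- 1) * F)) = F"
  unfolding Pi_op_def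
  by (subst lsubst_comp[OF m_pos periodic_shift])
     (simp add: lsubst_id mult.assoc[symmetric])

lemma P_inj: "inj_on P L"
  by (metis P_left inj_onI)

lemma P_image: "P ` L = L"
proof
  show "L \<subseteq> P ` L"
    using m_pos by (metis P_surj image_eqI lsubst_laurent subsetI)
qed auto

lemma Q_laurent [simp]: "F \<in> L \<Longrightarrow> Q F \<in> L"
  unfolding Q_def by (metis P_image inv_into_into)

lemma PQ [simp]: "F \<in> L \<Longrightarrow> P (Q F) = F"
  unfolding Q_def by (metis P_image f_inv_into_f)

lemma QP [simp]: "F \<in> L \<Longrightarrow> Q (P F) = F"
  unfolding Q_def by (rule inv_into_f_f[OF P_inj])

lemma Q_eqI: "F \<in> L \<Longrightarrow> P F = G \<Longrightarrow> Q G = F"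
  by auto

lemma Q_add: "F \<in> L \<Longrightarrow> G \<in> L \<Longrightarrow> Q (F + G) = Q F + Q G"
  and Q_lconst: "F \<in> L \<Longrightarrow> Q (lconst c * F) = lconst c * Q F"
  by (auto intro!: Q_eqI simp: P_add P_lconst)

text \<open>Replacing \<open>i\<close> by \<open>i + k m\<close> multiplies \<open>X_i\<close> by
  \<open>q^{-k}\<close> and the inverse of \<open>X_{i+1}\<close> by \<open>q^k\<close>; the two
  factors cancel.\<close>

lemma u_mod [simp]: "u (i mod int m) = u i"
proof -
  define k r where "k = i div int m" and "r = i mod int m"
  have i: "i = r + int m * k" "i + 1 = (r + 1) + int m * k" by (simp_all add: k_def r_def)
  have "u i = (lconst (qq powi (- k * 1)) * lconst (qq powi (- k * - 1))) * u r"
    unfolding u_def i(2) unfolding i(1) Xpow_periodic[OF m_pos] by (simp only: mult_ac)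
  also have "\<dots> = u r"
    by (simp flip: lconst_mult power_int_add)
  finally show ?thesis by (simp add: r_def)
qed

lemma s_mod [simp]: "s (i mod int m) = s i" and T_mod [simp]: "T (i mod int m) = T i"
  and R_mod [simp]: "R (i mod int m) = R i"
  by (simp_all add: s_def T_def R_def fun_eq_iff)

lemma mod_invariant: "(\<And>i. f (i mod int m) = f i) \<Longrightarrow> i mod int m = j mod int m \<Longrightarrow> f i = f j"
  by metis

lemmas T_cong = mod_invariant[of T, OF T_mod]

lemma X_inverse_mult [simp]: "X j e * (X j (- e) * F) = F" "X j (- e) * (X j e * F) = F"
  by (simp_all add: mult.assoc[symmetric])

lemma s_basic:
  assumes "1 \<le> i" "i < int m"
  shows "s i F = lsubst m (aff_swap m i) F"
  using assms unfolding s_def s_op_def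
  by (auto intro!: lsubst_cong simp: aff_swap_basic)

end

locale laurent_rep2 = laurent_rep + assumes m2: "2 \<le> m"
begin

text \<open>Replaces the index map in the definition of \<open>s_op\<close>, which is meaningful
  only on \<open>1, ..., m\<close>, by its periodic version.\<close>

lemma s_0: "s 0 F = X 1 1 * X 0 (- 1) * lsubst m (aff_swap m 0) F"
proof -
  have "aff_swap m 0 j = (id(1 := 0, int m := int m + 1)) j" if "1 \<le> j" "j \<le> int m" for j
  proof (cases "j = int m")
    case False
    then have "j mod int m = j" using that by (intro mod_pos_pos_trivial) auto
    then show ?thesis using that False by (auto simp: aff_swap_def)
  qed (use m2 in \<open>auto simp: aff_swap_def\<close>)
  then have "lsubst m (aff_swap m 0) F = lsubst m (id(1 := 0, int m := int m + 1)) F"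
    by (rule lsubst_cong)
  then show ?thesis by (simp add: s_def s_op_def)
qed

lemma s_laurent [simp]: "s i F \<in> L"
  unfolding s_def s_op_def by simp

lemma lsubst_shift_swap:
  "lsubst m (\<lambda>j. j + 1) (lsubst m (aff_swap m i) F) = lsubst m (aff_swap m (i + 1)) (lsubst m (\<lambda>j. j + 1) F)"
  by (simp add: lsubst_comp periodic_shift periodic_aff_swap aff_swap_shift)

lemma residue_cases:
  obtains (zero) "i mod int m = 0" "(i + 1) mod int m = 1"
    | (last) "i mod int m = int m - 1" "(i + 1) mod int m = 0"
    | (mid) r where "i mod int m = r" "(i + 1) mod int m = r + 1" "1 \<le> r" "r + 1 < int m"
proof -
  define r where "r = i mod int m"
  have r: "0 \<le> r" "r < int m" using m2 by (auto simp: r_def)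
  have e: "(i + 1) mod int m = (r + 1) mod int m" by (simp add: r_def mod_add_left_eq)
  show ?thesis
  proof (cases "r + 1 = int m")
    case True
    then show ?thesis using e by (intro last) (auto simp: r_def)
  next
    case False
    then have e': "(i + 1) mod int m = r + 1" using r e by (simp add: mod_pos_pos_trivial)
    show ?thesis
    proof (cases "r = 0")
      case True then show ?thesis using e' zero by (simp add: r_def)
    next
      case F2: False
      with r False have "1 \<le> r" "r + 1 < int m" by linarith+
      with e' show ?thesis by (intro mid[of r]) (simp_all only: r_def)
    qed
  qed
qed

text \<open>The substitutions are conjugate by the shift; what has to match is the factor
  \<open>X_1\<close> of \<open>P\<close>. A reflection in the middle range fixes it. For
  \<open>i = 0\<close> the factor of \<open>s 0\<close> is shifted to \<open>X_2 / X_1\<close>,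
  turning \<open>X_1\<close> into \<open>X_2 = s 1 X_1\<close>; for \<open>i = m - 1\<close> the
  factor \<open>X_1 / X_0\<close> of \<open>s 0\<close> repairs the image \<open>X_0\<close> of
  \<open>X_1\<close>.\<close>

lemma P_s: "P (s i F) = s (i + 1) (P F)"
proof -
  have s: "s (i + 1) = s ((i + 1) mod int m)" "s i = s (i mod int m)" by simp_all
  note simps = Pi_op_def lsubst_mult lsubst_Xpow[OF m_pos periodic_aff_swap]
     lsubst_Xpow[OF m_pos periodic_shift] lsubst_shift_swap
  show ?thesis
  proof (cases i rule: residue_cases)
    case zero
    have "aff_swap m 1 1 = 2" by (simp add: aff_swap_def)
    then show ?thesis
      unfolding s zero s_0 using m2 by (simp add: s_basic simps mult.assoc)
  next
    case last
    have "aff_swap m 0 1 = 0" "aff_swap m (int m - 1 + 1) = aff_swap m 0"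
      using m2 aff_swap_mod[of m "int m"] by (simp_all add: aff_swap_def)
    then show ?thesis
      unfolding s last s_0 using m2 by (simp add: s_basic simps mult.assoc)
  next
    case (mid r)
    then have "aff_swap m (r + 1) 1 = 1" by (simp add: aff_swap_basic)
    then show ?thesis
      unfolding s mid(1,2) using mid by (simp add: s_basic simps)
  qed
qed

lemma P_u: "P (G * (1 - u i)) = P G * (1 - u (i + 1))"
proof -
  have "lsubst m (\<lambda>j. j + 1) (u i) = u (i + 1)"
    by (simp add: lsubst_mult u_def lsubst_Xpow[OF m_pos periodic_shift] add.commute)
  then show ?thesis
    unfolding mult.commute[of G] P_mult by (simp add: lsubst_diff mult.commute)
qed

text \<open>As \<open>m \<ge> 2\<close>, the indices \<open>i\<close> and \<open>i + 1\<close> have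
  different residues, so \<open>u i\<close> is a nonconstant monomial. This is what permits
  cancelling \<open>1 - u i\<close>.\<close>

lemma u_neq_1 [simp]: "u i \<noteq> 1"
proof
  assume *: "u i = 1"
  define k l where "k = (i - 1) mod int m + 1" and "l = i mod int m + 1"
  have "k \<noteq> l"
    unfolding k_def l_def by (cases "i - 1" rule: residue_cases) (use m2 in auto)
  obtain c d where "X i 1 = single (single k 1) c" "X (i + 1) (- 1) = single (single l (- 1)) d"
    unfolding Xpow_def Let_def k_def l_def by simp
  then have "single (single k 1 + single l (- 1)) (c * d) = (single 0 1 :: lpoly)"
    using * by (simp add: u_def mult_single)
  then have "single k 1 + single l (- 1) = (0 :: int \<Rightarrow>\<^sub>0 int)"
    by (metis keys_single insert_not_empty singleton_inject zero_neq_one)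
  then have "lookup (single k 1 + single l (- 1)) k = (0::int)" by simp
  then show False using \<open>k \<noteq> l\<close> by (simp add: lookup_add lookup_single_not_eq)
qed

lemma X_swap:
  "1 \<le> i \<Longrightarrow> i < int m \<Longrightarrow> 1 \<le> j \<Longrightarrow> j \<le> int m \<Longrightarrow>
   s i (X j e) = X (if j = i then i + 1 else if j = i + 1 then i else j) e"
  by (simp add: s_basic lsubst_Xpow periodic_aff_swap aff_swap_basic)

text \<open>The elements with this divisibility form a ring, by the twisted Leibniz rule
  \<open>F F' - s(F F') = (F - s F) F' + s F (F' - s F')\<close>. It contains the constants and all
  powers of the variables, hence everything.\<close>

lemma divided_difference_basic:
  assumes A: "subring_set A" and i: "1 \<le> i" "i < int m" and F: "F \<in> laurent_over A m"
  shows "\<exists>G\<in>laurent_over A m. G * (1 - u i) = F - s i F"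
proof -
  define S where "S = {F \<in> laurent_over A m. s i F \<in> laurent_over A m \<and> (\<exists>G\<in>laurent_over A m. G * (1 - u i) = F - s i F)}"
  note over = laurent_over_add[OF A] laurent_over_diff[OF A] laurent_over_mult[OF A]
    laurent_over_lconst[OF A] laurent_over_0[OF A] laurent_over_1[OF A] laurent_over_Xpow[OF A]
  note sub = s_basic[OF i] lsubst_mult lsubst_add
  have SI: "F \<in> S" if "F \<in> laurent_over A m" "s i F \<in> laurent_over A m" "G \<in> laurent_over A m"
    "G * (1 - u i) = F - s i F" for F G
    using that by (auto simp: S_def)
  have add: "F + F' \<in> S" if F: "F \<in> S" and F': "F' \<in> S" for F F'
  proof -
    obtain G G' where "G \<in> laurent_over A m" "G * (1 - u i) = F - s i F"
      "G' \<in> laurent_over A m" "G' * (1 - u i) = F' - s i F'" using F F' unfolding S_def by blast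
    moreover from this have "(G + G') * (1 - u i) = F + F' - s i (F + F')"
      unfolding distrib_right sub by simp
    ultimately show ?thesis using F F'
      by (intro SI[of _ "G + G'"]) (auto simp: S_def sub intro!: over)
  qed
  have mult: "F * F' \<in> S" if F: "F \<in> S" and F': "F' \<in> S" for F F'
  proof -
    obtain G G' where G: "G \<in> laurent_over A m" "G * (1 - u i) = F - s i F"
      "G' \<in> laurent_over A m" "G' * (1 - u i) = F' - s i F'" using F F' unfolding S_def by blast
    have "(G * F' + s i F * G') * (1 - u i) = (G * (1 - u i)) * F' + s i F * (G' * (1 - u i))"
      by (simp add: algebra_simps)
    also have "\<dots> = F * F' - s i (F * F')"
      unfolding G sub by (simp add: algebra_simps)
    finally show ?thesis
      using F F' G by (intro SI[of _ "G * F' + s i F * G'"]) (auto simp: S_def sub intro!: over)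
  qed
  have const: "lconst c \<in> S" if "c \<in> A" for c
    using that by (intro SI[of _ 0]) (auto simp: sub intro!: over)
  \<comment> \<open>Geometric sums for exponents of both signs; in the downward step
    \<open>v\<close> is the inverse of \<open>u i\<close>.\<close>
  have geom: "\<exists>G\<in>laurent_over A m. G * (1 - u i) = 1 - X i k * X (i + 1) (- k)" for k
  proof (induction k rule: int_induct[where k = 0])
    case base
    then show ?case using over by (auto intro!: bexI[of _ 0])
  next
    case (step1 k)
    then obtain G where G: "G \<in> laurent_over A m" "G * (1 - u i) = 1 - X i k * X (i + 1) (- k)" by auto
    have "(1 + u i * G) * (1 - u i) = 1 - u i + u i * (G * (1 - u i))" by (simp add: algebra_simps)
    also have "\<dots> = 1 - X i (k + 1) * X (i + 1) (- (k + 1))"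
      unfolding G unfolding u_def minus_add_distrib Xpow_add by (simp add: algebra_simps)
    finally show ?case
      using i G by (intro bexI[of _ "1 + u i * G"]) (auto simp: u_def intro!: over)
  next
    case (step2 k)
    define v where "v = X i (- 1) * X (i + 1) 1"
    have uv: "u i * v = 1" by (simp add: u_def v_def mult.left_commute[of "X (i + 1) (- 1)"] mult.assoc)
    from step2 obtain G where G: "G \<in> laurent_over A m" "G * (1 - u i) = 1 - X i k * X (i + 1) (- k)" by auto
    have "(v * G - v) * (1 - u i) = v * (G * (1 - u i)) - v + u i * v" by (simp add: algebra_simps)
    also have "\<dots> = 1 - X i (k + - 1) * X (i + 1) (- k + 1)"
      unfolding G uv unfolding v_def Xpow_add by (simp add: algebra_simps)
    finally show ?case
      using i G by (intro bexI[of _ "v * G - v"]) (auto simp: v_def intro!: over)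
  qed
  have var: "X j e \<in> S" if j: "1 \<le> j" "j \<le> int m" for j e
  proof -
    consider "j = i" | "j = i + 1" | "j \<noteq> i" "j \<noteq> i + 1" by auto
    then show ?thesis
    proof cases
      case 1
      obtain G where G: "G \<in> laurent_over A m" "G * (1 - u i) = 1 - X i (- e) * X (i + 1) e"
        using geom[of "- e"] by auto
      have "(X i e * G) * (1 - u i) = X i e - X (i + 1) e"
        unfolding mult.assoc G by (simp add: right_diff_distrib)
      then show ?thesis using 1 i j G
        by (intro SI[of _ "X i e * G"]) (auto simp: X_swap intro!: over)
    next
      case 2
      obtain G where G: "G \<in> laurent_over A m" "G * (1 - u i) = 1 - X i e * X (i + 1) (- e)"
        using geom[of e] by auto
      have "(X (i + 1) e * G) * (1 - u i) = X (i + 1) e - X i e"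
        unfolding mult.assoc G by (simp add: right_diff_distrib mult.left_commute)
      then show ?thesis using 2 i j G
        by (intro SI[of _ "X (i + 1) e * G"]) (auto simp: X_swap intro!: over)
    next
      case 3
      then show ?thesis using i j
        by (intro SI[of _ 0]) (auto simp: X_swap intro!: over)
    qed
  qed
  have prod: "prod f B \<in> S" if "\<And>x. x \<in> B \<Longrightarrow> f x \<in> S" for f and B :: "int set"
    using that const[of 1] subring_setD[OF A]
    by (induction B rule: infinite_finite_induct) (auto intro: mult)
  \<comment> \<open>The identity substitution exhibits \<open>F\<close> as a sum of products of
    constants and powers of variables.\<close>
  have "lsubst m (\<lambda>j. j) F \<in> S"
  proof -
    have sum: "sum f B \<in> S" if "\<And>x. x \<in> B \<Longrightarrow> f x \<in> S" for f and B :: "(int \<Rightarrow>\<^sub>0 int) set"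
      using that const[of 0] subring_setD[OF A]
      by (induction B rule: infinite_finite_induct) (auto intro: add)
    show ?thesis unfolding lsubst_def
      using F by (intro sum mult const prod var) (auto simp: laurent_over_def)
  qed
  then show ?thesis
    using F by (auto simp: S_def lsubst_id[OF laurent_overD])
qed

text \<open>The twisted reflection \<open>s 0\<close> is conjugate by \<open>P\<close> to
  \<open>s (m - 1)\<close>, for which the division is already known; every other residue is covered
  directly.\<close>

lemma divided_difference_exists: "F \<in> L \<Longrightarrow> \<exists>G\<in>L. G * (1 - u i) = F - s i F"
proof -
  have basic: "\<exists>G\<in>L. G * (1 - u i) = F - s i F" if "1 \<le> i" "i < int m" "F \<in> L" for i F
    using divided_difference_basic[OF subring_set_UNIV that(1,2)] that(3) by simp
  have zero: "\<exists>G\<in>L. G * (1 - u 0) = F - s 0 F" if F: "F \<in> L" for F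
  proof -
    have eq: "s (int m) = s 0" "u (int m) = u 0"
      using s_mod[of "int m"] u_mod[of "int m"] by simp_all
    obtain G where G: "G \<in> L" "G * (1 - u (int m - 1)) = Q F - s (int m - 1) (Q F)"
      using basic[of "int m - 1" "Q F"] m2 Q_laurent[OF F] by auto
    from arg_cong[OF G(2), of P] have "P G * (1 - u 0) = F - s 0 F"
      using that by (simp add: P_u P_diff P_s eq)
    then show ?thesis using G by auto
  qed
  assume "F \<in> L"
  have "i mod int m = 0 \<or> 1 \<le> i mod int m" "i mod int m < int m"
    using pos_mod_sign[of "int m" i] by (simp_all del: pos_mod_sign, linarith)
  then have "\<exists>G\<in>L. G * (1 - u (i mod int m)) = F - s (i mod int m) F"
    using basic[of "i mod int m" F] zero[of F] \<open>F \<in> L\<close>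
    by (cases "i mod int m = 0") (simp_all del: u_mod s_mod)
  then show ?thesis by simp
qed

definition D :: "int \<Rightarrow> lpoly \<Rightarrow> lpoly" where
  "D i F = (THE G. G \<in> L \<and> G * (1 - u i) = F - s i F)"

lemma D_ex1: "F \<in> L \<Longrightarrow> \<exists>!G. G \<in> L \<and> G * (1 - u i) = F - s i F"
proof -
  assume "F \<in> L"
  moreover have "1 - u i \<noteq> 0" by (metis u_neq_1 right_minus_eq)
  ultimately show ?thesis
    using divided_difference_exists[of F i] by (metis mult_right_cancel)
qed

lemma D_laurent [simp]: "F \<in> L \<Longrightarrow> D i F \<in> L"
  and D_mult: "F \<in> L \<Longrightarrow> D i F * (1 - u i) = F - s i F"
  using theI'[OF D_ex1[of F i]] by (auto simp: D_def)

lemma D_eqI: "F \<in> L \<Longrightarrow> G * (1 - u i) = F - s i F \<Longrightarrow> D i F = G"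
proof -
  assume "F \<in> L" "G * (1 - u i) = F - s i F"
  moreover have "1 - u i \<noteq> 0" by (metis u_neq_1 right_minus_eq)
  ultimately show ?thesis by (metis D_mult mult_right_cancel)
qed

lemma T_D: "T i F = lconst tt * s i F + lconst (tt - 1) * D i F"
  unfolding T_def T_op_def D_def
  by (simp add: s_def[symmetric] u_def[symmetric])

lemma T_laurent [simp]: "F \<in> L \<Longrightarrow> T i F \<in> L"
  by (simp add: T_D)

lemma R_laurent [simp]: "F \<in> L \<Longrightarrow> R i F \<in> L"
  by (simp add: R_def)

lemma s_add: "s i (F + G) = s i F + s i G" and s_lconst: "s i (lconst c * F) = lconst c * s i F"
  unfolding s_def s_op_def by (simp_all add: lsubst_add lsubst_mult algebra_simps)

lemma s_diff: "s i (F - G) = s i F - s i G"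
  using s_add[of i "F - G" G] by simp

lemma D_add: "F \<in> L \<Longrightarrow> G \<in> L \<Longrightarrow> D i (F + G) = D i F + D i G"
  and D_lconst: "F \<in> L \<Longrightarrow> D i (lconst c * F) = lconst c * D i F"
proof -
  assume F: "F \<in> L"
  show "D i (lconst c * F) = lconst c * D i F"
    by (rule D_eqI) (simp_all add: F mult.assoc D_mult s_lconst flip: right_diff_distrib)
  assume G: "G \<in> L"
  show "D i (F + G) = D i F + D i G"
    by (rule D_eqI) (simp_all add: F G distrib_right D_mult s_add)
qed

lemma T_add: "F \<in> L \<Longrightarrow> G \<in> L \<Longrightarrow> T i (F + G) = T i F + T i G"
  and T_lconst: "F \<in> L \<Longrightarrow> T i (lconst c * F) = lconst c * T i F"
  by (simp_all add: T_D s_add s_lconst D_add D_lconst distrib_left mult.left_commute)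

lemma P_T: "F \<in> L \<Longrightarrow> P (T i F) = T (i + 1) (P F)"
proof -
  assume F: "F \<in> L"
  have "P (D i F) = D (i + 1) (P F)"
    using F arg_cong[OF D_mult[OF F, of i], of P] by (intro D_eqI[symmetric]) (auto simp: P_u P_s P_diff)
  then show ?thesis by (simp add: T_D P_add P_lconst P_s)
qed

text \<open>The form in which \<open>T i\<close> is computed with: relations between the operators
  are multiplied by factors \<open>1 - u j\<close>, expanded by this identity, and the factors are
  cancelled at the end.\<close>

lemma T_spec:
  assumes "F \<in> L"
  shows "T i F * (1 - u i) = (lconst tt - 1) * F + (1 - lconst tt * u i) * s i F"
proof -
  have "T i F * (1 - u i) = lconst tt * s i F * (1 - u i) + (lconst tt - 1) * (D i F * (1 - u i))"
    unfolding T_D lconst_diff lconst_simps by (simp add: algebra_simps)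
  also have "\<dots> = (lconst tt - 1) * F + (1 - lconst tt * u i) * s i F"
    unfolding D_mult[OF assms] by (simp add: algebra_simps)
  finally show ?thesis .
qed

end

section \<open>The defining relations\<close>

context
  fixes t x y f f1 f2 f12 f21 f121 g1 g2 g3 g4 h1 h2 w :: "'a::field"
  assumes nz: "x \<noteq> 0" "x \<noteq> 1" "y \<noteq> 1" "x * y \<noteq> 1"
    and g: "g1 * (1 - x) = (t - 1) * f + (1 - t * x) * f1"
      "g2 * (1 - x * y) = (t - 1) * f2 + (1 - t * (x * y)) * f21"
      "g3 * (x - 1) = (t - 1) * x * f1 + (x - t) * f"
      "g4 * (1 - y) = (t - 1) * f12 + (1 - t * y) * f121"
    and h: "h1 * (1 - y) = (t - 1) * g1 + (1 - t * y) * g2"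
      "h2 * (1 - x * y) = (t - 1) * g3 + (1 - t * (x * y)) * g4"
    and w: "w * (1 - x) = (t - 1) * h1 + (1 - t * x) * h2"
begin

text \<open>Dictionary: \<open>x = u 1\<close>, \<open>y = u 2\<close>; the digits after
  \<open>f\<close> list the reflections applied to it, so \<open>f12 = s 1 (s 2 f)\<close>. Further
  \<open>g1, g2, g3, g4\<close> are \<open>T 1 f\<close> and its images under \<open>s 2\<close>,
  \<open>s 1\<close> and \<open>s 1 s 2\<close>, \<open>h1 = T 2 (T 1 f)\<close>,
  \<open>h2 = s 1 h1\<close> and \<open>w = T 1 h1\<close>. The result expands
  \<open>T 1 T 2 T 1\<close> over the six images of \<open>f\<close> under the symmetric
  group.\<close>

lemma braid_expansion:
  "w = ((t - 1)\<^sup>2 / (1 - x)\<^sup>2 * ((t - 1) / (1 - y)) + (1 - t * x) / (1 - x) * ((t - 1) / (1 - x * y)) * ((x - t) / (x - 1))) * f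
     + (1 - t * x) / (1 - x) * ((t - 1) / (1 - x)) * ((t - 1) / (1 - y) - x * (t - 1) / (1 - x * y)) * f1
     + (t - 1) / (1 - x) * ((1 - t * y) / (1 - y)) * ((t - 1) / (1 - x * y)) * f2
     + (t - 1) / (1 - x) * ((1 - t * y) / (1 - y)) * ((1 - t * (x * y)) / (1 - x * y)) * f21
     + (1 - t * x) / (1 - x) * ((1 - t * (x * y)) / (1 - x * y)) * ((t - 1) / (1 - y)) * f12
     + (1 - t * x) / (1 - x) * ((1 - t * (x * y)) / (1 - x * y)) * ((1 - t * y) / (1 - y)) * f121"
proof -
  have nz': "1 - x \<noteq> 0" "1 - y \<noteq> 0" "1 - x * y \<noteq> 0" "x - 1 \<noteq> 0"
    using nz by auto
  define a b c where "a = inverse (1 - x)" and "b = inverse (1 - y)" and "c = inverse (1 - x * y)"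
  have inv: "z = r * inverse d" if "z * d = r" "d \<noteq> 0" for z r d :: 'a
    using that by (auto simp: field_simps)
  have "inverse (x - 1) = - a" unfolding a_def by (metis inverse_minus_eq minus_diff_eq)
  then have xa: "inverse (x - 1) = - a" .
  show ?thesis
    unfolding inv[OF w nz'(1)] inv[OF h(1) nz'(2)] inv[OF h(2) nz'(3)]
    unfolding inv[OF g(1) nz'(1)] inv[OF g(2) nz'(3)] inv[OF g(3) nz'(4)] inv[OF g(4) nz'(2)]
    unfolding divide_inverse power_inverse[symmetric] xa a_def[symmetric] b_def[symmetric] c_def[symmetric]
    by (simp add: algebra_simps power2_eq_square)
qed

end

text \<open>Exchanging the indices 1 and 2 turns one expansion into the other. The coefficients at
  \<open>f121\<close>, \<open>f12\<close> and \<open>f21\<close> then agree by commutativity, and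
  those at \<open>f\<close>, \<open>f1\<close> and \<open>f2\<close> by three identities of rational
  functions.\<close>

lemma braid_field:
  fixes t x y f f1 f2 f12 f21 f121 g1 g2 g3 g4 h1 h2 w g1' g2' g3' g4' h1' h2' w' :: "'a::field"
  assumes nz: "x \<noteq> 0" "y \<noteq> 0" "x \<noteq> 1" "y \<noteq> 1" "x * y \<noteq> 1"
    and g: "g1 * (1 - x) = (t - 1) * f + (1 - t * x) * f1"
      "g2 * (1 - x * y) = (t - 1) * f2 + (1 - t * (x * y)) * f21"
      "g3 * (x - 1) = (t - 1) * x * f1 + (x - t) * f"
      "g4 * (1 - y) = (t - 1) * f12 + (1 - t * y) * f121"
    and h: "h1 * (1 - y) = (t - 1) * g1 + (1 - t * y) * g2"
      "h2 * (1 - x * y) = (t - 1) * g3 + (1 - t * (x * y)) * g4"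
    and w: "w * (1 - x) = (t - 1) * h1 + (1 - t * x) * h2"
    and g': "g1' * (1 - y) = (t - 1) * f + (1 - t * y) * f2"
      "g2' * (1 - x * y) = (t - 1) * f1 + (1 - t * (x * y)) * f12"
      "g3' * (y - 1) = (t - 1) * y * f2 + (y - t) * f"
      "g4' * (1 - x) = (t - 1) * f21 + (1 - t * x) * f121"
    and h': "h1' * (1 - x) = (t - 1) * g1' + (1 - t * x) * g2'"
      "h2' * (1 - x * y) = (t - 1) * g3' + (1 - t * (x * y)) * g4'"
    and w': "w' * (1 - y) = (t - 1) * h1' + (1 - t * y) * h2'"
  shows "w = w'"
proof -
  have nz': "1 - x \<noteq> 0" "1 - y \<noteq> 0" "1 - x * y \<noteq> 0" "x - 1 \<noteq> 0" "y - 1 \<noteq> 0"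
    using nz by auto
  have c: "y * x = x * y" by simp
  note e = braid_expansion[OF nz(1,3,4,5) g h w]
    braid_expansion[where x = y and y = x, unfolded c, OF nz(2,4,3,5) g' h' w']
  have "(t - 1)\<^sup>2 / (1 - x)\<^sup>2 * ((t - 1) / (1 - y)) + (1 - t * x) / (1 - x) * ((t - 1) / (1 - x * y)) * ((x - t) / (x - 1))
    = (t - 1)\<^sup>2 / (1 - y)\<^sup>2 * ((t - 1) / (1 - x)) + (1 - t * y) / (1 - y) * ((t - 1) / (1 - x * y)) * ((y - t) / (y - 1))"
    using nz' by (simp add: divide_simps) (simp add: algebra_simps power2_eq_square)
  moreover have "(t - 1) / (1 - x) * ((t - 1) / (1 - y) - x * (t - 1) / (1 - x * y)) = (t - 1) / (1 - y) * ((t - 1) / (1 - x * y))"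
    using nz' by (simp add: divide_simps) (simp add: algebra_simps power2_eq_square)
  moreover have "(t - 1) / (1 - y) * ((t - 1) / (1 - x) - y * (t - 1) / (1 - x * y)) = (t - 1) / (1 - x) * ((t - 1) / (1 - x * y))"
    using nz' by (simp add: divide_simps) (simp add: algebra_simps power2_eq_square)
  ultimately show ?thesis
    unfolding e by (simp only: mult.assoc) (simp only: mult_ac add_ac)
qed

text \<open>Used with \<open>z = u i\<close> and \<open>z' = s i (u i)\<close>, its inverse:
  multiplying by \<open>z\<close> removes the inverse from the relation for
  \<open>s i (T i F)\<close>.\<close>

lemma flip_spec:
  fixes g :: "'a::comm_ring_1"
  assumes "g * (1 - z') = (c - 1) * f1 + (1 - c * z') * f" and z: "z' * z = 1"
  shows "g * (z - 1) = (c - 1) * z * f1 + (z - c) * f"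
proof -
  have "(1 - z') * z = z - 1" "(1 - c * z') * z = z - c"
    using z by (simp_all add: left_diff_distrib mult.assoc)
  then have "g * (z - 1) = g * (1 - z') * z"
    by (simp add: mult.assoc)
  also have "\<dots> = (c - 1) * z * f1 + ((1 - c * z') * z) * f"
    unfolding assms(1) by (simp add: algebra_simps)
  finally show ?thesis
    unfolding \<open>(1 - c * z') * z = z - c\<close> .
qed

abbreviation (in laurent_rep) t where "t \<equiv> lconst tt"

section \<open>Quadratic, commutation and braid relations of the operators\<close>

context laurent_rep2
begin

text \<open>The cyclic symmetry as an induction rule: the induction step will always be conjugation
  by \<open>P\<close>, which raises indices by one.\<close>

lemma shift_induct:
  assumes "\<phi> 1" "\<And>i. \<phi> i \<Longrightarrow> \<phi> (i + 1)" "\<And>i j. i mod int m = j mod int m \<Longrightarrow> \<phi> i \<Longrightarrow> \<phi> j"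
  shows "\<phi> (i :: int)"
proof -
  have "\<phi> (int n + 1)" for n
  proof (induction n)
    case (Suc n)
    from assms(2)[OF this] show ?case by (simp add: add_ac)
  qed (use assms(1) in simp)
  from this[of "nat ((i - 1) mod int m)"] have "\<phi> ((i - 1) mod int m + 1)" by simp
  then show ?thesis by (rule assms(3)[rotated]) (simp add: mod_add_left_eq)
qed

lemma T_shift: "F \<in> L \<Longrightarrow> T (i + 1) F = P (T i (Q F))"
  by (simp add: P_T)

lemma s_mult: "1 \<le> i \<Longrightarrow> i < int m \<Longrightarrow> s i (F * G) = s i F * s i G"
  by (simp add: s_basic lsubst_mult)

lemma s_1: "1 \<le> i \<Longrightarrow> i < int m \<Longrightarrow> s i 1 = 1"
  and s_const: "1 \<le> i \<Longrightarrow> i < int m \<Longrightarrow> s i (lconst c) = lconst c"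
  by (simp_all add: s_basic)

lemma s_s:
  assumes "1 \<le> i" "i < int m" "F \<in> L"
  shows "s i (s i F) = F"
proof -
  have "lsubst m (\<lambda>j. aff_swap m i (aff_swap m i j)) F = lsubst m (\<lambda>j. j) F"
    using assms by (intro lsubst_cong) (auto simp: aff_swap_basic)
  then show ?thesis
    using assms by (simp add: s_basic lsubst_comp periodic_aff_swap lsubst_id)
qed

lemma s_T_spec:
  assumes "1 \<le> i" "i < int m" "F \<in> L"
  shows "s i (T j F) * (1 - s i (u j)) = (t - 1) * s i F + (1 - t * s i (u j)) * s i (s j F)"
proof -
  have "s i (T j F * (1 - u j)) = s i ((t - 1) * F + (1 - t * u j) * s j F)"
    using assms by (simp only: T_spec)
  then show ?thesis
    using assms by (simp add: s_mult s_add s_diff s_const s_1)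
qed

lemma s_u_self: "1 \<le> i \<Longrightarrow> i < int m \<Longrightarrow> s i (u i) * u i = 1"
  by (simp add: u_def s_mult X_swap mult.left_commute mult.assoc)

lemma T_quadratic_basic:
  assumes i: "1 \<le> i" "i < int m" and F: "F \<in> L"
  shows "T i (T i F) = (t - 1) * T i F + t * F"
proof -
  define x G H where "x = u i" and "G = T i F" and "H = s i (T i F)"
  have nz: "1 - x \<noteq> 0" unfolding x_def by (metis u_neq_1 right_minus_eq)
  have G: "G * (1 - x) = (t - 1) * F + (1 - t * x) * s i F"
    using T_spec[OF F, of i] by (simp add: x_def G_def)
  have H: "H * (x - 1) = (t - 1) * x * s i F + (x - t) * F"
    unfolding H_def x_def
    by (rule flip_spec[OF _ s_u_self[OF i]]) (use s_T_spec[OF i F, of i] in \<open>simp add: s_s[OF i F]\<close>)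
  have TG: "T i G * (1 - x) = (t - 1) * G + (1 - t * x) * H"
    using T_spec[of G i] F by (simp add: x_def G_def H_def)
  \<comment> \<open>One factor \<open>1 - x\<close> clears the denominator of the outer operator,
    the other that of the inner one.\<close>
  have "(T i G * (1 - x)) * (1 - x) = ((t - 1) * G + t * F) * (1 - x) * (1 - x)"
  proof -
    have "((t - 1) * G + (1 - t * x) * H) * (1 - x) = (t - 1) * (G * (1 - x)) - (1 - t * x) * (H * (x - 1))"
      by (simp add: algebra_simps)
    also have "\<dots> = (t - 1) * (1 - x) * (G * (1 - x)) + t * F * (1 - x) * (1 - x)"
      unfolding G H by (simp add: algebra_simps)
    also have "\<dots> = ((t - 1) * G + t * F) * (1 - x) * (1 - x)"
      by (simp add: algebra_simps)
    finally show ?thesis unfolding TG .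
  qed
  then show ?thesis using nz unfolding G_def by simp
qed

lemma T_quadratic: "F \<in> L \<Longrightarrow> T i (T i F) = (t - 1) * T i F + t * F"
proof (induction i arbitrary: F rule: shift_induct)
  case 1
  then show ?case using T_quadratic_basic[of 1] m2 by simp
next
  case (2 i)
  have t: "t - 1 = lconst (tt - 1)" by (simp add: lconst_diff)
  show ?case
    using 2 by (simp add: T_shift t P_add P_lconst)
next
  case (3 i j)
  then show ?case by (metis T_cong)
qed

lemma R_T: "F \<in> L \<Longrightarrow> R i (T i F) = F" and T_R: "F \<in> L \<Longrightarrow> T i (R i F) = F"
proof -
  have i: "lconst (inverse tt) * t = 1" by (simp flip: lconst_mult)
  assume F: "F \<in> L"
  have "lconst (inverse tt) * (T i (T i F) + (1 - t) * T i F) = (lconst (inverse tt) * t) * F"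
    using F by (simp add: T_quadratic algebra_simps)
  then show "R i (T i F) = F" and "T i (R i F) = F"
    using F by (simp_all add: R_def T_lconst T_add lconst_diff[of 1 tt, symmetric, simplified] i)
qed

lemma T_comm_basic:
  assumes j: "3 \<le> j" "j < int m" and F: "F \<in> L"
  shows "T 1 (T j F) = T j (T 1 F)"
proof -
  have i: "1 \<le> (1::int)" "1 < int m" and j1: "1 \<le> j" using j by auto
  define x y where "x = u 1" and "y = u j"
  have nz: "(1 - x) * (1 - y) \<noteq> 0"
    unfolding x_def y_def by (metis u_neq_1 right_minus_eq mult_eq_0_iff)
  have su: "s 1 y = y" "s j x = x"
    using i j by (simp_all add: x_def y_def u_def s_mult X_swap)
  have "lsubst m (\<lambda>k. aff_swap m 1 (aff_swap m j k)) F = lsubst m (\<lambda>k. aff_swap m j (aff_swap m 1 k)) F"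
    using i j by (intro lsubst_cong) (auto simp: aff_swap_basic)
  then have ss: "s 1 (s j F) = s j (s 1 F)"
    using i j by (simp add: s_basic lsubst_comp periodic_aff_swap)
  have e: "T 1 F * (1 - x) = (t - 1) * F + (1 - t * x) * s 1 F"
      "T j F * (1 - y) = (t - 1) * F + (1 - t * y) * s j F"
    unfolding x_def y_def using F by (rule T_spec)+
  have e1: "s 1 (T j F) * (1 - y) = (t - 1) * s 1 F + (1 - t * y) * s 1 (s j F)"
    using s_T_spec[OF i F, of j] unfolding y_def[symmetric] su .
  have e2: "s j (T 1 F) * (1 - x) = (t - 1) * s j F + (1 - t * x) * s 1 (s j F)"
    using s_T_spec[OF j1 j(2) F, of 1] unfolding x_def[symmetric] su ss .
  have e3: "T 1 (T j F) * (1 - x) = (t - 1) * T j F + (1 - t * x) * s 1 (T j F)"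
      "T j (T 1 F) * (1 - y) = (t - 1) * T 1 F + (1 - t * y) * s j (T 1 F)"
    unfolding x_def y_def using F by (simp_all add: T_spec)
  have "T 1 (T j F) * ((1 - x) * (1 - y)) = (t - 1) * (T j F * (1 - y)) + (1 - t * x) * (s 1 (T j F) * (1 - y))"
    unfolding mult.assoc[symmetric] e3 by (simp only: distrib_right)
  also have "\<dots> = (t - 1) * (T 1 F * (1 - x)) + (1 - t * y) * (s j (T 1 F) * (1 - x))"
    unfolding e e1 e2 by (simp add: algebra_simps)
  also have "\<dots> = T j (T 1 F) * ((1 - x) * (1 - y))"
    unfolding mult.commute[of "1 - x" "1 - y"] unfolding mult.assoc[symmetric] e3 by (simp only: distrib_right)
  finally have "T 1 (T j F) * ((1 - x) * (1 - y)) = T j (T 1 F) * ((1 - x) * (1 - y))" .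
  then show ?thesis using nz by simp
qed

text \<open>The two bounds say that \<open>i\<close> and \<open>j\<close> are not neighbours on the
  cycle of length \<open>m\<close>; after rotating \<open>i\<close> to 1, both reflections are
  ordinary transpositions with disjoint supports.\<close>

lemma T_comm:
  assumes "2 \<le> j - i" "j - i \<le> int m - 2" "F \<in> L"
  shows "T i (T j F) = T j (T i F)"
proof -
  define k where "k = j - i"
  have "T i (T (i + k) F) = T (i + k) (T i F)"
    using assms(3)
  proof (induction i arbitrary: F rule: shift_induct)
    case 1
    then show ?case using T_comm_basic[of "1 + k"] assms by (simp add: k_def)
  next
    case (2 i)
    then show ?case using T_shift[of _ "i + k"] by (simp add: T_shift add.assoc add.commute[of 1])
  next
    case (3 i j)
    have "(i + k) mod int m = (j + k) mod int m"
      using 3(1) by (rule mod_add_cong) simp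
    from T_cong[OF this] T_cong[OF 3(1)] show ?case
      using 3(2)[OF 3(3)] by simp
  qed
  then show ?thesis by (simp add: k_def)
qed

lemma T_braid_basic:
  assumes m3: "3 \<le> m" and F: "F \<in> L"
  shows "T 1 (T 2 (T 1 F)) = T 2 (T 1 (T 2 F))"
proof -
  have i: "1 \<le> (1::int)" "1 < int m" and j: "1 \<le> (2::int)" "2 < int m" using m3 by auto
  define x y where "x = u 1" and "y = u 2"
  have xy: "x * y = X 1 1 * X 3 (- 1)"
    by (simp add: x_def y_def u_def mult.assoc mult.left_commute[of "X 2 (- 1)"])
  have su: "s 1 (u 2) = x * y" "s 2 (u 1) = x * y" "s 1 (u 1) * x = 1" "s 2 (u 2) * y = 1"
    "s 1 (x * y) = y" "s 2 (x * y) = x"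
    unfolding xy using s_u_self[OF i] s_u_self[OF j] i j
    by (simp_all add: x_def y_def u_def s_mult X_swap)
  have nz: "x \<noteq> 0" "y \<noteq> 0" "x \<noteq> 1" "y \<noteq> 1"
    unfolding x_def y_def using u_neq_1[of 1] u_neq_1[of 2] by (simp_all add: u_def)
  have nz': "x * y \<noteq> 1"
    using su(5) nz(4) i s_1 by metis
  have "lsubst m (\<lambda>k. aff_swap m 1 (aff_swap m 2 (aff_swap m 1 k))) F =
        lsubst m (\<lambda>k. aff_swap m 2 (aff_swap m 1 (aff_swap m 2 k))) F"
    using i j by (intro lsubst_cong) (auto simp: aff_swap_basic)
  then have ss: "s 2 (s 1 (s 2 F)) = s 1 (s 2 (s 1 F))"
    using i j by (simp add: s_basic lsubst_comp periodic_aff_swap)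
  have e: "T 1 F * (1 - x) = (t - 1) * F + (1 - t * x) * s 1 F"
      "s 2 (T 1 F) * (1 - x * y) = (t - 1) * s 2 F + (1 - t * (x * y)) * s 2 (s 1 F)"
      "s 1 (T 1 F) * (x - 1) = (t - 1) * x * s 1 F + (x - t) * F"
      "s 1 (s 2 (T 1 F)) * (1 - y) = (t - 1) * s 1 (s 2 F) + (1 - t * y) * s 1 (s 2 (s 1 F))"
      "T 2 (T 1 F) * (1 - y) = (t - 1) * T 1 F + (1 - t * y) * s 2 (T 1 F)"
      "s 1 (T 2 (T 1 F)) * (1 - x * y) = (t - 1) * s 1 (T 1 F) + (1 - t * (x * y)) * s 1 (s 2 (T 1 F))"
      "T 1 (T 2 (T 1 F)) * (1 - x) = (t - 1) * T 2 (T 1 F) + (1 - t * x) * s 1 (T 2 (T 1 F))"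
      "T 2 F * (1 - y) = (t - 1) * F + (1 - t * y) * s 2 F"
      "s 1 (T 2 F) * (1 - x * y) = (t - 1) * s 1 F + (1 - t * (x * y)) * s 1 (s 2 F)"
      "s 2 (T 2 F) * (y - 1) = (t - 1) * y * s 2 F + (y - t) * F"
      "s 2 (s 1 (T 2 F)) * (1 - x) = (t - 1) * s 2 (s 1 F) + (1 - t * x) * s 1 (s 2 (s 1 F))"
      "T 1 (T 2 F) * (1 - x) = (t - 1) * T 2 F + (1 - t * x) * s 1 (T 2 F)"
      "s 2 (T 1 (T 2 F)) * (1 - x * y) = (t - 1) * s 2 (T 2 F) + (1 - t * (x * y)) * s 2 (s 1 (T 2 F))"
      "T 2 (T 1 (T 2 F)) * (1 - y) = (t - 1) * T 1 (T 2 F) + (1 - t * y) * s 2 (T 1 (T 2 F))"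
  proof -
    show s21: "s 2 (T 1 F) * (1 - x * y) = (t - 1) * s 2 F + (1 - t * (x * y)) * s 2 (s 1 F)"
      using s_T_spec[OF j F, of 1] by (simp add: su)
    show s12: "s 1 (T 2 F) * (1 - x * y) = (t - 1) * s 1 F + (1 - t * (x * y)) * s 1 (s 2 F)"
      using s_T_spec[OF i F, of 2] by (simp add: su)
    show "s 1 (s 2 (T 1 F)) * (1 - y) = (t - 1) * s 1 (s 2 F) + (1 - t * y) * s 1 (s 2 (s 1 F))"
      using arg_cong[OF s21, of "s 1"] i
      by (simp only: s_mult s_diff s_add s_1 s_const su)
    show "s 2 (s 1 (T 2 F)) * (1 - x) = (t - 1) * s 2 (s 1 F) + (1 - t * x) * s 1 (s 2 (s 1 F))"
      using arg_cong[OF s12, of "s 2"] j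
      by (simp only: s_mult s_diff s_add s_1 s_const su ss)
    show "s 1 (T 1 F) * (x - 1) = (t - 1) * x * s 1 F + (x - t) * F"
      by (rule flip_spec[OF _ su(3)]) (use s_T_spec[OF i F, of 1] in \<open>simp add: s_s[OF i F]\<close>)
    show "s 2 (T 2 F) * (y - 1) = (t - 1) * y * s 2 F + (y - t) * F"
      by (rule flip_spec[OF _ su(4)]) (use s_T_spec[OF j F, of 2] in \<open>simp add: s_s[OF j F]\<close>)
    show "s 1 (T 2 (T 1 F)) * (1 - x * y) = (t - 1) * s 1 (T 1 F) + (1 - t * (x * y)) * s 1 (s 2 (T 1 F))"
      using s_T_spec[OF i, of "T 1 F" 2] F by (simp add: su)
    show "s 2 (T 1 (T 2 F)) * (1 - x * y) = (t - 1) * s 2 (T 2 F) + (1 - t * (x * y)) * s 2 (s 1 (T 2 F))"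
      using s_T_spec[OF j, of "T 2 F" 1] F by (simp add: su)
  qed (use F in \<open>simp_all add: T_spec x_def y_def\<close>)
  \<comment> \<open>Laurent polynomials form only a domain, so the relations are moved to their
    field of fractions, where \<open>braid_field\<close> applies.\<close>
  note e' = e[THEN arg_cong[where f = to_fract], unfolded to_fract_mult to_fract_diff to_fract_add to_fract_1]
  have "to_fract x \<noteq> 0" "to_fract y \<noteq> 0" "to_fract x \<noteq> 1" "to_fract y \<noteq> 1" "to_fract x * to_fract y \<noteq> 1"
    using nz nz' by (metis to_fract_0 to_fract_1 to_fract_mult to_fract_eq_iff)+
  from braid_field[OF this e'] show ?thesis
    by (simp only: to_fract_eq_iff)
qed

lemma T_braid: "3 \<le> m \<Longrightarrow> F \<in> L \<Longrightarrow> T i (T (i + 1) (T i F)) = T (i + 1) (T i (T (i + 1) F))"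
proof (induction i arbitrary: F rule: shift_induct)
  case 1
  then show ?case using T_braid_basic[of F] by simp
next
  case (2 i)
  have "T (i + 1) (T (i + 1 + 1) (T (i + 1) (P (Q F)))) = T (i + 1 + 1) (T (i + 1) (T (i + 1 + 1) (P (Q F))))"
    using 2 by (simp only: P_T[symmetric] T_laurent Q_laurent)
  then show ?case using 2 by simp
next
  case (3 i j)
  have "(i + 1) mod int m = (j + 1) mod int m"
    using 3(1) by (rule mod_add_cong) simp
  from T_cong[OF this] T_cong[OF 3(1)] show ?case
    using 3(2)[OF 3(3,4)] by simp
qed

lemma R_add: "F \<in> L \<Longrightarrow> G \<in> L \<Longrightarrow> R i (F + G) = R i F + R i G"
  and R_lconst: "F \<in> L \<Longrightarrow> R i (lconst c * F) = lconst c * R i F"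
  by (simp_all add: R_def T_add T_lconst distrib_left mult.left_commute)

lemma P_R: "F \<in> L \<Longrightarrow> P (R i F) = R (i + 1) (P F)"
  by (simp add: R_def P_lconst P_add P_T)

lemma T_R_comm: "2 \<le> j - i \<Longrightarrow> j - i \<le> int m - 2 \<Longrightarrow> F \<in> L \<Longrightarrow> T i (R j F) = R j (T i F)"
  and R_T_comm: "2 \<le> j - i \<Longrightarrow> j - i \<le> int m - 2 \<Longrightarrow> F \<in> L \<Longrightarrow> T j (R i F) = R i (T j F)"
  by (simp add: R_def T_lconst T_add, metis T_comm)+

end

section \<open>The operators Y\<close>

text \<open>Linearity is relative to a set because \<open>T i\<close> and \<open>Q\<close> rest on
  \<open>THE\<close> and \<open>inv_into\<close> and are controlled only on
  \<open>L\<close>.\<close>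

definition linear_on :: "lpoly set \<Rightarrow> (lpoly \<Rightarrow> lpoly) \<Rightarrow> bool" where
  "linear_on V A \<longleftrightarrow> (\<forall>F\<in>V. A F \<in> V) \<and> (\<forall>F\<in>V. \<forall>G\<in>V. A (F + G) = A F + A G) \<and>
     (\<forall>F\<in>V. \<forall>c. A (lconst c * F) = lconst c * A F)"

lemma linear_onD:
  assumes "linear_on V A"
  shows "F \<in> V \<Longrightarrow> A F \<in> V" "F \<in> V \<Longrightarrow> G \<in> V \<Longrightarrow> A (F + G) = A F + A G"
    "F \<in> V \<Longrightarrow> A (lconst c * F) = lconst c * A F"
  using assms by (auto simp: linear_on_def)

lemma linear_on_comp: "linear_on V A \<Longrightarrow> linear_on V B \<Longrightarrow> linear_on V (\<lambda>F. A (B F))"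
  by (simp add: linear_on_def)

lemma linear_on_foldr: "(\<And>x. x \<in> set xs \<Longrightarrow> linear_on V (f x)) \<Longrightarrow> linear_on V (foldr f xs)"
  by (induction xs) (auto simp: linear_on_def)

lemma linear_on_scale: "linear_on (laurent m) A \<Longrightarrow> linear_on (laurent m) (\<lambda>F. lconst c * A F)"
  by (simp add: linear_on_def distrib_left mult.left_commute)

lemma foldr_commute:
  assumes "\<And>x F. x \<in> set xs \<Longrightarrow> F \<in> V \<Longrightarrow> f x F \<in> V"
    "\<And>x F. x \<in> set xs \<Longrightarrow> F \<in> V \<Longrightarrow> A (f x F) = f x (A F)" "F \<in> V"
  shows "A (foldr f xs F) = foldr f xs (A F)"
proof -
  have "foldr f xs F \<in> V \<and> A (foldr f xs F) = foldr f xs (A F)"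
    using assms(1,2) by (induction xs) (simp_all add: assms(3))
  then show ?thesis ..
qed

lemma foldr_inverse:
  assumes "\<And>x F. x \<in> set xs \<Longrightarrow> F \<in> V \<Longrightarrow> g x F \<in> V \<and> f x (g x F) = F" "F \<in> V"
  shows "foldr f xs (foldr g (rev xs) F) = F"
  using assms
proof (induction xs arbitrary: F)
  case (Cons x xs)
  then show ?case by simp
qed simp

lemma map_plus_upto: "map (\<lambda>j. j + k) [a..b] = [a + k..b + k]"
  by (rule nth_equalityI) (simp_all add: nth_upto)

lemma map_minus_upto: "map (\<lambda>j. j - k) [a..b] = [a - k..b - k]"
  using map_plus_upto[of "- k"] by simp

section \<open>The operators \<open>Y i\<close>, their inverses and their commutation\<close>

context laurent_rep
begin

lemma t_cancel: "t * F = t * G \<longleftrightarrow> F = G"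
  by simp

text \<open>An index with \<open>1 \<le> i < m\<close> forces \<open>m \<ge> 2\<close>. Facts about
  \<open>T i\<close> for such \<open>i\<close> can thus be restated in \<open>laurent_rep\<close>,
  where \<open>m = 1\<close> is allowed, without a case distinction on \<open>m\<close>.\<close>

lemma rank2I: "1 \<le> i \<Longrightarrow> i < int m \<Longrightarrow> laurent_rep2 m"
  by unfold_locales simp

context
  fixes i :: int
  assumes i: "1 \<le> i" "i < int m"
begin

interpretation laurent_rep2 m using i by (rule rank2I)

lemma T_in: "F \<in> L \<Longrightarrow> T i F \<in> L" and R_in: "F \<in> L \<Longrightarrow> R i F \<in> L"
  by simp_all

lemma linear_T: "linear_on L (T i)" and linear_R: "linear_on L (R i)"
  by (simp_all add: linear_on_def T_add T_lconst R_add R_lconst)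

lemmas T_quad = T_quadratic[of _ i]
lemmas TR = T_R[of _ i]
lemmas RT = R_T[of _ i]
lemmas P_T_shift = P_T[of _ i]

lemma T_braid1: "i + 1 < int m \<Longrightarrow> F \<in> L \<Longrightarrow> T i (T (i + 1) (T i F)) = T (i + 1) (T i (T (i + 1) F))"
  using i by (simp add: T_braid)

lemma T_comm1: "i + 2 \<le> j \<Longrightarrow> j < int m \<Longrightarrow> F \<in> L \<Longrightarrow> T i (T j F) = T j (T i F)"
  using i by (intro T_comm) auto

text \<open>\<open>T 1\<close> is also \<open>T (m + 1)\<close>, and moving it to the right past
  each \<open>P\<close> lowers its index by one. This wrap-around enters the commutation of
  \<open>Y 1\<close> with \<open>Y 2\<close>.\<close>

lemma T1_P_P: "F \<in> L \<Longrightarrow> T 1 (P (P F)) = P (P (T (int m - 1) F))"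
proof -
  have "T (int m - 1 + 1 + 1) = T 1"
    by (rule T_cong) simp
  then show "F \<in> L \<Longrightarrow> T 1 (P (P F)) = P (P (T (int m - 1) F))"
    by (simp only: P_T T_laurent P_laurent)
qed

end

lemma linear_P: "linear_on L P" and linear_Q: "linear_on L Q"
  by (simp_all add: linear_on_def P_add P_lconst Q_add Q_lconst)

lemma foldr_T_in [simp]: "set xs \<subseteq> {1..<int m} \<Longrightarrow> F \<in> L \<Longrightarrow> foldr T xs F \<in> L"
  and foldr_R_in [simp]: "set xs \<subseteq> {1..<int m} \<Longrightarrow> F \<in> L \<Longrightarrow> foldr R xs F \<in> L"
  by (induction xs) (auto simp: T_in R_in)

lemma foldr_TR: "set xs \<subseteq> {1..<int m} \<Longrightarrow> F \<in> L \<Longrightarrow> foldr T xs (foldr R (rev xs) F) = F"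
  by (rule foldr_inverse) (auto simp: R_in TR subset_iff)

lemma foldr_RT: "set xs \<subseteq> {1..<int m} \<Longrightarrow> F \<in> L \<Longrightarrow> foldr R xs (foldr T (rev xs) F) = F"
  by (rule foldr_inverse) (auto simp: T_in RT subset_iff)

text \<open>\<open>T j\<close> commutes with the factors up to \<open>j - 2\<close>, the braid
  relation moves it past \<open>T (j - 1) T j\<close> as \<open>T (j - 1)\<close>, and this commutes
  with the remaining factors.\<close>

lemma T_foldr_shift:
  assumes "1 \<le> a" "a < j" "j \<le> b" "b < int m" "F \<in> L"
  shows "T j (foldr T [a..b] F) = foldr T [a..b] (T (j - 1) F)"
proof -
  have "[a..b] = [a..j - 2] @ [j - 1..b]"
    using upto_split1[of a "j - 1" b] assms by simp
  also have "[j - 1..b] = (j - 1) # j # [j + 1..b]"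
    using assms by (simp add: upto_rec1)
  finally have split: "[a..b] = [a..j - 2] @ (j - 1) # j # [j + 1..b]" .
  define G where "G = foldr T [j + 1..b] F"
  have G: "G \<in> L" using assms by (simp add: G_def subset_iff)
  have "T j (foldr T [a..j - 2] (T (j - 1) (T j G))) = foldr T [a..j - 2] (T j (T (j - 1) (T j G)))"
    using assms G by (intro foldr_commute[where V = L]) (auto simp: T_in intro!: T_comm1[symmetric])
  also have "T j (T (j - 1) (T j G)) = T (j - 1) (T j (T (j - 1) G))"
    using T_braid1[of "j - 1" G, symmetric] assms G by simp
  also have "T (j - 1) G = foldr T [j + 1..b] (T (j - 1) F)"
    unfolding G_def using assms by (intro foldr_commute[where V = L]) (auto simp: T_in intro!: T_comm1)
  finally show ?thesis
    by (simp add: split G_def)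
qed

lemma foldr_T_shift:
  assumes "1 \<le> a" "b < int m" "F \<in> L" "set xs \<subseteq> {a<..b}"
  shows "foldr T xs (foldr T [a..b] F) = foldr T [a..b] (foldr T (map (\<lambda>j. j - 1) xs) F)"
  using assms(4)
proof (induction xs)
  case (Cons j xs)
  have "foldr T (map (\<lambda>j. j - 1) xs) F \<in> L"
    using Cons.prems assms by (intro foldr_T_in) auto
  with Cons assms show ?case
    by (simp add: T_foldr_shift)
qed simp

lemma P_foldr_T:
  assumes "set xs \<subseteq> {1..<int m - 1}" "F \<in> L"
  shows "P (foldr T xs F) = foldr T (map (\<lambda>j. j + 1) xs) (P F)"
  using assms
proof (induction xs)
  case (Cons j xs)
  have "set xs \<subseteq> {1..<int m}" using Cons.prems by auto
  then show ?case using Cons by (simp add: P_T_shift)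
qed simp

definition Y :: "int \<Rightarrow> lpoly \<Rightarrow> lpoly" where
  "Y i F = lconst (tt powi (int m - i)) * foldr T (rev [1..i - 1]) (P (foldr R (rev [i..int m - 1]) F))"

text \<open>The inverse of \<open>Y i\<close>: each factor inverted and the order reversed.\<close>

definition Z :: "int \<Rightarrow> lpoly \<Rightarrow> lpoly" where
  "Z i F = lconst (tt powi (i - int m)) * foldr T [i..int m - 1] (Q (foldr R [1..i - 1] F))"

lemma linear_Y: "1 \<le> i \<Longrightarrow> i \<le> int m \<Longrightarrow> linear_on L (Y i)"
  and linear_Z: "1 \<le> i \<Longrightarrow> i \<le> int m \<Longrightarrow> linear_on L (Z i)"
  unfolding Y_def[abs_def] Z_def[abs_def]
  by (auto intro!: linear_on_scale linear_on_comp[OF linear_P linear_on_foldr] linear_on_comp[OF linear_Q linear_on_foldr]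
      linear_on_comp[OF linear_on_foldr] linear_T linear_R)

lemmas Y_lin = linear_onD[OF linear_Y]
lemmas Z_lin = linear_onD[OF linear_Z]

lemma powi_inverse: "lconst (tt powi k) * (lconst (tt powi - k) * F) = F"
proof -
  have "lconst (tt powi k * tt powi - k) = 1" by (simp flip: power_int_add)
  then show ?thesis by (simp add: lconst_mult flip: mult.assoc)
qed

lemma YZ:
  assumes "1 \<le> i" "i \<le> int m" "F \<in> L"
  shows "Y i (Z i F) = F"
proof -
  have "Y i (Z i F) = lconst (tt powi (i - int m)) * Y i (foldr T [i..int m - 1] (Q (foldr R [1..i - 1] F)))"
    using assms by (subst Z_def, intro Y_lin) (auto simp: subset_iff)
  also have "Y i (foldr T [i..int m - 1] (Q (foldr R [1..i - 1] F))) = lconst (tt powi (int m - i)) * F"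
    using assms foldr_RT[of "rev [i..int m - 1]" "Q (foldr R [1..i - 1] F)"] foldr_TR[of "rev [1..i - 1]" F]
    by (simp add: Y_def subset_iff)
  finally show ?thesis using powi_inverse[of "i - int m"] by simp
qed

lemma ZY:
  assumes "1 \<le> i" "i \<le> int m" "F \<in> L"
  shows "Z i (Y i F) = F"
proof -
  have "Z i (Y i F) = lconst (tt powi (int m - i)) * Z i (foldr T (rev [1..i - 1]) (P (foldr R (rev [i..int m - 1]) F)))"
    using assms by (subst Y_def, intro Z_lin) (auto simp: subset_iff)
  also have "Z i (foldr T (rev [1..i - 1]) (P (foldr R (rev [i..int m - 1]) F))) = lconst (tt powi (i - int m)) * F"
    using assms foldr_RT[of "[1..i - 1]" "P (foldr R (rev [i..int m - 1]) F)"] foldr_TR[of "[i..int m - 1]" F]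
    by (simp add: Z_def subset_iff)
  finally show ?thesis using powi_inverse[of "int m - i"] by simp
qed

text \<open>The right \<open>T i\<close> cancels the first inverse in \<open>Y i\<close>, the left
  one lengthens its initial word, and the exponent of \<open>t\<close> differs by one. Relations for
  \<open>Y (i + 1)\<close> are derived from those for \<open>Y i\<close> through this
  identity.\<close>

lemma TYT:
  assumes i: "1 \<le> i" "i < int m" and F: "F \<in> L"
  shows "T i (Y i (T i F)) = t * Y (i + 1) F"
proof -
  define G where "G = P (foldr R (rev [i + 1..int m - 1]) F)"
  have l: "rev [i..int m - 1] = rev [i + 1..int m - 1] @ [i]" "rev [1..i + 1 - 1] = i # rev [1..i - 1]"
    using i by (simp_all add: upto_rec1[of i] upto_rec2[of 1 i])
  have H: "foldr T (rev [1..i - 1]) G \<in> L" using i by (simp add: G_def subset_iff)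
  have "Y i (T i F) = lconst (tt powi (int m - i)) * foldr T (rev [1..i - 1]) G"
    unfolding Y_def l G_def using F i by (simp add: RT)
  then have "T i (Y i (T i F)) = lconst (tt powi (int m - i)) * T i (foldr T (rev [1..i - 1]) G)"
    using H by (simp add: linear_onD(3)[OF linear_T[OF i]])
  also have "tt powi (int m - i) = tt * tt powi (int m - (i + 1))"
    using power_int_add_1'[of tt "int m - (i + 1)"] by simp
  finally show ?thesis
    unfolding Y_def l G_def by (simp add: lconst_mult mult.assoc)
qed

text \<open>On vectors \<open>T 1 ... T (m - 1) G\<close>, which are all vectors by
  \<open>U_surj\<close>, the inverses in \<open>Y 1\<close> disappear and only a multiple of
  \<open>P\<close> is left.\<close>

lemma Y1_U: "F \<in> L \<Longrightarrow> Y 1 (foldr T [1..int m - 1] F) = lconst (tt powi (int m - 1)) * P F"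
  using foldr_RT[of "rev [1..int m - 1]" F] by (simp add: Y_def subset_iff)

lemma U_surj:
  assumes "F \<in> L" "1 \<le> a" "b < int m"
  obtains G where "G \<in> L" "F = foldr T [a..b] G"
proof
  show "foldr R (rev [a..b]) F \<in> L"
    using assms by (simp add: subset_iff)
  show "F = foldr T [a..b] (foldr R (rev [a..b]) F)"
    using foldr_TR[of "[a..b]" F] assms by (simp add: subset_iff)
qed

text \<open>With \<open>F = T 1 ... T (m - 1) G\<close>, both sides are the same multiple of
  \<open>P (T (j - 1) G)\<close>: \<open>P\<close> lowers the index \<open>j\<close> on one side,
  and \<open>T_foldr_shift\<close> does so on the other.\<close>

lemma T_Y1: 
  assumes j: "2 \<le> j" "j < int m" and F: "F \<in> L"
  shows "T j (Y 1 F) = Y 1 (T j F)"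
proof -
  obtain G where G: "G \<in> L" "F = foldr T [1..int m - 1] G"
    using U_surj[OF F, of 1 "int m - 1"] by auto
  have "T j (Y 1 F) = lconst (tt powi (int m - 1)) * T j (P G)"
    using j G by (simp add: Y1_U linear_onD(3)[OF linear_T])
  also have "T j (P G) = P (T (j - 1) G)"
    using P_T_shift[of "j - 1" G] j G by simp
  also have "lconst (tt powi (int m - 1)) * P (T (j - 1) G) = Y 1 (T j F)"
    using Y1_U[of "T (j - 1) G"] T_foldr_shift[of 1 j "int m - 1" G] T_in[of "j - 1" G] j G by simp
  finally show ?thesis .
qed

text \<open>Induction through \<open>t Y (k + 1) = T k Y k T k\<close>. If \<open>j\<close> is not
  adjacent to \<open>k\<close>, then \<open>T j\<close> commutes with all three factors. If
  \<open>j = k - 1\<close>, the identity is unfolded twice; the braid relation turns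
  \<open>T j\<close> into \<open>T k\<close>, which commutes with \<open>Y j\<close> and is turned
  back on the other side.\<close>

lemma T_Y:
  assumes "1 \<le> i" "i \<le> int m" "1 \<le> j" "j < int m" "j \<noteq> i" "j \<noteq> i - 1" "F \<in> L"
  shows "T j (Y i F) = Y i (T j F)"
  using assms
proof (induction "nat i" arbitrary: i j F rule: less_induct)
  case less
  note lin = linear_onD(3)[OF linear_T] linear_onD(3)[OF linear_Y]
  show ?case
  proof (cases "i = 1")
    case True
    then show ?thesis using T_Y1[of j F] less.prems by simp
  next
    case False
    define k where "k = i - 1"
    have k: "1 \<le> k" "k < int m" and i: "i = k + 1" using False less.prems by (auto simp: k_def)
    have IH: "T j (Y l F) = Y l (T j F)" if "1 \<le> l" "l \<le> k" "1 \<le> j" "j < int m" "j \<noteq> l" "j \<noteq> l - 1" "F \<in> L" for l j F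
      using that i k by (intro less.hyps) auto
    have cases: "k + 2 \<le> j \<or> j + 2 \<le> k \<or> (j = k - 1 \<and> 1 \<le> k - 1)"
      using less.prems i by linarith
    have inL: "T l G \<in> L" "Y l' G \<in> L" if "G \<in> L" "1 \<le> l" "l < int m" "1 \<le> l'" "l' \<le> int m" for l l' G
      using that by (simp_all add: T_in Y_lin)
    consider (far) "k + 2 \<le> j \<or> j + 2 \<le> k" | (near) "j = k - 1" "1 \<le> k - 1"
      using cases by blast
    then show ?thesis
    proof cases
      case far
      then have far': "j \<noteq> k" "j \<noteq> k - 1" by auto
      have TT: "T j (T k G) = T k (T j G)" if "G \<in> L" for G
        using far T_comm1[of k j G] T_comm1[of j k G] that k less.prems by auto
      have "t * T j (Y i F) = T j (T k (Y k (T k F)))"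
        using k i less.prems by (simp add: TYT lin Y_lin)
      also have "\<dots> = T k (Y k (T k (T j F)))"
        using k i less.prems far' by (simp add: TT IH T_in Y_lin)
      also have "\<dots> = t * Y i (T j F)"
        using k i less.prems by (simp add: TYT T_in)
      finally show ?thesis by (simp only: t_cancel)
    next
      case near
      have k': "k = j + 1" "1 \<le> j" "j + 1 < int m" using near k by auto
      have b: "T j (T (j + 1) (T j G)) = T (j + 1) (T j (T (j + 1) G))" if "G \<in> L" for G
        using T_braid1[of j G] k' that by simp
      have e: "t * (t * Y i G) = T k (T j (Y j (T j (T k G))))" if "G \<in> L" for G
      proof -
        have "T k (t * Y k (T k G)) = t * (t * Y i G)"
          using k i that by (simp add: TYT lin Y_lin T_in)
        also have "t * Y k (T k G) = T j (Y j (T j (T k G)))"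
          using k k' that TYT[of j "T k G"] by (simp add: T_in)
        finally show ?thesis by simp
      qed
      have F: "F \<in> L" by fact
      have "t * (t * T j (Y i F)) = T j (t * (t * Y i F))"
        using less.prems by (simp add: lin Y_lin)
      also have "\<dots> = T j (T k (T j (Y j (T j (T k F)))))"
        using e[OF F] by simp
      also have "\<dots> = T k (T j (T k (Y j (T j (T k F)))))"
        unfolding k'(1) using k' F by (intro b) (simp add: T_in Y_lin)
      also have "T k (Y j (T j (T k F))) = Y j (T k (T j (T k F)))"
        using IH[of j k "T j (T k F)"] k' F by (simp add: T_in)
      also have "T k (T j (T k F)) = T j (T k (T j F))"
        unfolding k'(1) using b[OF F] by simp
      also have "T k (T j (Y j (T j (T k (T j F))))) = t * (t * Y i (T j F))"
        using e[of "T j F"] k' F by (simp add: T_in)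
      finally show ?thesis by (simp only: t_cancel)
    qed
  qed
qed

text \<open>Up to the scalar \<open>t\<close>, this is commutation of \<open>Y 1\<close> with
  \<open>Y 2\<close>. Both sides are reduced to a scalar times a word with \<open>P\<close> twice,
  and the two words agree by \<open>T1_P_P\<close>.\<close>

lemma Y1_T_Y1_T:
  assumes m2: "2 \<le> m" and F: "F \<in> L"
  shows "Y 1 (T 1 (Y 1 (T 1 F))) = T 1 (Y 1 (T 1 (Y 1 F)))"
proof -
  define c where "c = lconst (tt powi (int m - 1))"
  have cL: "c \<in> L" by (simp add: c_def)
  define U where "U = foldr T [1..int m - 1]"
  define U1 where "U1 = foldr T [2..int m - 1]"
  define U2 where "U2 = foldr T [1..int m - 2]"
  have lists: "[1..int m - 1] = 1 # [2..int m - 1]" "[1..int m - 1] = [1..int m - 2] @ [int m - 1]"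
    "map (\<lambda>j. j + 1) [1..int m - 2] = [2..int m - 1]" "map (\<lambda>j. j - 1) [2..int m - 1] = [1..int m - 2]"
    using m2 upto_rec1[of 1 "int m - 1"] upto_rec2[of 1 "int m - 1"]
    by (simp_all add: map_plus_upto map_minus_upto)
  have inU: "U G \<in> L" "U1 G \<in> L" "U2 G \<in> L" "T 1 G \<in> L" "Y 1 G \<in> L" "T (int m - 1) G \<in> L" if "G \<in> L" for G
    using that m2 by (simp_all add: U_def U1_def U2_def subset_iff T_in Y_lin)
  have U: "U G = T 1 (U1 G)" "U G = U2 (T (int m - 1) G)" for G
    unfolding U_def U1_def U2_def by (subst lists(1), simp) (subst lists(2), simp)
  have UU: "U (U2 G) = U1 (U G)" if "G \<in> L" for G
  proof -
    have "set [2..int m - 1] \<subseteq> {1<..int m - 1}" by auto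
    from foldr_T_shift[OF _ _ that this] show ?thesis
      by (simp add: U_def U1_def U2_def lists(4))
  qed
  have PU2: "P (U2 G) = U1 (P G)" if "G \<in> L" for G
    using P_foldr_T[of "[1..int m - 2]" G] that by (simp add: U1_def U2_def lists(3) subset_iff)
  have YU: "Y 1 (U G) = c * P G" if "G \<in> L" for G
    using Y1_U[OF that] by (simp add: U_def c_def)
  have lin: "T 1 (c * G) = c * T 1 G" "Y 1 (c * G) = c * Y 1 G" if "G \<in> L" for G
    using that m2 by (simp_all add: c_def linear_onD(3)[OF linear_T] Y_lin)
  obtain F' where F': "F' \<in> L" "F = U F'"
    using U_surj[OF F, of 1 "int m - 1"] unfolding U_def by auto
  \<comment> \<open>A second substitution, so that the inverses in both occurrences of
    \<open>Y 1\<close> are cancelled; the word stops at \<open>m - 2\<close> because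
    \<open>U U2 = U1 U\<close>.\<close>
  obtain G where G: "G \<in> L" "F' = U2 G"
    using U_surj[OF F'(1), of 1 "int m - 2"] unfolding U2_def by auto
  have "T 1 F = U (U G)"
    using G F' by (simp add: UU U(1)[symmetric])
  then have "Y 1 (T 1 F) = c * P (U G)"
    using G by (simp add: YU inU)
  also have "P (U G) = U1 (P (T (int m - 1) G))"
    using G by (simp add: U(2) PU2 inU)
  finally have "T 1 (Y 1 (T 1 F)) = c * U (P (T (int m - 1) G))"
    using G by (simp add: lin inU U(1)[symmetric])
  then have l: "Y 1 (T 1 (Y 1 (T 1 F))) = c * (c * P (P (T (int m - 1) G)))"
    using G by (simp add: lin inU YU)
  have "Y 1 F = c * U1 (P G)"
    using G F' by (simp add: YU PU2 inU)
  then have "T 1 (Y 1 F) = c * U (P G)"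
    using G by (simp add: lin inU U(1)[symmetric])
  then have "T 1 (Y 1 (T 1 (Y 1 F))) = c * (c * T 1 (P (P G)))"
    using G by (simp add: lin inU YU cL)
  then show ?thesis
    using T1_P_P[of 1 G] m2 G by (simp add: l)
qed

text \<open>In the induction step \<open>T j\<close> with \<open>j \<ge> 2\<close> passes
  \<open>Y 1\<close>, so commutation with \<open>Y j\<close> carries over to
  \<open>T j Y j T j\<close>, that is, to \<open>Y (j + 1)\<close>.\<close>

lemma Y1_Y:
  assumes "2 \<le> j" "j \<le> int m" "F \<in> L"
  shows "Y 1 (Y j F) = Y j (Y 1 F)"
  using assms
proof (induction j arbitrary: F rule: int_ge_induct)
  case base
  have m2: "2 \<le> m" using base by simp
  have "t * Y 1 (Y 2 F) = Y 1 (T 1 (Y 1 (T 1 F)))"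
    using base TYT[of 1 F] Y_lin(3)[of 1 "Y 2 F" tt] Y_lin(1)[of 2 F] by simp
  also have "\<dots> = t * Y 2 (Y 1 F)"
    unfolding Y1_T_Y1_T[OF m2 \<open>F \<in> L\<close>]
    using base TYT[of 1 "Y 1 F"] by (simp add: Y_lin)
  finally show ?case by (simp only: t_cancel)
next
  case (step j)
  have j: "1 \<le> j" "j < int m" "2 \<le> j" using step by auto
  have "t * Y 1 (Y (j + 1) F) = Y 1 (T j (Y j (T j F)))"
    using j step.prems by (simp add: TYT Y_lin)
  also have "\<dots> = T j (Y j (T j (Y 1 F)))"
    using j step by (simp add: T_Y1[symmetric] T_in Y_lin)
  also have "\<dots> = t * Y (j + 1) (Y 1 F)"
    using j step.prems by (simp add: TYT Y_lin)
  finally show ?case by (simp only: t_cancel)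
qed

lemma Y_less_commute:
  assumes "1 \<le> i" "i < j" "j \<le> int m" "F \<in> L"
  shows "Y i (Y j F) = Y j (Y i F)"
  using assms
proof (induction i arbitrary: F rule: int_ge_induct)
  case base
  then show ?case by (simp add: Y1_Y)
next
  case (step i)
  have i: "i < int m" "j \<noteq> i + 1" using step by auto
  have "t * Y (i + 1) (Y j F) = T i (Y i (T i (Y j F)))"
    using step i by (simp add: TYT Y_lin)
  also have "\<dots> = Y j (T i (Y i (T i F)))"
    using step i by (simp add: T_Y T_in Y_lin)
  also have "\<dots> = t * Y j (Y (i + 1) F)"
    using step i by (simp add: TYT Y_lin)
  finally show ?case by (simp only: t_cancel)
qed

lemma Y_commute:
  assumes "1 \<le> i" "i \<le> int m" "1 \<le> j" "j \<le> int m" "F \<in> L"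
  shows "Y i (Y j F) = Y j (Y i F)"
  using assms Y_less_commute[of i j F] Y_less_commute[of j i F] by (cases i j rule: linorder_cases) auto

lemma Y_Z_commute:
  assumes "1 \<le> i" "i \<le> int m" "1 \<le> j" "j \<le> int m" "F \<in> L"
  shows "Y i (Z j F) = Z j (Y i F)"
proof -
  have "Z j (Y i F) = Z j (Y i (Y j (Z j F)))" using assms by (simp add: YZ)
  also have "\<dots> = Z j (Y j (Y i (Z j F)))" using assms Y_commute[of i j "Z j F"] by (simp add: Z_lin)
  also have "\<dots> = Y i (Z j F)" using assms by (simp add: ZY Y_lin Z_lin)
  finally show ?thesis ..
qed

lemma Z_commute:
  assumes "1 \<le> i" "i \<le> int m" "1 \<le> j" "j \<le> int m" "F \<in> L"
  shows "Z i (Z j F) = Z j (Z i F)"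
proof -
  have "Z i (Z j F) = Z i (Z j (Y i (Z i F)))" using assms by (simp add: YZ)
  also have "\<dots> = Z i (Y i (Z j (Z i F)))" using assms Y_Z_commute[of i j "Z i F"] by (simp add: Z_lin)
  also have "\<dots> = Z j (Z i F)" using assms by (simp add: ZY Z_lin)
  finally show ?thesis .
qed

end

section \<open>Specialization at t = 1\<close>

text \<open>The localization of \<open>Q[q][t]\<close> at the prime ideal generated by
  \<open>t - 1\<close>: here \<open>poly b 1\<close> is a polynomial in \<open>q\<close>, and its
  being nonzero means that \<open>t - 1\<close> does not divide \<open>b\<close>.\<close>

definition local_at_1 :: "qt set" where
  "local_at_1 = {Fract a b | a b. poly b 1 \<noteq> 0}"

lemma local_at_1I: "poly b 1 \<noteq> 0 \<Longrightarrow> Fract a b \<in> local_at_1"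
  by (auto simp: local_at_1_def)

lemma local_at_1E:
  assumes "x \<in> local_at_1"
  obtains a b where "x = Fract a b" "poly b 1 \<noteq> 0" "b \<noteq> 0"
  using assms by (force simp: local_at_1_def)

lemma subring_local_at_1: "subring_set local_at_1"
  unfolding subring_set_def
proof (intro conjI ballI)
  show "1 \<in> local_at_1"
    by (simp add: One_fract_def local_at_1I)
  fix x y assume "x \<in> local_at_1" "y \<in> local_at_1"
  then show "x - y \<in> local_at_1" "x * y \<in> local_at_1"
    by (auto elim!: local_at_1E intro!: local_at_1I)
qed

lemmas local_ring = subring_setD[OF subring_local_at_1]

lemma tt_local: "tt \<in> local_at_1" "inverse tt \<in> local_at_1"
  unfolding tt_def by (auto intro!: local_at_1I)

lemma qq_local: "qq \<in> local_at_1" "inverse qq \<in> local_at_1"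
  unfolding qq_def by (auto intro!: local_at_1I)

lemma power_local: "x \<in> local_at_1 \<Longrightarrow> x ^ n \<in> local_at_1"
  by (induction n) (auto intro: local_ring)

lemma powi_local: "qq powi k \<in> local_at_1" "tt powi k \<in> local_at_1"
  by (auto simp: power_int_def intro!: power_local qq_local tt_local)

lemma tt_minus_1: "tt - 1 = Fract [:- 1, 1:] 1"
  by (simp add: tt_def One_fract_def one_pCons)

text \<open>After clearing the denominator of \<open>h\<close>, evaluation at \<open>t = 1\<close>
  kills the right side but not the left.\<close>

lemma not_in_maximal_ideal:
  assumes "poly n 1 \<noteq> 0" "h \<in> local_at_1"
  shows "Fract n 1 \<noteq> (tt - 1) * h"
proof
  assume *: "Fract n 1 = (tt - 1) * h"
  obtain a b where h: "h = Fract a b" "poly b 1 \<noteq> 0" "b \<noteq> 0"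
    using assms(2) by (rule local_at_1E)
  then have "n * b = [:- 1, 1:] * a"
    using * unfolding tt_minus_1 h(1) mult_fract by (subst (asm) eq_fract) simp_all
  then have "poly (n * b) 1 = poly ([:- 1, 1:] * a) 1" by (rule arg_cong)
  then show False using assms(1) h(2) by simp
qed

lemma common_denominator:
  assumes "finite A"
  shows "\<exists>d :: 'a::idom. d \<noteq> 0 \<and> (\<forall>x\<in>A. \<exists>n. f x * Fract d 1 = Fract n 1)"
  using assms
proof (induction A)
  case (insert x A)
  then obtain d where d: "d \<noteq> 0" "\<forall>x\<in>A. \<exists>n. f x * Fract d 1 = Fract n 1" by auto
  obtain a b where ab: "f x = Fract a b" "b \<noteq> 0" by (cases "f x") auto
  have "f x * Fract (b * d) 1 = Fract (a * d) 1"
    using ab by (simp add: eq_fract)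
  moreover have "\<exists>n. f y * Fract (b * d) 1 = Fract n 1" if "y \<in> A" for y
  proof -
    obtain n where "f y * Fract d 1 = Fract n 1" using d(2) \<open>y \<in> A\<close> by blast
    moreover have "f y * Fract (b * d) 1 = (f y * Fract d 1) * Fract b 1"
      by (simp add: mult.assoc mult.commute)
    ultimately have "f y * Fract (b * d) 1 = Fract (n * b) 1"
      by simp
    then show ?thesis by blast
  qed
  moreover have "b * d \<noteq> 0"
    using d(1) ab(2) by simp
  ultimately show ?case by blast
qed (auto intro: exI[of _ 1])

text \<open>Multiply by a common denominator, then divide by the smallest power of
  \<open>t - 1\<close> found among the numerators; the coefficient where the minimum is attained
  becomes nonzero at \<open>t = 1\<close>.\<close>

lemma primitive_scaling:
  fixes p :: "'k \<Rightarrow>\<^sub>0 qt"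
  assumes "p \<noteq> 0"
  obtains d a where "\<And>b. d * lookup p b \<in> local_at_1" "\<And>h. h \<in> local_at_1 \<Longrightarrow> d * lookup p a \<noteq> (tt - 1) * h"
proof -
  obtain D where D: "D \<noteq> 0" "\<forall>b\<in>keys p. \<exists>n. lookup p b * Fract D 1 = Fract n 1"
    using common_denominator[of "keys p" "lookup p"] by auto
  then obtain n where n: "lookup p b * Fract D 1 = Fract (n b) 1" if "b \<in> keys p" for b
    by metis
  have nz: "n b \<noteq> 0" if "b \<in> keys p" for b
  proof
    assume "n b = 0"
    then have "lookup p b * Fract D 1 = 0" using n[OF that] by (simp add: Zero_fract_def)
    moreover have "Fract D 1 \<noteq> 0" using D(1) by (simp add: Zero_fract_def eq_fract)
    ultimately show False using that by (simp add: in_keys_iff)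
  qed
  define ord where "ord b = Polynomial.order 1 (n b)" for b
  define o1 where "o1 = Min (ord ` keys p)"
  have ne: "keys p \<noteq> {}" using assms by (metis keys_eq_empty)
  obtain a where a: "a \<in> keys p" "ord a = o1"
  proof -
    have "o1 \<in> ord ` keys p" unfolding o1_def by (rule Min_in) (use ne in simp_all)
    then show ?thesis using that by blast
  qed
  have "\<exists>n'. n b = [:- 1, 1:] ^ o1 * n'" if "b \<in> keys p" for b
  proof -
    have "o1 \<le> Polynomial.order 1 (n b)" using that unfolding o1_def ord_def by (intro Min_le) auto
    then have "[:- 1, 1:] ^ o1 dvd n b" using order_divides[of 1 o1 "n b"] by simp
    then show ?thesis unfolding dvd_def .
  qed
  then obtain n' where n': "n b = [:- 1, 1:] ^ o1 * n' b" if "b \<in> keys p" for b by metis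
  define d where "d = Fract D ([:- 1, 1:] ^ o1)"
  have d: "d * lookup p b = Fract (n' b) 1" if "b \<in> keys p" for b
  proof -
    have "d = Fract D 1 * Fract 1 ([:- 1, 1:] ^ o1)" by (simp add: d_def)
    then have "d * lookup p b = (lookup p b * Fract D 1) * Fract 1 ([:- 1, 1:] ^ o1)"
      by (simp only: mult_ac)
    also have "\<dots> = Fract (n' b) 1"
      unfolding n[OF that] n'[OF that] by (simp add: eq_fract)
    finally show ?thesis .
  qed
  have "poly (n' a) 1 \<noteq> 0"
  proof
    assume "poly (n' a) 1 = 0"
    then have "[:- 1, 1:] dvd n' a" using poly_eq_0_iff_dvd[of "n' a" 1] by simp
    then have "[:- 1, 1:] ^ Suc o1 dvd n a" unfolding n'[OF a(1)] power_Suc2 by (intro mult_dvd_mono dvd_refl)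
    then show False using order_divides[of 1 "Suc o1" "n a"] nz[OF a(1)] a(2) by (simp add: ord_def)
  qed
  then have "d * lookup p a \<noteq> (tt - 1) * h" if "h \<in> local_at_1" for h
    using not_in_maximal_ideal[OF _ that] by (simp add: d[OF a(1)])
  moreover have "d * lookup p b \<in> local_at_1" for b
  proof (cases "b \<in> keys p")
    case True then show ?thesis by (simp add: d local_at_1I)
  next
    case False then show ?thesis by (simp add: in_keys_iff local_ring)
  qed
  ultimately show ?thesis using that by blast
qed

section \<open>Congruence modulo \<open>t - 1\<close>\<close>

context laurent_rep
begin

abbreviation "LR \<equiv> laurent_over local_at_1 m"

lemmas LR_L = laurent_overD[where A = local_at_1 and m = m]
lemmas LR_add = laurent_over_add[OF subring_local_at_1]
lemmas LR_diff = laurent_over_diff[OF subring_local_at_1]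
lemmas LR_mult = laurent_over_mult[OF subring_local_at_1]
lemmas LR_lconst = laurent_over_lconst[OF subring_local_at_1]
lemmas LR_0 = laurent_over_0[OF subring_local_at_1]
lemmas LR_1 = laurent_over_1[OF subring_local_at_1]
lemmas LR_sum = laurent_over_sum[OF subring_local_at_1]
lemmas LR_single = laurent_over_single[OF subring_local_at_1]

lemma LR_X: "X j e \<in> LR"
proof -
  have "(j - 1) mod int m + 1 \<in> {1..int m}" by (simp add: add1_zle_eq)
  then show ?thesis
    unfolding Xpow_def Let_def by (intro LR_single powi_local) (auto split: if_splits)
qed

lemma LR_lsubst: "F \<in> LR \<Longrightarrow> lsubst m \<sigma> F \<in> LR"
  by (rule laurent_over_lsubst[OF subring_local_at_1]) (auto intro: LR_X)

definition cong1 :: "lpoly \<Rightarrow> lpoly \<Rightarrow> bool"  (infix "\<approx>" 50) where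
  "F \<approx> G \<longleftrightarrow> F \<in> LR \<and> G \<in> LR \<and> (\<exists>H\<in>LR. F = G + lconst (tt - 1) * H)"

lemma cong1_refl: "F \<in> LR \<Longrightarrow> F \<approx> F"
  by (auto simp: cong1_def intro!: bexI[of _ 0] LR_0)

lemma cong1_trans [trans]: "F \<approx> G \<Longrightarrow> G \<approx> H \<Longrightarrow> F \<approx> H"
  unfolding cong1_def by (auto simp: add.assoc simp flip: distrib_left intro: LR_add)

lemma cong1_sym: "F \<approx> G \<Longrightarrow> G \<approx> F"
proof -
  assume "F \<approx> G"
  then obtain H where H: "F \<in> LR" "G \<in> LR" "H \<in> LR" "F = G + lconst (tt - 1) * H"
    by (auto simp: cong1_def)
  then have "G = F + lconst (tt - 1) * (0 - H)" by simp
  then show "G \<approx> F" unfolding cong1_def using H LR_diff[OF LR_0 H(3)] by blast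
qed

text \<open>Preserving the lattice \<open>LR\<close> is what lets a linear operator pass to the
  quotient modulo \<open>t - 1\<close>.\<close>

definition integral :: "(lpoly \<Rightarrow> lpoly) \<Rightarrow> bool" where
  "integral A \<longleftrightarrow> linear_on L A \<and> (\<forall>F\<in>LR. A F \<in> LR)"

lemma integral_LR: "integral A \<Longrightarrow> F \<in> LR \<Longrightarrow> A F \<in> LR"
  by (simp add: integral_def)

lemma integral_cong: "integral A \<Longrightarrow> F \<approx> G \<Longrightarrow> A F \<approx> A G"
proof -
  assume A: "integral A" and "F \<approx> G"
  then obtain H where H: "F \<in> LR" "G \<in> LR" "H \<in> LR" "F = G + lconst (tt - 1) * H"
    by (auto simp: cong1_def)
  then have "A F = A G + lconst (tt - 1) * A H"
    using A by (simp add: integral_def linear_on_def LR_L)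
  then show ?thesis
    unfolding cong1_def using H integral_LR[OF A] by blast
qed

lemma integral_comp: "integral A \<Longrightarrow> integral B \<Longrightarrow> integral (\<lambda>F. A (B F))"
  by (simp add: integral_def linear_on_comp)

lemma integral_foldr: "(\<And>x. x \<in> set xs \<Longrightarrow> integral (f x)) \<Longrightarrow> integral (foldr f xs)"
  by (induction xs) (auto simp: integral_def linear_on_def)

lemma integral_scale: "c \<in> local_at_1 \<Longrightarrow> integral (\<lambda>F. lconst c * F)"
  using linear_on_scale[of m "\<lambda>F. F"] by (simp add: integral_def LR_mult LR_lconst linear_on_def)

lemma integral_P: "integral P"
  by (simp add: integral_def linear_P) (simp add: Pi_op_def LR_mult LR_X LR_lsubst)

lemma integral_Q: "integral Q"
proof -
  have "Q F = lsubst m (\<lambda>j. j + (- 1)) (X 1 (- 1) * F)" if "F \<in> L" for F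
    using that m_pos by (intro Q_eqI P_surj lsubst_laurent)
  then show ?thesis
    by (simp add: integral_def linear_Q LR_mult LR_X LR_lsubst LR_L)
qed

lemma cong1_scale:
  assumes "F \<in> LR" shows "t * F \<approx> F"
  unfolding cong1_def using assms
  by (auto simp: LR_mult LR_lconst tt_local lconst_diff algebra_simps intro!: bexI[of _ F])

context
  fixes i :: int
  assumes i: "1 \<le> i" "i < int m"
begin

interpretation laurent_rep2 m using i by (rule rank2I)

lemma s_LR: "F \<in> LR \<Longrightarrow> s i F \<in> LR"
  using i by (simp add: s_basic LR_lsubst)

text \<open>\<open>T i - s i\<close> is \<open>t - 1\<close> times the sum of \<open>s i\<close> and
  the divided difference, and the latter preserves \<open>LR\<close> by
  \<open>divided_difference_basic\<close> over the local ring.\<close>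

lemma T_cong_s: "F \<in> LR \<Longrightarrow> T i F \<approx> s i F"
proof -
  assume F: "F \<in> LR"
  obtain G where G: "G \<in> LR" "G * (1 - u i) = F - s i F"
    using divided_difference_basic[OF subring_local_at_1 i F] by auto
  have "T i F = s i F + lconst (tt - 1) * (s i F + G)"
    using D_eqI[OF LR_L[OF F] G(2)] by (simp add: T_D lconst_diff algebra_simps)
  moreover from this have "T i F \<in> LR"
    using F G by (simp add: LR_add LR_mult LR_lconst s_LR local_ring tt_local)
  ultimately show ?thesis
    unfolding cong1_def using F G s_LR LR_add by blast
qed

lemma integral_T: "integral (T i)"
  using T_cong_s linear_T[OF i] by (auto simp: integral_def cong1_def)

lemma integral_R: "integral (R i)"
  using integral_T linear_R[OF i]
  by (auto simp: integral_def R_def intro!: LR_mult LR_add LR_lconst local_ring tt_local)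

text \<open>Write \<open>F = s i (s i F)\<close> and replace the outer reflection by
  \<open>T i\<close>, which \<open>R i\<close> then cancels.\<close>

lemma R_cong_s: "F \<in> LR \<Longrightarrow> R i F \<approx> s i F"
proof -
  assume F: "F \<in> LR"
  have sF: "s i F \<in> LR" by (rule s_LR[OF F])
  have "R i F = R i (s i (s i F))"
    using F i by (simp add: s_s LR_L)
  also have "\<dots> \<approx> R i (T i (s i F))"
    by (rule integral_cong[OF integral_R cong1_sym[OF T_cong_s[OF sF]]])
  also have "R i (T i (s i F)) = s i F"
    by (rule R_T[OF LR_L[OF sF]])
  finally show ?thesis .
qed

end

lemma integral_Y: "1 \<le> i \<Longrightarrow> i \<le> int m \<Longrightarrow> integral (Y i)"
  and integral_Z: "1 \<le> i \<Longrightarrow> i \<le> int m \<Longrightarrow> integral (Z i)"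
  unfolding Y_def[abs_def] Z_def[abs_def]
  by (intro integral_comp[OF integral_scale[OF powi_local(2)]] integral_comp[OF integral_foldr]
      integral_comp[OF integral_P integral_foldr] integral_comp[OF integral_Q integral_foldr] integral_T integral_R; simp)+

text \<open>Modulo \<open>t - 1\<close> the word is \<open>s k ... s 1\<close>, whose product is the
  cycle sending 1 to \<open>k + 1\<close> and lowering \<open>2, ..., k + 1\<close> by one.\<close>

lemma foldr_R_cong:
  "0 \<le> k \<Longrightarrow> k < int m \<Longrightarrow> F \<in> LR \<Longrightarrow>
   foldr R (rev [1..k]) F \<approx> lsubst m (\<lambda>j. if j = 1 then k + 1 else if j \<le> k + 1 then j - 1 else j) F"
proof (induction k rule: int_ge_induct)
  case base
  have "lsubst m (\<lambda>j. if j = 1 then 0 + 1 else if j \<le> 0 + 1 then j - 1 else j) F = lsubst m (\<lambda>j. j) F"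
    by (rule lsubst_cong) auto
  then show ?case using base by (simp add: lsubst_id LR_L cong1_refl)
next
  case (step k)
  have k: "1 \<le> k + 1" "k + 1 < int m" using step by auto
  let ?\<sigma> = "\<lambda>k j. if j = 1 then k + 1 else if j \<le> k + 1 then j - 1 else j"
  have "foldr R (rev [1..k + 1]) F = R (k + 1) (foldr R (rev [1..k]) F)"
    using k by (simp add: upto_rec2[of 1 "k + 1"])
  also have "\<dots> \<approx> R (k + 1) (lsubst m (?\<sigma> k) F)"
    using step k by (intro integral_cong[OF integral_R[OF k]]) simp_all
  also have "\<dots> \<approx> s (k + 1) (lsubst m (?\<sigma> k) F)"
    by (rule R_cong_s[OF k LR_lsubst[OF step.prems(2)]])
  also have "\<dots> = lsubst m (?\<sigma> (k + 1)) F"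
    unfolding s_basic[OF k] lsubst_comp[OF m_pos periodic_aff_swap]
    using k by (intro lsubst_cong) (auto simp: aff_swap_basic)
  finally show ?case .
qed

text \<open>Periodic form of the index map behind the q-shift
  \<open>X_i \<mapsto> q^{-1} X_i\<close>; periodicity is required for composing it with
  reflections.\<close>

definition wrap :: "int \<Rightarrow> int \<Rightarrow> int" where
  "wrap i j = (if (j - i) mod int m = 0 then j + int m else j)"

lemma periodic_wrap: "periodic m (wrap i)"
proof -
  have "(j + int m * k - i) mod int m = (j - i) mod int m" for j k
    by (metis add_diff_eq add.commute diff_add_eq mod_mult_self2)
  then show ?thesis by (simp add: periodic_def wrap_def)
qed

lemma wrap_basic:
  assumes "1 \<le> i" "i \<le> int m" "1 \<le> j" "j \<le> int m"
  shows "wrap i j = (if j = i then j + int m else j)"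
proof -
  have "(j - i) mod int m = 0 \<longleftrightarrow> j = i"
    using assms by (auto simp: mod_eq_0_iff_dvd dest: zdvd_imp_le[rotated] zdvd_not_zless)
       (smt (verit, best) zdvd_not_zless dvd_minus_iff)
  then show ?thesis by (simp add: wrap_def)
qed

text \<open>At \<open>t = 1\<close>, \<open>Y i\<close> is the q-shift of the variable
  \<open>X_i\<close> followed by multiplication by \<open>X_i\<close>. For \<open>i = 1\<close> the
  shift in \<open>P\<close> and the cycle of \<open>foldr_R_cong\<close> compose to this; afterwards
  \<open>TYT\<close> becomes conjugation by \<open>s i\<close>.\<close>

lemma Y_cong:
  assumes "1 \<le> i" "i \<le> int m" "F \<in> LR"
  shows "Y i F \<approx> X i 1 * lsubst m (\<lambda>j. if j = i then j + int m else j) F"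
  using assms
proof (induction i arbitrary: F rule: int_ge_induct)
  case base
  let ?\<sigma> = "\<lambda>j. if j = 1 then int m - 1 + 1 else if j \<le> int m - 1 + 1 then j - 1 else j"
  have c: "lconst (tt powi n) * G \<approx> G" if "G \<in> LR" "n \<ge> 0" for G n
    using that(2)
  proof (induction n rule: int_ge_induct)
    case base show ?case using that by (simp add: cong1_refl)
  next
    case (step n)
    have "lconst (tt powi (n + 1)) * G = t * (lconst (tt powi n) * G)"
      by (simp add: power_int_add lconst_mult mult_ac)
    also have "\<dots> \<approx> t * G"
      by (rule integral_cong[OF integral_scale[OF tt_local(1)] step.IH])
    also have "\<dots> \<approx> G" by (rule cong1_scale[OF that(1)])
    finally show ?case .
  qed
  have V: "foldr R (rev [1..int m - 1]) F \<approx> lsubst m ?\<sigma> F"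
    using base by (intro foldr_R_cong) auto
  have "Y 1 F = lconst (tt powi (int m - 1)) * P (foldr R (rev [1..int m - 1]) F)"
    by (simp add: Y_def)
  also have "\<dots> \<approx> P (foldr R (rev [1..int m - 1]) F)"
    using V by (intro c integral_LR[OF integral_P]) (auto simp: cong1_def)
  also have "\<dots> \<approx> P (lsubst m ?\<sigma> F)"
    by (rule integral_cong[OF integral_P V])
  also have "\<dots> = X 1 1 * lsubst m (\<lambda>j. if j = 1 then j + int m else j) F"
    unfolding Pi_op_def lsubst_comp[OF m_pos periodic_shift]
    by (intro arg_cong2[of _ _ _ _ "(*)"] lsubst_cong) auto
  finally show ?case .
next
  case (step i)
  have i: "1 \<le> i" "i < int m" using step by auto
  interpret laurent_rep2 m using i by (rule rank2I)
  let ?\<sigma> = "\<lambda>i j. if j = i then j + int m else j"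
  have sF: "s i F \<in> LR" using s_LR[OF i] step.prems by auto
  have "Y (i + 1) F \<approx> t * Y (i + 1) F"
    using step i by (intro cong1_sym[OF cong1_scale] integral_LR[OF integral_Y]) simp_all
  also have "\<dots> = T i (Y i (T i F))"
    using i step.prems by (simp add: TYT LR_L)
  also have "\<dots> \<approx> T i (Y i (s i F))"
    using i step.prems
    by (intro integral_cong[OF integral_T[OF i]] integral_cong[OF integral_Y] T_cong_s) simp_all
  also have "\<dots> \<approx> T i (X i 1 * lsubst m (?\<sigma> i) (s i F))"
    using i step.IH[of "s i F"] sF by (intro integral_cong[OF integral_T[OF i]]) simp_all
  also have "\<dots> \<approx> s i (X i 1 * lsubst m (?\<sigma> i) (s i F))"
    using i sF by (intro T_cong_s LR_mult LR_X LR_lsubst) simp_all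
  also have "\<dots> = X (i + 1) 1 * lsubst m (aff_swap m i) (lsubst m (?\<sigma> i) (lsubst m (aff_swap m i) F))"
    using i by (simp add: s_mult X_swap) (simp add: s_basic)
  also have "lsubst m (?\<sigma> i) (lsubst m (aff_swap m i) F) = lsubst m (wrap i) (lsubst m (aff_swap m i) F)"
    using i by (intro lsubst_cong) (simp add: wrap_basic)
  also have "lsubst m (aff_swap m i) \<dots> = lsubst m (\<lambda>j. aff_swap m i (wrap i (aff_swap m i j))) F"
    by (simp add: lsubst_comp periodic_aff_swap periodic_wrap)
  also have "\<dots> = lsubst m (?\<sigma> (i + 1)) F"
  proof (rule lsubst_cong)
    fix j assume j: "1 \<le> j" "j \<le> int m"
    \<comment> \<open>For \<open>j = i + 1\<close> the wrapped index leaves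
      \<open>1, ..., m\<close>, so \<open>aff_swap_basic\<close> does not cover it.\<close>
    have "aff_swap m i (i + int m) = i + 1 + int m" by (simp add: aff_swap_def)
    then show "aff_swap m i (wrap i (aff_swap m i j)) = ?\<sigma> (i + 1) j"
      using i j by (simp add: aff_swap_basic wrap_basic)
  qed
  finally show ?case .
qed

end

section \<open>Monomials in the operators Y\<close>

lemma lin_ext_1: "lin_ext \<phi> 1 = \<phi> 0"
  unfolding single_one[symmetric] lin_ext_single by simp

lemma lin_ext_shift: "lin_ext \<phi> (single b 1 * p) = lin_ext (\<lambda>a. \<phi> (b + a)) p"
  by (rule keys_induct[of _ p]) (simp_all add: mult_single lin_ext_add distrib_left)

lemma linear_on_lin_ext:
  assumes "linear_on V A" "0 \<in> V" "\<And>F G. F \<in> V \<Longrightarrow> G \<in> V \<Longrightarrow> F + G \<in> V"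
    "\<And>c F. F \<in> V \<Longrightarrow> lconst c * F \<in> V" "\<And>a. \<phi> a \<in> V"
  shows "A (lin_ext \<phi> p) = lin_ext (\<lambda>a. A (\<phi> a)) p"
proof -
  have "lin_ext \<phi> p \<in> V \<and> A (lin_ext \<phi> p) = lin_ext (\<lambda>a. A (\<phi> a)) p"
  proof (rule keys_induct[of _ p])
    have "A (lconst 0 * 0) = lconst 0 * A 0"
      using assms by (intro linear_onD(3)[OF assms(1)])
    then show "lin_ext \<phi> 0 \<in> V \<and> A (lin_ext \<phi> 0) = lin_ext (\<lambda>a. A (\<phi> a)) 0"
      using assms(2) by simp
  qed (use assms in \<open>simp_all add: linear_on_def lin_ext_add\<close>)
  then show ?thesis ..
qed

context laurent_rep
begin

lemma linear_lin_ext: "linear_on L A \<Longrightarrow> (\<And>a. \<phi> a \<in> L) \<Longrightarrow> A (lin_ext \<phi> p) = lin_ext (\<lambda>a. A (\<phi> a)) p"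
  by (rule linear_on_lin_ext[where V = L]) auto

definition Ypow :: "int \<Rightarrow> int \<Rightarrow> lpoly \<Rightarrow> lpoly" where
  "Ypow j k F = (if k \<ge> 0 then (Y j ^^ nat k) F else (Z j ^^ nat (- k)) F)"

definition Ymonomial :: "(int \<Rightarrow>\<^sub>0 int) \<Rightarrow> lpoly \<Rightarrow> lpoly" where
  "Ymonomial a F = foldr (\<lambda>j. Ypow j (lookup a j)) [1..int m] F"

context
  fixes j :: int
  assumes j: "1 \<le> j" "j \<le> int m"
begin

lemma Ypow_in: "F \<in> L \<Longrightarrow> Ypow j k F \<in> L"
proof -
  assume F: "F \<in> L"
  have "(Y j ^^ n) F \<in> L" "(Z j ^^ n) F \<in> L" for n
    by (induction n) (use F j in \<open>simp_all add: Y_lin Z_lin\<close>)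
  then show ?thesis by (simp add: Ypow_def)
qed

lemma Y_Ypow: "F \<in> L \<Longrightarrow> Y j (Ypow j k F) = Ypow j (k + 1) F"
  and Z_Ypow: "F \<in> L \<Longrightarrow> Z j (Ypow j k F) = Ypow j (k - 1) F"
proof -
  assume F: "F \<in> L"
  have inL: "(Y j ^^ n) F \<in> L" "(Z j ^^ n) F \<in> L" for n
    by (induction n) (use F j in \<open>simp_all add: Y_lin Z_lin\<close>)
  show "Y j (Ypow j k F) = Ypow j (k + 1) F"
  proof (cases "k \<ge> 0")
    case True
    then show ?thesis by (simp add: Ypow_def nat_add_distrib)
  next
    case False
    then have "nat (- k) = Suc (nat (- (k + 1)))" by simp
    with False show ?thesis using j inL F by (cases "k = - 1") (simp_all add: Ypow_def YZ)
  qed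
  show "Z j (Ypow j k F) = Ypow j (k - 1) F"
  proof (cases "k > 0")
    case True
    then have "nat k = Suc (nat (k - 1))" by simp
    with True show ?thesis using j inL by (simp add: Ypow_def ZY)
  next
    case False
    then have "nat (- (k - 1)) = Suc (nat (- k))" by simp
    with False show ?thesis by (cases "k = 0") (simp_all add: Ypow_def)
  qed
qed

lemma Ypow_commute:
  assumes "\<And>F. F \<in> L \<Longrightarrow> A F \<in> L" "\<And>F. F \<in> L \<Longrightarrow> A (Y j F) = Y j (A F)" "\<And>F. F \<in> L \<Longrightarrow> A (Z j F) = Z j (A F)"
    and F: "F \<in> L"
  shows "A (Ypow j k F) = Ypow j k (A F)"
proof -
  have inL: "(Y j ^^ n) F \<in> L" "(Z j ^^ n) F \<in> L" for n
    by (induction n) (use F j in \<open>simp_all add: Y_lin Z_lin\<close>)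
  have "A ((Y j ^^ n) F) = (Y j ^^ n) (A F)" "A ((Z j ^^ n) F) = (Z j ^^ n) (A F)" for n
    by (induction n) (use inL in \<open>simp_all add: assms\<close>)
  then show ?thesis by (simp add: Ypow_def)
qed

end

lemma foldr_Ypow_in: "set xs \<subseteq> {1..int m} \<Longrightarrow> F \<in> L \<Longrightarrow> foldr (\<lambda>j. Ypow j (f j)) xs F \<in> L"
  by (induction xs) (auto simp: Ypow_in)

lemma Ymonomial_in: "F \<in> L \<Longrightarrow> Ymonomial a F \<in> L"
  unfolding Ymonomial_def by (rule foldr_Ypow_in) auto

text \<open>Isolates what \<open>Y i\<close> (\<open>d = 1\<close>) and \<open>Z i\<close>
  (\<open>d = - 1\<close>) share: each adds \<open>d\<close> to one exponent and commutes with all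
  other factors.\<close>

lemma foldr_Ypow_update:
  assumes A: "\<And>k F. F \<in> L \<Longrightarrow> A (Ypow i k F) = Ypow i (k + d) F"
    and comm: "\<And>j k F. 1 \<le> j \<Longrightarrow> j \<le> int m \<Longrightarrow> F \<in> L \<Longrightarrow> j \<noteq> i \<Longrightarrow> A (Ypow j k F) = Ypow j k (A F)"
    and xs: "distinct xs" "set xs \<subseteq> {1..int m}" "i \<in> set xs" and F: "F \<in> L"
  shows "A (foldr (\<lambda>j. Ypow j (f j)) xs F) = foldr (\<lambda>j. Ypow j (f j + (if j = i then d else 0))) xs F"
  using xs
proof (induction xs)
  case (Cons j xs)
  have G: "foldr (\<lambda>j. Ypow j (f j)) xs F \<in> L"
    using Cons.prems F by (intro foldr_Ypow_in) auto
  show ?case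
  proof (cases "j = i")
    case True
    then have "foldr (\<lambda>j. Ypow j (f j + (if j = i then d else 0))) xs F = foldr (\<lambda>j. Ypow j (f j)) xs F"
      using Cons.prems by (intro foldr_cong) auto
    then show ?thesis using True G A by simp
  next
    case False
    have "A (Ypow j (f j) (foldr (\<lambda>j. Ypow j (f j)) xs F)) = Ypow j (f j) (A (foldr (\<lambda>j. Ypow j (f j)) xs F))"
      using Cons.prems G False by (intro comm) auto
    then show ?thesis using Cons False by simp
  qed
qed simp

lemma Y_Ymonomial:
  assumes "1 \<le> i" "i \<le> int m" "F \<in> L"
  shows "Y i (Ymonomial a F) = Ymonomial (single i 1 + a) F"
    and "Z i (Ymonomial a F) = Ymonomial (single i (- 1) + a) F"
proof -
  have *: "lookup (single i d + a) j = lookup a j + (if j = i then d else 0)" for d j :: int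
    by (simp add: lookup_add lookup_single)
  have comm: "Y i (Ypow j k G) = Ypow j k (Y i G)" "Z i (Ypow j k G) = Ypow j k (Z i G)"
    if "1 \<le> j" "j \<le> int m" "G \<in> L" for j k G
    using assms that by (auto intro!: Ypow_commute simp: Y_lin Z_lin Y_commute Y_Z_commute Z_commute)

  show "Y i (Ymonomial a F) = Ymonomial (single i 1 + a) F"
    unfolding Ymonomial_def * using assms
    by (intro foldr_Ypow_update) (simp_all add: Y_Ypow comm)
  show "Z i (Ymonomial a F) = Ymonomial (single i (- 1) + a) F"
    unfolding Ymonomial_def * using assms
    by (intro foldr_Ypow_update) (simp_all add: Z_Ypow comm)
qed

text \<open>The exponent of \<open>q\<close> is left existential: independence only requires the
  leading coefficient to be a unit.\<close>

definition monomial_mod :: "lpoly \<Rightarrow> (int \<Rightarrow>\<^sub>0 int) \<Rightarrow> bool" where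
  "monomial_mod F a \<longleftrightarrow> keys a \<subseteq> {1..int m} \<and> (\<exists>k. F \<approx> lconst (qq powi k) * single a 1)"

lemma LR_monomial: "keys a \<subseteq> {1..int m} \<Longrightarrow> single a 1 \<in> LR"
  by (rule LR_single) (auto intro: local_ring)

lemma Y_monomial:
  assumes i: "1 \<le> i" "i \<le> int m" and a: "keys a \<subseteq> {1..int m}"
  shows "Y i (single a 1) \<approx> lconst (qq powi - lookup a i) * single (a + single i 1) 1"
proof -
  have "(\<Prod>j\<in>{1..int m}. X (if j = i then j + int m else j) (lookup a j)) =
    (\<Prod>j\<in>{1..int m}. (if j = i then lconst (qq powi - lookup a j) else 1) * X j (lookup a j))"
    using Xpow_periodic[OF m_pos, of i 1] by (intro prod.cong) auto
  also have "\<dots> = lconst (qq powi - lookup a i) * Xmonomial m (\<lambda>j. j) a"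
    using i by (simp add: prod.distrib Xmonomial_def)
  finally have e1: "lsubst m (\<lambda>j. if j = i then j + int m else j) (single a 1) = lconst (qq powi - lookup a i) * single a 1"
    unfolding lsubst_lin_ext lin_ext_single Xmonomial_id[OF a] by (simp add: Xmonomial_def)
  have e2: "X i 1 * (lconst (qq powi - lookup a i) * single a 1) = lconst (qq powi - lookup a i) * single (a + single i 1) 1"
    using i by (simp add: Xpow_basic lconst_single mult_single add.commute)
  show ?thesis
    using Y_cong[OF i LR_monomial[OF a]] unfolding e1 e2 .
qed

lemma keys_plus_single: "1 \<le> i \<Longrightarrow> i \<le> int m \<Longrightarrow> keys a \<subseteq> {1..int m} \<Longrightarrow> keys (a + single i (k::int)) \<subseteq> {1..int m}"
  using keys_add[of a "single i k"] by (auto split: if_splits)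

lemma integral_const_q: "integral (\<lambda>F. lconst (qq powi k) * F)"
  by (rule integral_scale[OF powi_local(1)])

lemma q_cancel: "lconst (qq powi k) * (lconst (qq powi l) * F) = lconst (qq powi (k + l)) * F"
  by (simp add: power_int_add lconst_mult mult.assoc)

lemma Y_monomial_mod:
  assumes i: "1 \<le> i" "i \<le> int m" and "monomial_mod F a"
  shows "monomial_mod (Y i F) (a + single i 1)"
proof -
  obtain k where k: "F \<approx> lconst (qq powi k) * single a 1" and a: "keys a \<subseteq> {1..int m}"
    using assms(3) by (auto simp: monomial_mod_def)
  have "Y i F \<approx> Y i (lconst (qq powi k) * single a 1)"
    by (rule integral_cong[OF integral_Y[OF i] k])
  also have "\<dots> = lconst (qq powi k) * Y i (single a 1)"
    by (rule Y_lin(3)[OF i LR_L[OF LR_monomial[OF a]]])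
  also have "\<dots> \<approx> lconst (qq powi k) * (lconst (qq powi - lookup a i) * single (a + single i 1) 1)"
    by (rule integral_cong[OF integral_const_q Y_monomial[OF i a]])
  finally show ?thesis
    unfolding q_cancel monomial_mod_def using keys_plus_single[OF i a] by blast
qed

lemma Z_monomial_mod:
  assumes i: "1 \<le> i" "i \<le> int m" and "monomial_mod F a"
  shows "monomial_mod (Z i F) (a + single i (- 1))"
proof -
  obtain k where k: "F \<approx> lconst (qq powi k) * single a 1" and a: "keys a \<subseteq> {1..int m}"
    using assms(3) by (auto simp: monomial_mod_def)
  define b where "b = a + single i (- 1)"
  have ab: "a = b + single i 1" by (simp add: b_def add.assoc flip: single_add)
  have b: "keys b \<subseteq> {1..int m}" unfolding b_def by (rule keys_plus_single[OF i a])
  note inL = LR_L[OF LR_monomial[OF a]] LR_L[OF LR_monomial[OF b]]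
  define l where "l = - lookup b i"
  \<comment> \<open>\<open>Z i\<close> inverts \<open>Y i\<close>, so it is applied to the
    congruence for \<open>Y i\<close> at the monomial \<open>b\<close> with one factor
    \<open>X_i\<close> fewer.\<close>
  have "single b 1 \<approx> Z i (lconst (qq powi l) * single a 1)"
    using integral_cong[OF integral_Z[OF i] Y_monomial[OF i b]] unfolding ZY[OF i inL(2)] ab l_def .
  also have "\<dots> = lconst (qq powi l) * Z i (single a 1)"
    by (rule Z_lin(3)[OF i inL(1)])
  finally have "lconst (qq powi - l) * single b 1 \<approx> Z i (single a 1)"
    using integral_cong[OF integral_const_q[of "- l"]] by (fastforce simp: q_cancel)
  then have Z: "Z i (single a 1) \<approx> lconst (qq powi - l) * single b 1"
    by (rule cong1_sym)
  have "Z i F \<approx> Z i (lconst (qq powi k) * single a 1)"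
    by (rule integral_cong[OF integral_Z[OF i] k])
  also have "\<dots> = lconst (qq powi k) * Z i (single a 1)"
    by (rule Z_lin(3)[OF i inL(1)])
  also have "\<dots> \<approx> lconst (qq powi k) * (lconst (qq powi - l) * single b 1)"
    by (rule integral_cong[OF integral_const_q Z])
  finally show ?thesis
    unfolding q_cancel monomial_mod_def using b unfolding b_def by blast
qed

lemma Ypow_monomial_mod:
  assumes j: "1 \<le> j" "j \<le> int m" and F: "monomial_mod F a"
  shows "monomial_mod (Ypow j k F) (a + single j k)"
proof -
  have "monomial_mod ((Y j ^^ n) F) (a + single j (int n))" for n
  proof (induction n)
    case (Suc n)
    have e: "a + single j (int (Suc n)) = a + single j (int n) + single j (1)"
      by (rule poly_mapping_eqI) (simp add: lookup_add lookup_single when_def)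
    from Y_monomial_mod[OF j Suc] show ?case by (simp only: e funpow.simps comp_apply)
  qed (use F in simp)
  moreover have "monomial_mod ((Z j ^^ n) F) (a + single j (- int n))" for n
  proof (induction n)
    case (Suc n)
    have e: "a + single j (- int (Suc n)) = a + single j (- int n) + single j (- 1)"
      by (rule poly_mapping_eqI) (simp add: lookup_add lookup_single when_def)
    from Z_monomial_mod[OF j Suc] show ?case by (simp only: e funpow.simps comp_apply)
  qed (use F in simp)
  from calculation[of "nat k"] this[of "nat (- k)"] show ?thesis
    by (cases "k \<ge> 0") (simp_all add: Ypow_def)
qed

lemma Ymonomial_monomial_mod:
  assumes "keys a \<subseteq> {1..int m}"
  shows "monomial_mod (Ymonomial a 1) a"
proof -
  have base: "monomial_mod 1 0"
    unfolding monomial_mod_def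
    using cong1_refl[OF LR_1] by (intro conjI exI[of _ 0]) simp_all
  have "monomial_mod (foldr (\<lambda>j. Ypow j (lookup a j)) xs 1) (\<Sum>j\<leftarrow>xs. single j (lookup a j))"
    if "set xs \<subseteq> {1..int m}" for xs
    using that
  proof (induction xs)
    case (Cons j xs)
    then show ?case
      using Ypow_monomial_mod[of j "foldr (\<lambda>j. Ypow j (lookup a j)) xs 1" "\<Sum>j\<leftarrow>xs. single j (lookup a j)"]
      by (simp add: add.commute)
  qed (simp add: base)
  from this[of "[1..int m]"] have "monomial_mod (Ymonomial a 1) (\<Sum>j\<leftarrow>[1..int m]. single j (lookup a j))"
    by (simp add: Ymonomial_def)
  also have "(\<Sum>j\<leftarrow>[1..int m]. single j (lookup a j)) = (\<Sum>j\<in>{1..int m}. single j (lookup a j))"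
    by (simp add: sum_list_distinct_conv_sum_set)
  also have "\<dots> = (\<Sum>j\<in>keys a. single j (lookup a j))"
    using assms by (intro sum.mono_neutral_right) (auto simp: in_keys_iff)
  also have "\<dots> = a" by (rule poly_mapping_expansion[symmetric])
  finally show ?thesis .
qed

text \<open>Scale a vanishing combination by \<open>primitive_scaling\<close>. Modulo
  \<open>t - 1\<close> it becomes a combination of distinct monomials whose coefficients are changed
  only by powers of \<open>q\<close>, so every scaled coefficient is divisible by
  \<open>t - 1\<close>, contradicting primitivity. The hypothesis \<open>p \<in> L\<close> matters
  because \<open>Ymonomial\<close> reads only the exponents at \<open>1, ..., m\<close>.\<close>

theorem Ymonomial_independent:
  assumes p: "p \<in> L" and zero: "lin_ext (\<lambda>a. Ymonomial a 1) p = 0"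
  shows "p = 0"
proof (rule ccontr)
  assume "p \<noteq> 0"
  then obtain d a0 where d: "\<And>b. d * lookup p b \<in> local_at_1"
    and a0: "\<And>h. h \<in> local_at_1 \<Longrightarrow> d * lookup p a0 \<noteq> (tt - 1) * h"
    by (rule primitive_scaling) blast
  define r where "r = lconst d * p"
  have r: "lookup r b \<in> local_at_1" for b by (simp add: r_def lookup_lconst_mult d)
  have rL: "keys b \<subseteq> {1..int m}" if "b \<in> keys r" for b
    using p that by (auto simp: r_def laurent_def in_keys_iff lookup_lconst_mult)
  have "\<exists>k H. H \<in> LR \<and> Ymonomial b 1 = lconst (qq powi k) * single b 1 + lconst (tt - 1) * H" if "b \<in> keys r" for b
    using Ymonomial_monomial_mod[OF rL[OF that]] by (auto simp: monomial_mod_def cong1_def)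
  then obtain k H where kH: "H b \<in> LR" "Ymonomial b 1 = lconst (qq powi k b) * single b 1 + lconst (tt - 1) * H b"
    if "b \<in> keys r" for b by metis
  have "lin_ext (\<lambda>a. Ymonomial a 1) r = 0"
    by (simp add: r_def lin_ext_lconst zero)
  moreover have "lin_ext (\<lambda>a. Ymonomial a 1) r =
      (\<Sum>b\<in>keys r. single b (lookup r b * qq powi k b)) + lconst (tt - 1) * (\<Sum>b\<in>keys r. lconst (lookup r b) * H b)"
    unfolding lin_ext_def sum_distrib_left sum.distrib[symmetric]
    by (intro sum.cong refl) (simp add: kH(2) distrib_left lconst_single mult.left_commute)
  ultimately have "lookup ((\<Sum>b\<in>keys r. single b (lookup r b * qq powi k b)) + lconst (tt - 1) * (\<Sum>b\<in>keys r. lconst (lookup r b) * H b)) a0 = 0"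
    by simp
  moreover define h where "h = lookup (\<Sum>b\<in>keys r. lconst (lookup r b) * H b) a0"
  moreover have "lookup (\<Sum>b\<in>keys r. single b (lookup r b * qq powi k b)) a0 = lookup r a0 * qq powi k a0"
    by (simp add: lookup_sum lookup_single when_def in_keys_iff)
  ultimately have e: "lookup r a0 * qq powi k a0 + (tt - 1) * h = 0"
    by (simp add: lookup_add lookup_lconst_mult)
  have "(\<Sum>b\<in>keys r. lconst (lookup r b) * H b) \<in> LR"
    by (intro LR_sum LR_mult LR_lconst r kH(1))
  then have h: "h \<in> local_at_1" by (simp add: h_def laurent_over_def)
  have neg: "lookup r a0 * qq powi k a0 = - ((tt - 1) * h)"
    using e by (simp only: eq_neg_iff_add_eq_0)
  have "d * lookup p a0 = lookup r a0 * qq powi k a0 * qq powi - k a0"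
    by (simp add: r_def lookup_lconst_mult mult.assoc flip: power_int_add)
  also have "\<dots> = (tt - 1) * ((0 - h) * qq powi - k a0)"
    unfolding neg by (simp add: mult.assoc)
  finally have "d * lookup p a0 = (tt - 1) * ((0 - h) * qq powi - k a0)" .
  moreover have "(0 - h) * qq powi - k a0 \<in> local_at_1"
    by (intro local_ring(5) local_ring(4) local_ring(1) h powi_local)
  ultimately show False using a0 by blast
qed

section \<open>The cyclic module generated by a pair of symmetric vectors\<close>

text \<open>Closure is built in only for scalars, sums, \<open>Y i\<close> and \<open>Z i\<close>,
  which keeps \<open>cyclic_pairs_expansion\<close> provable; closure under the remaining operators
  is then a theorem.\<close>

inductive_set cyclic_pairs :: "lpoly \<Rightarrow> (lpoly \<times> lpoly) set" for v where
  base: "(1, v) \<in> cyclic_pairs v"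
| add: "(F, G) \<in> cyclic_pairs v \<Longrightarrow> (F', G') \<in> cyclic_pairs v \<Longrightarrow> (F + F', G + G') \<in> cyclic_pairs v"
| scale: "(F, G) \<in> cyclic_pairs v \<Longrightarrow> (lconst c * F, lconst c * G) \<in> cyclic_pairs v"
| Y: "(F, G) \<in> cyclic_pairs v \<Longrightarrow> 1 \<le> i \<Longrightarrow> i \<le> int m \<Longrightarrow> (Y i F, Y i G) \<in> cyclic_pairs v"
| Z: "(F, G) \<in> cyclic_pairs v \<Longrightarrow> 1 \<le> i \<Longrightarrow> i \<le> int m \<Longrightarrow> (Z i F, Z i G) \<in> cyclic_pairs v"

lemma cyclic_pairs_diff:
  assumes "(F, G) \<in> cyclic_pairs v" "(F', G') \<in> cyclic_pairs v"
  shows "(F - F', G - G') \<in> cyclic_pairs v"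
  using cyclic_pairs.add[OF assms(1) cyclic_pairs.scale[OF assms(2), of "- 1"]]
  by (simp add: lconst_uminus)

context
  fixes v assumes v: "v \<in> L"
begin

text \<open>The rules treat both coordinates alike, so the same \<open>p\<close> serves for both;
  \<open>Y i\<close> and \<open>Z i\<close> multiply \<open>p\<close> by a variable or its
  inverse.\<close>

lemma cyclic_pairs_expansion:
  assumes "(F, G) \<in> cyclic_pairs v"
  shows "\<exists>p\<in>L. F = lin_ext (\<lambda>a. Ymonomial a 1) p \<and> G = lin_ext (\<lambda>a. Ymonomial a v) p"
  using assms
proof (induction rule: cyclic_pairs.induct)
  case base
  have "Ymonomial 0 F = F" for F
  proof -
    have "foldr (\<lambda>j. Ypow j 0) xs F = F" for xs
      by (induction xs) (simp_all add: Ypow_def)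
    then show ?thesis by (simp add: Ymonomial_def)
  qed
  then show ?case
    by (intro bexI[of _ 1]) (simp_all add: lin_ext_1)
next
  case (add F G F' G')
  then obtain p p' where p: "p \<in> L" "p' \<in> L"
    "F = lin_ext (\<lambda>a. Ymonomial a 1) p" "G = lin_ext (\<lambda>a. Ymonomial a v) p"
    "F' = lin_ext (\<lambda>a. Ymonomial a 1) p'" "G' = lin_ext (\<lambda>a. Ymonomial a v) p'" by blast
  show ?case unfolding p(3-) using p(1,2) by (intro bexI[of _ "p + p'"]) (simp_all add: lin_ext_add)
next
  case (scale F G c)
  then obtain p where p: "p \<in> L"
    "F = lin_ext (\<lambda>a. Ymonomial a 1) p" "G = lin_ext (\<lambda>a. Ymonomial a v) p" by blast
  show ?case unfolding p(2-) using p(1) by (intro bexI[of _ "lconst c * p"]) (simp_all add: lin_ext_lconst)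
next
  case (Y F G i)
  then obtain p where p: "p \<in> L"
    "F = lin_ext (\<lambda>a. Ymonomial a 1) p" "G = lin_ext (\<lambda>a. Ymonomial a v) p" by blast
  have "single (single i 1) 1 \<in> L" using Y.hyps by (intro laurent_single) auto
  then show ?case unfolding p(2-) using p(1) Y.hyps v
    by (intro bexI[of _ "single (single i 1) 1 * p"])
       (simp_all add: lin_ext_shift linear_lin_ext[OF linear_Y] Ymonomial_in Y_Ymonomial)
next
  case (Z F G i)
  then obtain p where p: "p \<in> L"
    "F = lin_ext (\<lambda>a. Ymonomial a 1) p" "G = lin_ext (\<lambda>a. Ymonomial a v) p" by blast
  have "single (single i (- 1)) 1 \<in> L" using Z.hyps by (intro laurent_single) auto
  then show ?case unfolding p(2-) using p(1) Z.hyps v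
    by (intro bexI[of _ "single (single i (- 1)) 1 * p"])
       (simp_all add: lin_ext_shift linear_lin_ext[OF linear_Z] Ymonomial_in Y_Ymonomial)
qed

text \<open>The difference of the two pairs has first coordinate 0, so its common coefficient family
  \<open>p\<close> vanishes by independence, and with it the second coordinate.\<close>

lemma cyclic_pairs_functional:
  assumes "(F, G) \<in> cyclic_pairs v" "(F, G') \<in> cyclic_pairs v"
  shows "G = G'"
proof -
  obtain p where p: "p \<in> L" "F - F = lin_ext (\<lambda>a. Ymonomial a 1) p" "G - G' = lin_ext (\<lambda>a. Ymonomial a v) p"
    using cyclic_pairs_expansion[OF cyclic_pairs_diff[OF assms]] by blast
  then have "p = 0" using Ymonomial_independent[OF p(1)] by simp
  then show ?thesis using p(3) by simp
qed

lemma cyclic_pairs_in: "(F, G) \<in> cyclic_pairs v \<Longrightarrow> F \<in> L \<and> G \<in> L"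
  by (induction rule: cyclic_pairs.induct) (simp_all add: v Y_lin Z_lin)

end

section \<open>Bernstein relations and stability of the module of pairs\<close>

context
  fixes i :: int
  assumes i: "1 \<le> i" "i < int m"
begin

lemma tR: "t * R i F = T i F - (t - 1) * F"
proof -
  have "t * lconst (inverse tt) = 1" by (simp flip: lconst_mult)
  then have "t * R i F = T i F + lconst (1 - tt) * F"
    by (simp add: R_def mult.assoc[symmetric])
  then show ?thesis by (simp add: lconst_diff algebra_simps)
qed

text \<open>From \<open>TYT\<close> in the form \<open>T i Y i = t Y (i + 1) R i\<close>, with
  \<open>t R i = T i - (t - 1)\<close>.\<close>

lemma T_Y_same: "F \<in> L \<Longrightarrow> T i (Y i F) = Y (i + 1) (T i F) - (t - 1) * Y (i + 1) F"
proof -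
  assume F: "F \<in> L"
  have "T i (Y i F) = t * Y (i + 1) (R i F)"
    using TYT[OF i, of "R i F"] F i by (simp add: TR R_in)
  also have "\<dots> = Y (i + 1) (t * R i F)"
    using i F by (simp add: Y_lin R_in)
  also have "t * R i F = T i F + lconst (1 - tt) * F"
    unfolding tR by (simp add: lconst_diff algebra_simps)
  also have "Y (i + 1) \<dots> = Y (i + 1) (T i F) + lconst (1 - tt) * Y (i + 1) F"
    using i F by (simp add: Y_lin T_in)
  finally show ?thesis by (simp add: lconst_diff algebra_simps)
qed

lemma T_Y_next: "F \<in> L \<Longrightarrow> T i (Y (i + 1) F) = (t - 1) * Y (i + 1) F + Y i (T i F)"
proof -
  assume F: "F \<in> L"
  have "t * T i (Y (i + 1) F) = T i (T i (Y i (T i F)))"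
    using i F linear_onD(3)[OF linear_T[OF i], of "Y (i + 1) F" tt] by (simp add: TYT Y_lin)
  also have "\<dots> = (t - 1) * T i (Y i (T i F)) + t * Y i (T i F)"
    using i F by (intro T_quad) (simp_all add: Y_lin T_in)
  also have "\<dots> = t * ((t - 1) * Y (i + 1) F + Y i (T i F))"
    using i F by (simp add: TYT algebra_simps)
  finally show ?thesis by (simp only: t_cancel)
qed

text \<open>The relation \<open>T_Y_same\<close> at \<open>Z i F\<close>, solved for
  \<open>T i (Z i F)\<close> by applying \<open>Z (i + 1)\<close>.\<close>

lemma T_Z_same: "F \<in> L \<Longrightarrow> T i (Z i F) = Z (i + 1) (T i F) + (t - 1) * Z i F"
proof -
  assume F: "F \<in> L"
  have "T i F = Y (i + 1) (T i (Z i F)) - (t - 1) * Y (i + 1) (Z i F)"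
    using T_Y_same[of "Z i F"] F i by (simp add: YZ Z_lin)
  also have "\<dots> = Y (i + 1) (T i (Z i F) + lconst (1 - tt) * Z i F)"
    using F i by (simp add: Y_lin T_in Z_lin) (simp add: lconst_diff algebra_simps)
  finally have "Z (i + 1) (T i F) = T i (Z i F) + lconst (1 - tt) * Z i F"
    using F i by (simp add: ZY T_in Z_lin)
  then show ?thesis by (simp add: lconst_diff algebra_simps)
qed

lemma T_Z_next: "F \<in> L \<Longrightarrow> T i (Z (i + 1) F) = Z i (T i F) - (t - 1) * Z i F"
proof -
  assume F: "F \<in> L"
  have "T i F = (t - 1) * F + Y i (T i (Z (i + 1) F))"
    using T_Y_next[of "Z (i + 1) F"] F i by (simp add: YZ Z_lin)
  then have "Y i (T i (Z (i + 1) F)) = T i F + lconst (1 - tt) * F"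
    by (simp add: lconst_diff algebra_simps)
  then have "T i (Z (i + 1) F) = Z i (T i F + lconst (1 - tt) * F)"
    using ZY[of i "T i (Z (i + 1) F)"] F i by (simp add: T_in Z_lin)
  also have "\<dots> = Z i (T i F) + lconst (1 - tt) * Z i F"
    using F i by (simp add: T_in Z_lin)
  finally show ?thesis by (simp add: lconst_diff algebra_simps)
qed

lemma T_Z_far:
  assumes "1 \<le> j" "j \<le> int m" "i \<noteq> j" "i \<noteq> j - 1" "F \<in> L"
  shows "T i (Z j F) = Z j (T i F)"
proof -
  have "Z j (T i F) = Z j (T i (Y j (Z j F)))" using assms by (simp add: YZ)
  also have "\<dots> = Z j (Y j (T i (Z j F)))" using assms i T_Y[of j i "Z j F"] by (simp add: Z_lin)
  also have "\<dots> = T i (Z j F)" using assms i by (simp add: ZY T_in Z_lin)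
  finally show ?thesis ..
qed

end

lemma T_one: "1 \<le> i \<Longrightarrow> i < int m \<Longrightarrow> T i 1 = t * 1"
proof -
  assume i: "1 \<le> i" "i < int m"
  then interpret laurent_rep2 m by (rule rank2I)
  have "D i 1 = 0" by (rule D_eqI) (simp_all add: s_1 i)
  then show ?thesis by (simp add: T_D s_1 i)
qed

context
  fixes v assumes v: "v \<in> L" and symmetric: "\<And>i. 1 \<le> i \<Longrightarrow> i < int m \<Longrightarrow> T i v = t * v"
begin

lemma cyclic_pairs_scale': "(F, G) \<in> cyclic_pairs v \<Longrightarrow> ((t - 1) * F, (t - 1) * G) \<in> cyclic_pairs v"
  using cyclic_pairs.scale[of F G v "tt - 1"] by (simp add: lconst_diff)

text \<open>The base case is where symmetry enters: \<open>1\<close> and \<open>v\<close> have the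
  same eigenvalue \<open>t\<close>, so the generating pair is merely scaled. In the other cases the
  Bernstein relations move \<open>T i\<close> inwards with the same coefficients in both
  coordinates.\<close>

lemma cyclic_pairs_T:
  assumes "(F, G) \<in> cyclic_pairs v" "1 \<le> i" "i < int m"
  shows "(T i F, T i G) \<in> cyclic_pairs v"
  using assms
proof (induction rule: cyclic_pairs.induct)
  case base
  then show ?case using cyclic_pairs.scale[OF cyclic_pairs.base] by (simp add: T_one[simplified] symmetric)
next
  case (add F G F' G')
  then show ?case
    using cyclic_pairs_in[OF v add.hyps(1)] cyclic_pairs_in[OF v add.hyps(2)]
    by (simp add: linear_onD(2)[OF linear_T] cyclic_pairs.add)
next
  case (scale F G c)
  then show ?case
    using cyclic_pairs_in[OF v scale.hyps(1)]
    by (simp add: linear_onD(3)[OF linear_T] cyclic_pairs.scale)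
next
  case (Y F G j)
  have inL: "F \<in> L" "G \<in> L" using cyclic_pairs_in[OF v Y.hyps(1)] by auto
  have IH: "(T i F, T i G) \<in> cyclic_pairs v" using Y by blast
  note i = Y.prems
  consider "j = i" | "j = i + 1" | "i \<noteq> j" "i \<noteq> j - 1" by linarith
  then show ?case
  proof cases
    case 1
    then show ?thesis unfolding 1 T_Y_same[OF i inL(1)] T_Y_same[OF i inL(2)]
      using i by (intro cyclic_pairs_diff cyclic_pairs_scale' cyclic_pairs.Y IH Y.hyps(1)) auto
  next
    case 2
    then show ?thesis unfolding 2 T_Y_next[OF i inL(1)] T_Y_next[OF i inL(2)]
      using i by (intro cyclic_pairs.add cyclic_pairs_scale' cyclic_pairs.Y IH Y.hyps(1)) auto
  next
    case 3
    then show ?thesis using i inL Y.hyps by (simp add: T_Y cyclic_pairs.Y IH)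
  qed
next
  case (Z F G j)
  have inL: "F \<in> L" "G \<in> L" using cyclic_pairs_in[OF v Z.hyps(1)] by auto
  have IH: "(T i F, T i G) \<in> cyclic_pairs v" using Z by blast
  note i = Z.prems
  consider "j = i" | "j = i + 1" | "i \<noteq> j" "i \<noteq> j - 1" by linarith
  then show ?case
  proof cases
    case 1
    then show ?thesis unfolding 1 T_Z_same[OF i inL(1)] T_Z_same[OF i inL(2)]
      using i by (intro cyclic_pairs.add cyclic_pairs_scale' cyclic_pairs.Z IH Z.hyps(1)) auto
  next
    case 2
    then show ?thesis unfolding 2 T_Z_next[OF i inL(1)] T_Z_next[OF i inL(2)]
      using i by (intro cyclic_pairs_diff cyclic_pairs_scale' cyclic_pairs.Z IH Z.hyps(1)) auto
  next
    case 3
    then show ?thesis using i inL Z.hyps by (simp add: T_Z_far cyclic_pairs.Z IH)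
  qed
qed

lemma cyclic_pairs_R:
  "(F, G) \<in> cyclic_pairs v \<Longrightarrow> 1 \<le> i \<Longrightarrow> i < int m \<Longrightarrow> (R i F, R i G) \<in> cyclic_pairs v"
  unfolding R_def by (intro cyclic_pairs.scale cyclic_pairs.add cyclic_pairs_T)

lemma cyclic_pairs_foldr:
  assumes "(F, G) \<in> cyclic_pairs v" "set xs \<subseteq> {1..<int m}"
  shows "(foldr T xs F, foldr T xs G) \<in> cyclic_pairs v" "(foldr R xs F, foldr R xs G) \<in> cyclic_pairs v"
  using assms(2) by (induction xs) (simp_all add: assms(1) cyclic_pairs_T cyclic_pairs_R)

text \<open>By \<open>Y1_U\<close>, \<open>P\<close> is a scalar multiple of
  \<open>Y 1 T 1 ... T (m - 1)\<close>.\<close>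

lemma cyclic_pairs_P:
  assumes "(F, G) \<in> cyclic_pairs v" shows "(P F, P G) \<in> cyclic_pairs v"
proof -
  have e: "P H = lconst (tt powi (- (int m - 1))) * Y 1 (foldr T [1..int m - 1] H)" if "H \<in> L" for H
    unfolding Y1_U[OF that] using powi_inverse[of "- (int m - 1)" "P H"] by simp
  have inL: "F \<in> L" "G \<in> L" using cyclic_pairs_in[OF v assms] by auto
  show ?thesis
    unfolding e[OF inL(1)] e[OF inL(2)]
    by (intro cyclic_pairs.scale cyclic_pairs.Y cyclic_pairs_foldr assms) auto
qed

lemma cyclic_pairs_Q:
  assumes "(F, G) \<in> cyclic_pairs v" shows "(Q F, Q G) \<in> cyclic_pairs v"
proof -
  define c where "c = tt powi (int m - 1)"
  have e: "Q H = foldr R (rev [1..int m - 1]) (lconst c * Z 1 H)" if "H \<in> L" for H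
  proof -
    have "foldr T [1..int m - 1] (Q H) = Z 1 (Y 1 (foldr T [1..int m - 1] (Q H)))"
      using that by (intro ZY[symmetric] foldr_T_in) auto
    also have "\<dots> = lconst c * Z 1 H"
      using that by (simp add: Y1_U c_def Z_lin)
    finally show ?thesis
      using foldr_RT[of "rev [1..int m - 1]" "Q H"] that by (simp add: subset_iff)
  qed
  have inL: "F \<in> L" "G \<in> L" using cyclic_pairs_in[OF v assms] by auto
  show ?thesis
    unfolding e[OF inL(1)] e[OF inL(2)]
    by (intro cyclic_pairs.scale cyclic_pairs.Z cyclic_pairs_foldr assms) auto
qed

lemma cyclic_pairs_gen_op:
  assumes g: "g \<in> hgens m" and FG: "(F, G) \<in> cyclic_pairs v"
  shows "(gen_op m g F, gen_op m g G) \<in> cyclic_pairs v"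
proof (cases g)
  case (GT i)
  then have i: "m \<noteq> 1" "0 \<le> i" "i < int m" using g by (auto simp: hgens_def T_index_def split: if_splits)
  then have m2: "2 \<le> m" using m_pos by linarith
  then interpret laurent_rep2 m by unfold_locales
  have gen: "gen_op m g H = T i H" for H using i by (simp add: GT T_def)
  show ?thesis
  proof (cases "i = 0")
    case True
    have inL: "F \<in> L" "G \<in> L" using cyclic_pairs_in[OF v FG] by auto
    \<comment> \<open>The index 0 lies outside \<open>cyclic_pairs_T\<close>; it is reached from
      \<open>m - 1\<close> by conjugation with \<open>P\<close>.\<close>
    have "T i H = P (T (int m - 1) (Q H))" if "H \<in> L" for H
      using T_shift[OF that, of "int m - 1"] T_mod[of "int m"] True by simp
    then show ?thesis
      using inL m2 by (simp add: gen cyclic_pairs_P cyclic_pairs_T cyclic_pairs_Q FG)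
  next
    case False
    then show ?thesis using i FG by (simp add: gen cyclic_pairs_T)
  qed
next
  case GPi
  then show ?thesis using FG by (simp add: cyclic_pairs_P)
next
  case GPiInv
  then show ?thesis using cyclic_pairs_Q[OF FG] by (simp add: Q_def)
qed

end

end

section \<open>The affine Hecke algebra and its action\<close>

lemma letters_plus [simp]: "letters (u + v) = letters u @ letters v" "letters 0 = []"
  by (simp_all add: plus_hword_def zero_hword_def)

lemma free_algebra_simps [simp]:
  "x \<otimes>\<^bsub>free_algebra m\<^esub> y = x * y" "x \<oplus>\<^bsub>free_algebra m\<^esub> y = x + y"
  "\<one>\<^bsub>free_algebra m\<^esub> = 1" "\<zero>\<^bsub>free_algebra m\<^esub> = 0"
  by (simp_all add: free_algebra_def)

lemma free_algebra_carrier: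
  "a \<in> carrier (free_algebra m) \<longleftrightarrow> (\<forall>w\<in>keys a. set (letters w) \<subseteq> hgens m)"
  by (simp add: free_algebra_def)

lemma carrier_free_add: "a \<in> carrier (free_algebra m) \<Longrightarrow> b \<in> carrier (free_algebra m) \<Longrightarrow> a + b \<in> carrier (free_algebra m)"
  unfolding free_algebra_carrier using keys_add[of a b] by blast

lemma carrier_free_uminus: "a \<in> carrier (free_algebra m) \<Longrightarrow> - a \<in> carrier (free_algebra m)"
  unfolding free_algebra_carrier by (simp add: in_keys_iff)

lemma carrier_free_mult:
  assumes "a \<in> carrier (free_algebra m)" "b \<in> carrier (free_algebra m)"
  shows "a * b \<in> carrier (free_algebra m)"
  unfolding free_algebra_carrier
proof
  fix w assume "w \<in> keys (a * b)"
  then obtain u v where "w = u + v" "u \<in> keys a" "v \<in> keys b" using keys_mult[of a b] by blast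
  then show "set (letters w) \<subseteq> hgens m" using assms by (simp add: free_algebra_carrier)
qed

lemma carrier_free_fconst: "fconst c \<in> carrier (free_algebra m)"
  by (simp add: free_algebra_carrier fconst_def)

lemma carrier_free_0: "0 \<in> carrier (free_algebra m)" and carrier_free_1: "1 \<in> carrier (free_algebra m)"
  by (simp_all add: free_algebra_carrier)

lemma carrier_free_fgen: "g \<in> hgens m \<Longrightarrow> fgen g \<in> carrier (free_algebra m)"
  by (simp add: free_algebra_carrier fgen_def)

lemma carrier_free_diff: "a \<in> carrier (free_algebra m) \<Longrightarrow> b \<in> carrier (free_algebra m) \<Longrightarrow> a - b \<in> carrier (free_algebra m)"
  using carrier_free_add[of a m "- b"] carrier_free_uminus[of b m] by simp

lemmas carrier_free = carrier_free_add carrier_free_uminus carrier_free_diff carrier_free_mult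
  carrier_free_fconst carrier_free_0 carrier_free_1 carrier_free_fgen

lemma ring_free_algebra: "ring (free_algebra m)"
proof (rule ringI)
  show "abelian_group (free_algebra m)"
  proof (rule abelian_groupI)
    fix x assume "x \<in> carrier (free_algebra m)"
    then show "\<exists>y\<in>carrier (free_algebra m). y \<oplus>\<^bsub>free_algebra m\<^esub> x = \<zero>\<^bsub>free_algebra m\<^esub>"
      by (intro bexI[of _ "- x"]) (simp_all add: carrier_free)
  qed (simp_all add: carrier_free add_ac)
  show "monoid (free_algebra m)"
    by (rule monoidI) (simp_all add: carrier_free mult.assoc)
qed (simp_all add: distrib_left distrib_right)

lemma fconst_central: "fconst c * a = a * fconst c"
  by (rule keys_induct[of _ a]) (simp_all add: fconst_def mult_single distrib_left distrib_right mult.commute)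

lemma fconst_mult: "fconst c * fconst d = fconst (c * d)"
  and fconst_1: "fconst 1 = 1"
  and fconst_diff: "fconst (c - d) = fconst c - fconst d"
  by (simp_all add: fconst_def mult_single single_diff)

section \<open>Action of the free algebra and its descent to the quotient\<close>

context laurent_rep
begin

definition word_op :: "hword \<Rightarrow> lpoly \<Rightarrow> lpoly" where
  "word_op w = foldr (gen_op m) (letters w)"

lemma free_act_lin_ext: "free_act m a F = lin_ext (\<lambda>w. word_op w F) a"
  by (simp add: free_act_def lin_ext_def word_op_def)

lemma linear_gen_op: "g \<in> hgens m \<Longrightarrow> linear_on L (gen_op m g)"
proof (cases g)
  case (GT i)
  assume "g \<in> hgens m"
  then have i: "m \<noteq> 1" "0 \<le> i" "i < int m" using GT by (auto simp: hgens_def T_index_def split: if_splits)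
  then interpret laurent_rep2 m using m_pos by unfold_locales simp
  have "gen_op m g = T i" using i by (simp add: GT T_def fun_eq_iff)
  then show ?thesis by (simp add: linear_on_def T_add T_lconst)
next
  case GPi
  then show ?thesis by (simp add: linear_P cong: linear_on_def) (simp add: linear_on_def P_add P_lconst)
next
  case GPiInv
  then have "gen_op m g = Q" by (simp add: Q_def fun_eq_iff)
  then show ?thesis by (simp add: linear_Q)
qed

lemma linear_word_op: "set (letters w) \<subseteq> hgens m \<Longrightarrow> linear_on L (word_op w)"
  unfolding word_op_def by (intro linear_on_foldr linear_gen_op) auto

lemma word_op_plus: "word_op (w + w') F = word_op w (word_op w' F)"
  by (simp add: word_op_def)

lemma free_act_in: "a \<in> carrier (free_algebra m) \<Longrightarrow> F \<in> L \<Longrightarrow> free_act m a F \<in> L"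
  unfolding free_act_lin_ext
  by (rule lin_ext_laurent) (auto simp: free_algebra_carrier intro: linear_onD(1)[OF linear_word_op])

lemma free_act_add: "free_act m (a + b) F = free_act m a F + free_act m b F"
  and free_act_diff: "free_act m (a - b) F = free_act m a F - free_act m b F"
  and free_act_uminus: "free_act m (- a) F = - free_act m a F"
  and free_act_0: "free_act m 0 F = 0"
  by (simp_all add: free_act_lin_ext lin_ext_add lin_ext_diff lin_ext_uminus)

lemma free_act_fconst: "free_act m (fconst c) F = lconst c * F"
  by (simp add: free_act_lin_ext fconst_def word_op_def)

lemma free_act_1: "free_act m 1 F = F"
  using free_act_fconst[of 1] by (simp add: fconst_1)

lemma free_act_fgen: "free_act m (fgen g) F = gen_op m g F"
  by (simp add: free_act_lin_ext fgen_def word_op_def)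

lemma free_act_mult:
  assumes a: "a \<in> carrier (free_algebra m)" and b: "b \<in> carrier (free_algebra m)" and F: "F \<in> L"
  shows "free_act m (a * b) F = free_act m a (free_act m b F)"
proof (rule keys_induct[of _ a])
  fix w c assume "w \<in> keys a"
  then have lin: "linear_on L (word_op w)" using a by (auto simp: free_algebra_carrier intro: linear_word_op)
  have "free_act m (single w c * b) F = lconst c * word_op w (free_act m b F) \<and> free_act m b F \<in> L"
  proof (rule keys_induct[of _ b])
    show "free_act m (single w c * 0) F = lconst c * word_op w (free_act m 0 F) \<and> free_act m 0 F \<in> L"
      using linear_onD(3)[OF lin laurent_0, of 0] by (simp add: free_act_0)
  next
    fix w' d assume "w' \<in> keys b"
    then have "word_op w' F \<in> L" using b F by (auto simp: free_algebra_carrier intro: linear_onD(1)[OF linear_word_op])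
    then show "free_act m (single w c * single w' d) F = lconst c * word_op w (free_act m (single w' d) F) \<and> free_act m (single w' d) F \<in> L"
      by (simp add: free_act_lin_ext mult_single word_op_plus lconst_mult linear_onD[OF lin] mult.assoc)
  qed (simp add: free_act_add distrib_left linear_onD[OF lin])
  then show "free_act m (single w c * b) F = free_act m (single w c) (free_act m b F)"
    by (simp add: free_act_lin_ext[of "single w c"])
qed (simp_all add: free_act_0 free_act_add distrib_right)

lemma free_act_fT: "free_act m (fT m i) F = T i F"
  by (simp add: fT_def free_act_fgen T_def)

text \<open>An ideal containing the defining relations, hence containing
  \<open>hecke_ideal m\<close>; this inclusion is the well-definedness of the Hecke action.\<close>

definition annihilator :: "falg set" where
  "annihilator = {a \<in> carrier (free_algebra m). \<forall>F\<in>L. free_act m a F = 0}"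

lemma free_act_zero_vec: "a \<in> carrier (free_algebra m) \<Longrightarrow> free_act m a 0 = 0"
proof -
  assume a: "a \<in> carrier (free_algebra m)"
  have "free_act m a 0 = free_act m (a * 0) 0"
    using free_act_mult[OF a carrier_free_0 laurent_0] by (simp add: free_act_0)
  then show ?thesis by (simp add: free_act_0)
qed

lemma ideal_annihilator: "ideal annihilator (free_algebra m)"
proof (rule idealI[OF ring_free_algebra])
  interpret F: ring "free_algebra m" by (rule ring_free_algebra)
  have minv: "\<ominus>\<^bsub>free_algebra m\<^esub> x = - x" if "x \<in> carrier (free_algebra m)" for x
    using that by (intro F.minus_equality) (simp_all add: carrier_free)
  show "subgroup annihilator (add_monoid (free_algebra m))"
  proof (rule F.add.subgroupI)
    show "annihilator \<noteq> {}" by (auto simp: annihilator_def free_act_0 intro!: exI[of _ 0] carrier_free)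
  next
    fix a assume "a \<in> annihilator"
    then show "\<ominus>\<^bsub>free_algebra m\<^esub> a \<in> annihilator"
      by (simp add: annihilator_def minv carrier_free free_act_uminus)
  qed (auto simp: annihilator_def carrier_free free_act_add)
qed (auto simp: annihilator_def carrier_free free_act_mult free_act_zero_vec free_act_in)

lemma fT_carrier: "2 \<le> m \<Longrightarrow> fT m i \<in> carrier (free_algebra m)"
  unfolding fT_def by (intro carrier_free) (simp add: hgens_def T_index_def)

lemma gens_carrier: "fgen GPi \<in> carrier (free_algebra m)" "fgen GPiInv \<in> carrier (free_algebra m)"
  by (auto intro!: carrier_free simp: hgens_def)

lemma T_index_rank2: "i \<in> T_index m \<Longrightarrow> 2 \<le> m"
  using m_pos by (auto simp: T_index_def split: if_splits)

lemma hecke_relations_annihilator: "hecke_relations m \<subseteq> annihilator"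
proof -
  note act = free_act_add free_act_diff free_act_mult free_act_fconst free_act_1 free_act_fT free_act_fgen
  have quad: "(fT m i - fconst tt) * (fT m i + 1) \<in> annihilator" if "i \<in> T_index m" for i
  proof -
    interpret laurent_rep2 m using T_index_rank2[OF that] by unfold_locales
    show ?thesis
      by (auto simp: annihilator_def act carrier_free fT_carrier m2 T_add T_quadratic algebra_simps)
  qed
  have braid: "fT m i * fT m (i + 1) * fT m i - fT m (i + 1) * fT m i * fT m (i + 1) \<in> annihilator"
    if i: "i \<in> T_index m" and m3: "m > 2" for i
  proof -
    interpret laurent_rep2 m using T_index_rank2[OF i] by unfold_locales
    show ?thesis
      using T_braid[of _ i] m3 by (simp add: annihilator_def act carrier_free fT_carrier m2 mult.assoc)
  qed
  have comm: "fT m i * fT m j - fT m j * fT m i \<in> annihilator"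
    if "i \<in> T_index m" "j \<in> T_index m" "j \<noteq> (i + 1) mod int m" "j \<noteq> (i - 1) mod int m" for i j
  proof -
    interpret laurent_rep2 m using T_index_rank2[OF that(1)] by unfold_locales
    have ij: "0 \<le> i" "i < int m" "0 \<le> j" "j < int m"
      using that m2 by (auto simp: T_index_def split: if_splits)
    \<comment> \<open>Excluding both cyclic neighbours leaves distances from 2 to
      \<open>m - 2\<close>; the extreme pair \<open>0, m - 1\<close> is adjacent through the
      wrap-around.\<close>
    have **: "T k (T l F) = T l (T k F)"
      if kl: "0 \<le> k" "k < l" "l < int m" "l \<noteq> (k + 1) mod int m" "k \<noteq> (l + 1) mod int m" and F: "F \<in> L" for k l F
    proof (rule T_comm[OF _ _ F])
      have "(k + 1) mod int m = k + 1" using kl by (intro mod_pos_pos_trivial) auto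
      then show "2 \<le> l - k" using kl by linarith
      show "l - k \<le> int m - 2"
      proof (rule ccontr)
        assume "\<not> ?thesis"
        then have "k = 0" "l = int m - 1" using kl by linarith+
        then show False using kl by simp
      qed
    qed
    have j: "i \<noteq> (j + 1) mod int m"
    proof
      assume "i = (j + 1) mod int m"
      then have "(i - 1) mod int m = j mod int m" by (simp add: mod_diff_left_eq)
      then show False using that ij by simp
    qed
    have "(j + 1) mod int m \<noteq> i" using j by simp
    have "T i (T j F) = T j (T i F)" if "F \<in> L" for F
      using **[of i j F] **[of j i F] that \<open>j \<noteq> (i + 1) mod int m\<close> j ij
      by (cases i j rule: linorder_cases) auto
    then show ?thesis
      by (simp add: annihilator_def act carrier_free fT_carrier m2)
  qed
  have shift: "fgen GPi * fT m i - fT m (i + 1) * fgen GPi \<in> annihilator" if "i \<in> T_index m" for i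
  proof -
    interpret laurent_rep2 m using T_index_rank2[OF that] by unfold_locales
    show ?thesis
      by (simp add: annihilator_def act carrier_free fT_carrier gens_carrier m2 P_T)
  qed
  have inv: "fgen GPi * fgen GPiInv - 1 \<in> annihilator" "fgen GPiInv * fgen GPi - 1 \<in> annihilator"
    by (simp_all add: annihilator_def act carrier_free_diff carrier_free_mult carrier_free_1 gens_carrier Q_def[symmetric])
  show ?thesis
    unfolding hecke_relations_def using quad braid comm shift inv by blast
qed

lemma hecke_relations_carrier: "hecke_relations m \<subseteq> carrier (free_algebra m)"
  using hecke_relations_annihilator by (auto simp: annihilator_def)

lemma ideal_hecke_ideal: "ideal (hecke_ideal m) (free_algebra m)"
  unfolding hecke_ideal_def
  by (intro ring.genideal_ideal ring_free_algebra hecke_relations_carrier)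

lemma hecke_ideal_annihilator: "hecke_ideal m \<subseteq> annihilator"
  unfolding hecke_ideal_def
  by (intro ring.genideal_minimal ring_free_algebra ideal_annihilator hecke_relations_annihilator)

lemma ring_hecke: "ring (hecke m)"
  unfolding hecke_def by (rule ideal.quotient_is_ring[OF ideal_hecke_ideal])

sublocale H: ring "hecke m" by (rule ring_hecke)

lemma hclass_hom: "ring_hom_ring (free_algebra m) (hecke m) (hclass m)"
  unfolding hecke_def hclass_def[abs_def] by (rule ideal.rcos_ring_hom_ring[OF ideal_hecke_ideal])

lemma hclass_carrier [simp]: "a \<in> carrier (free_algebra m) \<Longrightarrow> hclass m a \<in> carrier (hecke m)"
  and hclass_mult: "a \<in> carrier (free_algebra m) \<Longrightarrow> b \<in> carrier (free_algebra m) \<Longrightarrow> hclass m a \<otimes>\<^bsub>hecke m\<^esub> hclass m b = hclass m (a * b)"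
  and hclass_add: "a \<in> carrier (free_algebra m) \<Longrightarrow> b \<in> carrier (free_algebra m) \<Longrightarrow> hclass m a \<oplus>\<^bsub>hecke m\<^esub> hclass m b = hclass m (a + b)"
  and hclass_1: "hclass m 1 = \<one>\<^bsub>hecke m\<^esub>" and hclass_0: "hclass m 0 = \<zero>\<^bsub>hecke m\<^esub>"
proof -
  interpret h: ring_hom_ring "free_algebra m" "hecke m" "hclass m" by (rule hclass_hom)
  show "a \<in> carrier (free_algebra m) \<Longrightarrow> hclass m a \<in> carrier (hecke m)"
    and "a \<in> carrier (free_algebra m) \<Longrightarrow> b \<in> carrier (free_algebra m) \<Longrightarrow> hclass m a \<otimes>\<^bsub>hecke m\<^esub> hclass m b = hclass m (a * b)"
    and "a \<in> carrier (free_algebra m) \<Longrightarrow> b \<in> carrier (free_algebra m) \<Longrightarrow> hclass m a \<oplus>\<^bsub>hecke m\<^esub> hclass m b = hclass m (a + b)"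
    using h.hom_mult[of a b] h.hom_add[of a b] by simp_all
  show "hclass m 1 = \<one>\<^bsub>hecke m\<^esub>" "hclass m 0 = \<zero>\<^bsub>hecke m\<^esub>"
    using h.hom_one h.hom_zero by simp_all
qed

lemma hecke_cases:
  assumes "h \<in> carrier (hecke m)"
  obtains a where "a \<in> carrier (free_algebra m)" "h = hclass m a"
  using assms unfolding hecke_def FactRing_def A_RCOSETS_defs RCOSETS_def hclass_def a_r_coset_def by auto

lemma hclass_eqI:
  assumes "a \<in> carrier (free_algebra m)" "b \<in> carrier (free_algebra m)" "a - b \<in> hecke_ideal m"
  shows "hclass m a = hclass m b"
proof -
  interpret ideal "hecke_ideal m" "free_algebra m" by (rule ideal_hecke_ideal)
  have "a \<in> hecke_ideal m +>\<^bsub>free_algebra m\<^esub> b"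
    unfolding a_r_coset_def' using assms(3) by (auto intro!: bexI[of _ "a - b"])
  then show ?thesis
    unfolding hclass_def by (rule a_repr_independence[symmetric, OF _ assms(2) a_subgroup])
qed

text \<open>Representatives differ by elements of the annihilator, so the image under
  \<open>the_elem\<close> is a singleton; it is nonempty because \<open>a\<close> lies in its own
  coset.\<close>

lemma hecke_act_hclass:
  assumes a: "a \<in> carrier (free_algebra m)" and F: "F \<in> L"
  shows "hecke_act m (hclass m a) F = free_act m a F"
proof -
  have "free_act m b F = free_act m a F" if "b \<in> hclass m a" for b
    using that hecke_ideal_annihilator F
    by (auto simp: hclass_def a_r_coset_def' free_act_add annihilator_def)
  moreover have "a \<in> hclass m a"
    using ideal.Icarr ideal_hecke_ideal additive_subgroup.zero_closed[OF ideal.axioms(1)[OF ideal_hecke_ideal]]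
    by (auto simp: hclass_def a_r_coset_def' intro!: bexI[of _ 0])
  ultimately have "(\<lambda>b. free_act m b F) ` hclass m a = {free_act m a F}" by blast
  then show ?thesis by (simp add: hecke_act_def)
qed

abbreviation "act \<equiv> hecke_act m"

lemma act_in:
  assumes "h \<in> carrier (hecke m)" "F \<in> L" shows "act h F \<in> L"
  using assms by (elim hecke_cases) (simp add: hecke_act_hclass free_act_in)

lemma act_mult:
  assumes "h \<in> carrier (hecke m)" "h' \<in> carrier (hecke m)" "F \<in> L"
  shows "act (h \<otimes>\<^bsub>hecke m\<^esub> h') F = act h (act h' F)"
  using assms
  by (elim hecke_cases)
     (simp add: hclass_mult hecke_act_hclass free_act_mult free_act_in carrier_free_mult)

lemma act_add:
  assumes "h \<in> carrier (hecke m)" "h' \<in> carrier (hecke m)" "F \<in> L"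
  shows "act (h \<oplus>\<^bsub>hecke m\<^esub> h') F = act h F + act h' F"
  using assms
  by (elim hecke_cases) (simp add: hclass_add hecke_act_hclass free_act_add carrier_free_add)

lemma act_one: "F \<in> L \<Longrightarrow> act \<one>\<^bsub>hecke m\<^esub> F = F"
  and act_zero: "F \<in> L \<Longrightarrow> act \<zero>\<^bsub>hecke m\<^esub> F = 0"
  by (simp_all add: hclass_1[symmetric] hclass_0[symmetric] hecke_act_hclass carrier_free free_act_1 free_act_0)

lemma act_uminus:
  assumes h: "h \<in> carrier (hecke m)" and F: "F \<in> L" shows "act (\<ominus>\<^bsub>hecke m\<^esub> h) F = - act h F"
proof -
  have "act (h \<oplus>\<^bsub>hecke m\<^esub> \<ominus>\<^bsub>hecke m\<^esub> h) F = 0"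
    using h F by (simp add: H.r_neg act_zero)
  then show ?thesis using h F by (simp add: act_add add_eq_0_iff)
qed

section \<open>Elements of the Hecke algebra and the operators by which they act\<close>

lemma hconst_carrier [simp]: "hconst m c \<in> carrier (hecke m)"
  by (simp add: hconst_def carrier_free)

lemma act_hconst: "F \<in> L \<Longrightarrow> act (hconst m c) F = lconst c * F"
  by (simp add: hconst_def hecke_act_hclass carrier_free free_act_fconst)

lemma hPi_carrier [simp]: "hPi m \<in> carrier (hecke m)"
  by (simp add: hPi_def gens_carrier)

lemma act_hPi: "F \<in> L \<Longrightarrow> act (hPi m) F = P F"
  by (simp add: hPi_def hecke_act_hclass gens_carrier free_act_fgen)

lemma act_hT: "2 \<le> m \<Longrightarrow> F \<in> L \<Longrightarrow> act (hT m i) F = T i F"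
  by (simp add: hT_def hecke_act_hclass fT_carrier free_act_fT)

lemma UnitsI:
  "h \<in> carrier (hecke m) \<Longrightarrow> h' \<in> carrier (hecke m) \<Longrightarrow> h \<otimes>\<^bsub>hecke m\<^esub> h' = \<one>\<^bsub>hecke m\<^esub> \<Longrightarrow>
   h' \<otimes>\<^bsub>hecke m\<^esub> h = \<one>\<^bsub>hecke m\<^esub> \<Longrightarrow> h \<in> Units (hecke m)"
  by (auto simp: Units_def)

lemma hecke_relations_ideal: "x \<in> hecke_relations m \<Longrightarrow> x \<in> hecke_ideal m"
  unfolding hecke_ideal_def using ring.genideal_self[OF ring_free_algebra hecke_relations_carrier] by blast

lemma hconst_Units: "c \<noteq> 0 \<Longrightarrow> hconst m c \<in> Units (hecke m)"
  by (rule UnitsI[where h' = "hconst m (inverse c)"])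
     (simp_all add: hconst_def carrier_free hclass_mult fconst_mult fconst_1 hclass_1)

lemma hPi_Units: "hPi m \<in> Units (hecke m)"
  unfolding hPi_def
proof (rule UnitsI)
  show "hclass m (fgen GPi) \<otimes>\<^bsub>hecke m\<^esub> hclass m (fgen GPiInv) = \<one>\<^bsub>hecke m\<^esub>"
    "hclass m (fgen GPiInv) \<otimes>\<^bsub>hecke m\<^esub> hclass m (fgen GPi) = \<one>\<^bsub>hecke m\<^esub>"
    unfolding hclass_1[symmetric] hclass_mult[OF gens_carrier] hclass_mult[OF gens_carrier(2,1)]
    by (rule hclass_eqI; simp add: carrier_free_mult carrier_free_1 gens_carrier hecke_relations_ideal hecke_relations_def)+
qed (simp_all add: gens_carrier)

lemma hT_Units:
  assumes m2: "2 \<le> m" shows "hT m i \<in> Units (hecke m)"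
proof -
  define x where "x = fT m i"
  \<comment> \<open>From \<open>(x - t)(x + 1) = x (x + 1 - t) - t\<close>, this is a two-sided
    inverse of \<open>x\<close> modulo the quadratic relation.\<close>
  define y where "y = fconst (inverse tt) * (x + fconst (1 - tt))"
  interpret ideal "hecke_ideal m" "free_algebra m" by (rule ideal_hecke_ideal)
  have x: "x \<in> carrier (free_algebra m)" unfolding x_def by (rule fT_carrier[OF m2])
  have y: "y \<in> carrier (free_algebra m)" unfolding y_def by (intro carrier_free x)
  have it: "fconst (inverse tt) * fconst tt = 1" by (simp add: fconst_mult fconst_1)
  have "i mod int m \<in> T_index m" using m2 by (simp add: T_index_def)
  then have "(x - fconst tt) * (x + 1) \<in> hecke_ideal m"
    using mod_mod_trivial[of i "int m"]
    by (intro hecke_relations_ideal) (force simp: hecke_relations_def x_def fT_def)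
  then have rel: "fconst (inverse tt) * ((x - fconst tt) * (x + 1)) \<in> hecke_ideal m"
    using I_l_closed[of "(x - fconst tt) * (x + 1)" "fconst (inverse tt)"] by (simp add: carrier_free)
  have z: "x + fconst (1 - tt) = x + 1 - fconst tt" by (simp add: fconst_diff fconst_1)
  have e1: "(x - fconst tt) * (x + 1) = x * (x + 1 - fconst tt) - fconst tt"
    and e2: "(x - fconst tt) * (x + 1) = (x + 1 - fconst tt) * x - fconst tt"
    using fconst_central[of tt x] by (simp_all add: algebra_simps)
  have p1: "fconst (inverse tt) * ((x - fconst tt) * (x + 1)) = fconst (inverse tt) * (x * (x + 1 - fconst tt)) - 1"
    unfolding e1 right_diff_distrib[of "fconst (inverse tt)" _ "fconst tt"] it ..
  have p2: "fconst (inverse tt) * ((x - fconst tt) * (x + 1)) = fconst (inverse tt) * ((x + 1 - fconst tt) * x) - 1"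
    unfolding e2 right_diff_distrib[of "fconst (inverse tt)" _ "fconst tt"] it ..
  have "x * y - 1 = fconst (inverse tt) * ((x - fconst tt) * (x + 1))"
    unfolding y_def z p1 by (simp only: mult.assoc[symmetric] fconst_central[of "inverse tt" x])
  moreover have "y * x - 1 = fconst (inverse tt) * ((x - fconst tt) * (x + 1))"
    unfolding y_def z p2 by (simp only: mult.assoc)
  ultimately show ?thesis
    unfolding hT_def x_def[symmetric] using x y rel
    by (intro UnitsI[where h' = "hclass m y"]) (simp_all add: hclass_mult hclass_1[symmetric] hclass_eqI carrier_free)
qed

lemma act_inv:
  assumes "h \<in> Units (hecke m)" "F \<in> L"
  shows "act h (act (inv\<^bsub>hecke m\<^esub> h) F) = F"
proof -
  have "act h (act (inv\<^bsub>hecke m\<^esub> h) F) = act (h \<otimes>\<^bsub>hecke m\<^esub> inv\<^bsub>hecke m\<^esub> h) F"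
    by (rule act_mult[symmetric, OF H.Units_closed[OF assms(1)] H.Units_inv_closed[OF assms(1)] assms(2)])
  also have "\<dots> = F"
    using assms by (simp add: H.Units_r_inv act_one)
  finally show ?thesis .
qed

lemma hTinv_carrier: "2 \<le> m \<Longrightarrow> hTinv m i \<in> carrier (hecke m)"
  by (simp add: hTinv_def hT_Units)

text \<open>The abstract inverse acts as a right inverse of \<open>T i\<close>, and
  \<open>R i\<close> undoes \<open>T i\<close> on \<open>L\<close>; no formula for the inverse
  element enters.\<close>

lemma act_hTinv:
  assumes m2: "2 \<le> m" and F: "F \<in> L" shows "act (hTinv m i) F = R i F"
proof -
  interpret laurent_rep2 m using m2 by unfold_locales
  have inL: "act (hTinv m i) F \<in> L" by (rule act_in[OF hTinv_carrier[OF m2] F])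
  have "T i (act (hTinv m i) F) = F"
    using act_inv[OF hT_Units[OF m2] F, of i] inL by (simp add: act_hT m2 hTinv_def)
  then show ?thesis using R_T[OF inL, of i] by simp
qed

lemma mult_list_closed:
  assumes "\<And>x. x \<in> set xs \<Longrightarrow> x \<in> carrier (hecke m)"
  shows "mult_list (hecke m) xs \<in> carrier (hecke m)"
  using assms by (induction xs) (simp_all add: mult_list_def)

lemma mult_list_Units:
  assumes "\<And>x. x \<in> set xs \<Longrightarrow> x \<in> Units (hecke m)"
  shows "mult_list (hecke m) xs \<in> Units (hecke m)"
  using assms by (induction xs) (simp_all add: mult_list_def)

lemma act_mult_list:
  assumes "\<And>x. x \<in> set xs \<Longrightarrow> x \<in> carrier (hecke m)" "F \<in> L"
  shows "act (mult_list (hecke m) xs) F = foldr act xs F"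
  using assms
proof (induction xs)
  case (Cons x xs)
  have "mult_list (hecke m) (x # xs) = x \<otimes>\<^bsub>hecke m\<^esub> mult_list (hecke m) xs"
    by (simp add: mult_list_def)
  with Cons mult_list_closed[of xs] show ?case by (simp add: act_mult)
qed (simp add: mult_list_def act_one)

lemma foldr_act:
  assumes "\<And>x G. x \<in> set xs \<Longrightarrow> G \<in> V \<Longrightarrow> act (f x) G = g x G \<and> g x G \<in> V" "F \<in> V"
  shows "foldr act (map f xs) F = foldr g xs F \<and> foldr g xs F \<in> V"
  using assms by (induction xs) simp_all

lemma act_hY:
  assumes i: "1 \<le> i" "i \<le> int m" and F: "F \<in> L"
  shows "hY m i \<in> Units (hecke m)" "act (hY m i) F = Y i F"
proof -
  let ?xs = "map (hT m) (rev [1..i - 1]) @ [hPi m] @ map (hTinv m) (rev [i..int m - 1])"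
  have units: "x \<in> Units (hecke m)" if "x \<in> set ?xs" for x
    using that i by (auto simp: hTinv_def intro!: hT_Units hPi_Units H.Units_inv_Units)
  show "hY m i \<in> Units (hecke m)"
    unfolding hY_def by (intro H.Units_m_closed hconst_Units mult_list_Units units) simp_all
  have carr: "x \<in> carrier (hecke m)" if "x \<in> set ?xs" for x
    using units[OF that] by (rule H.Units_closed)
  have r: "foldr act (map (hTinv m) (rev [i..int m - 1])) F = foldr R (rev [i..int m - 1]) F \<and> foldr R (rev [i..int m - 1]) F \<in> L"
    using F i by (intro foldr_act) (auto simp: act_hTinv R_in)
  have l: "foldr act (map (hT m) (rev [1..i - 1])) G = foldr T (rev [1..i - 1]) G \<and> foldr T (rev [1..i - 1]) G \<in> L" if "G \<in> L" for G
    using that i by (intro foldr_act) (auto simp: act_hT T_in)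
  let ?G = "foldr T (rev [1..i - 1]) (P (foldr R (rev [i..int m - 1]) F))"
  have G: "foldr act ?xs F = ?G" "?G \<in> L"
    using r l by (simp_all add: act_hPi)
  have ml: "mult_list (hecke m) ?xs \<in> carrier (hecke m)" by (rule mult_list_closed[OF carr])
  have "act (mult_list (hecke m) ?xs) F = ?G"
    using act_mult_list[OF carr F] by (simp only: G(1))
  then show "act (hY m i) F = Y i F"
    unfolding hY_def Y_def act_mult[OF hconst_carrier ml F] using G(2) by (simp only: act_hconst)
qed

lemma act_hY_inv:
  assumes i: "1 \<le> i" "i \<le> int m" and F: "F \<in> L"
  shows "act (inv\<^bsub>hecke m\<^esub> (hY m i)) F = Z i F"
proof -
  have inL: "act (inv\<^bsub>hecke m\<^esub> (hY m i)) F \<in> L"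
    using act_hY(1)[OF i F] F by (intro act_in) auto
  have "Y i (act (inv\<^bsub>hecke m\<^esub> (hY m i)) F) = F"
    using act_inv[OF act_hY(1)[OF i F] F] act_hY(2)[OF i inL] by simp
  then show ?thesis using ZY[OF i inL] by simp
qed

section \<open>The Y-subalgebra and the quantum product\<close>

lemma Y_generators_carrier:
  "range (hconst m) \<union> hY m ` {1..int m} \<union> (\<lambda>i. inv\<^bsub>hecke m\<^esub> (hY m i)) ` {1..int m} \<subseteq> carrier (hecke m)"
  using act_hY(1)[OF _ _ laurent_0] by (auto intro: H.Units_closed)

lemma Y_subalgebra_carrier: "y \<in> Y_subalgebra m \<Longrightarrow> y \<in> carrier (hecke m)"
  unfolding Y_subalgebra_def by (rule H.generate_ring_in_carrier[OF Y_generators_carrier])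

context
  fixes v assumes v: "v \<in> L"
begin

lemma cyclic_pairs_Y_subalgebra:
  assumes "y \<in> Y_subalgebra m" "(F, G) \<in> cyclic_pairs v"
  shows "(act y F, act y G) \<in> cyclic_pairs v"
  using assms unfolding Y_subalgebra_def
proof (induction arbitrary: F G rule: generate_ring.induct)
  case one
  then show ?case using cyclic_pairs_in[OF v one.prems] by (simp add: act_one)
next
  case (incl h)
  have "F \<in> L" "G \<in> L" using cyclic_pairs_in[OF v incl.prems] by auto
  then show ?case using incl
    by (auto simp: act_hconst act_hY act_hY_inv intro: cyclic_pairs.intros)
next
  case (a_inv h)
  have inL: "F \<in> L" "G \<in> L" using cyclic_pairs_in[OF v a_inv.prems] by auto
  have "h \<in> carrier (hecke m)" using a_inv.hyps Y_subalgebra_carrier by (simp add: Y_subalgebra_def)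
  then show ?case
    using cyclic_pairs.scale[OF a_inv.IH[OF a_inv.prems], of "- 1"] inL
    by (simp add: act_uminus lconst_uminus)
next
  case (eng_add h h')
  have inL: "F \<in> L" "G \<in> L" using cyclic_pairs_in[OF v eng_add.prems] by auto
  have "h \<in> carrier (hecke m)" "h' \<in> carrier (hecke m)"
    using eng_add.hyps Y_subalgebra_carrier by (simp_all add: Y_subalgebra_def)
  then show ?case using eng_add inL by (simp add: act_add cyclic_pairs.add)
next
  case (eng_mult h h')
  have inL: "F \<in> L" "G \<in> L" using cyclic_pairs_in[OF v eng_mult.prems] by auto
  have "h \<in> carrier (hecke m)" "h' \<in> carrier (hecke m)"
    using eng_mult.hyps Y_subalgebra_carrier by (simp_all add: Y_subalgebra_def)
  then show ?case using eng_mult inL by (simp add: act_mult)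
qed

text \<open>Converse to \<open>cyclic_pairs_Y_subalgebra\<close>. Its first coordinate shows that
  every \<open>h \<bullet> 1\<close> is a value of \<open>q_map\<close> on the Y-subalgebra, so that
  \<open>q_inv\<close> returns a true preimage.\<close>

lemma cyclic_pairs_witness:
  assumes "(F, G) \<in> cyclic_pairs v"
  shows "\<exists>y\<in>Y_subalgebra m. F = act y 1 \<and> G = act y v"
  using assms
proof (induction rule: cyclic_pairs.induct)
  case base
  show ?case unfolding Y_subalgebra_def
    by (rule bexI[OF _ generate_ring.one]) (simp add: act_one v)
next
  case (add F G F' G')
  then obtain y y' where y: "y \<in> Y_subalgebra m" "y' \<in> Y_subalgebra m"
    "F = act y 1" "G = act y v" "F' = act y' 1" "G' = act y' v" by blast
  then have "y \<oplus>\<^bsub>hecke m\<^esub> y' \<in> Y_subalgebra m"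
    unfolding Y_subalgebra_def by (intro generate_ring.eng_add)
  with y show ?case
    by (intro bexI[of _ "y \<oplus>\<^bsub>hecke m\<^esub> y'"]) (simp_all add: act_add v Y_subalgebra_carrier)
next
  case (scale F G c)
  then obtain y where y: "y \<in> Y_subalgebra m" "F = act y 1" "G = act y v" by blast
  then have "hconst m c \<otimes>\<^bsub>hecke m\<^esub> y \<in> Y_subalgebra m"
    unfolding Y_subalgebra_def by (intro generate_ring.eng_mult) (auto intro: generate_ring.incl)
  with y show ?case
    by (intro bexI[of _ "hconst m c \<otimes>\<^bsub>hecke m\<^esub> y"])
       (simp_all add: act_mult v Y_subalgebra_carrier act_hconst act_in)
next
  case (Y F G i)
  then obtain y where y: "y \<in> Y_subalgebra m" "F = act y 1" "G = act y v" by blast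
  then have "hY m i \<otimes>\<^bsub>hecke m\<^esub> y \<in> Y_subalgebra m"
    using Y.hyps unfolding Y_subalgebra_def by (intro generate_ring.eng_mult) (auto intro: generate_ring.incl)
  moreover have "hY m i \<in> carrier (hecke m)"
    using act_hY(1)[of i 0] Y.hyps by (simp add: H.Units_closed)
  ultimately show ?case using y Y.hyps
    by (intro bexI[of _ "hY m i \<otimes>\<^bsub>hecke m\<^esub> y"])
       (simp_all add: act_mult v Y_subalgebra_carrier act_hY(2) act_in)
next
  case (Z F G i)
  then obtain y where y: "y \<in> Y_subalgebra m" "F = act y 1" "G = act y v" by blast
  then have "inv\<^bsub>hecke m\<^esub> hY m i \<otimes>\<^bsub>hecke m\<^esub> y \<in> Y_subalgebra m"
    using Z.hyps unfolding Y_subalgebra_def by (intro generate_ring.eng_mult) (auto intro: generate_ring.incl)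
  moreover have "inv\<^bsub>hecke m\<^esub> hY m i \<in> carrier (hecke m)"
    using act_hY(1)[of i 0] Z.hyps by simp
  ultimately show ?case using y Z.hyps
    by (intro bexI[of _ "inv\<^bsub>hecke m\<^esub> hY m i \<otimes>\<^bsub>hecke m\<^esub> y"])
       (simp_all add: act_mult v Y_subalgebra_carrier act_hY_inv act_in)
qed

text \<open>A representative of \<open>h\<close> is a linear combination of words, and a word is
  applied one generator at a time by \<open>cyclic_pairs_gen_op\<close>.\<close>

lemma cyclic_pairs_hecke:
  assumes symmetric: "\<And>i. 1 \<le> i \<Longrightarrow> i < int m \<Longrightarrow> T i v = t * v" and h: "h \<in> carrier (hecke m)"
  shows "(act h 1, act h v) \<in> cyclic_pairs v"
proof -
  obtain a where a: "a \<in> carrier (free_algebra m)" "h = hclass m a"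
    using h by (rule hecke_cases)
  have word: "(word_op w 1, word_op w v) \<in> cyclic_pairs v" if "w \<in> keys a" for w
  proof -
    have "(foldr (gen_op m) gs 1, foldr (gen_op m) gs v) \<in> cyclic_pairs v" if "set gs \<subseteq> hgens m" for gs
      using that by (induction gs) (simp_all add: cyclic_pairs.base cyclic_pairs_gen_op[OF v symmetric])
    then show ?thesis using a that by (simp add: word_op_def free_algebra_carrier)
  qed
  have "(lin_ext (\<lambda>w. word_op w 1) a, lin_ext (\<lambda>w. word_op w v) a) \<in> cyclic_pairs v"
    by (rule keys_induct[of _ a])
       (use cyclic_pairs.scale[OF cyclic_pairs.base, of 0] in
         \<open>simp_all add: lin_ext_add cyclic_pairs.add cyclic_pairs.scale word\<close>)
  then show ?thesis using a v by (simp add: hecke_act_hclass free_act_lin_ext)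
qed

end

text \<open>The chosen preimage \<open>y\<close> of \<open>h \<bullet> 1\<close> and
  \<open>h\<close> itself give pairs with the same first coordinate, so functionality forces
  \<open>y \<bullet> v = h \<bullet> v\<close>. The preimage of \<open>v\<close> enters only through
  its value at \<open>1\<close>.\<close>

theorem quantum_mult_symmetric:
  assumes h: "h \<in> carrier (hecke m)" "h' \<in> carrier (hecke m)"
    and symmetric: "\<And>i. 1 \<le> i \<Longrightarrow> i < int m \<Longrightarrow> T i (act h' 1) = t * act h' 1"
  shows "quantum_mult m (act h 1) (act h' 1) = act h (act h' 1)"
proof -
  define v where "v = act h' 1"
  have v: "v \<in> L" unfolding v_def by (rule act_in[OF h(2) laurent_1])
  have sym: "T i v = t * v" if "1 \<le> i" "i < int m" for i
    using symmetric[OF that] by (simp add: v_def)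
  have inv: "q_inv m (act x 1) \<in> Y_subalgebra m" "act (q_inv m (act x 1)) 1 = act x 1"
    if x: "x \<in> carrier (hecke m)" for x
  proof -
    obtain y where "y \<in> Y_subalgebra m" "act x 1 = act y 1"
      using cyclic_pairs_witness[OF v cyclic_pairs_hecke[OF v sym x]] by blast
    then have "act x 1 \<in> q_map m ` Y_subalgebra m" by (auto simp: q_map_def)
    then show "q_inv m (act x 1) \<in> Y_subalgebra m" "act (q_inv m (act x 1)) 1 = act x 1"
      unfolding q_inv_def q_map_def[symmetric] by (rule inv_into_into, rule f_inv_into_f)
  qed
  define y where "y = q_inv m (act h 1)"
  have y: "y \<in> Y_subalgebra m" "act y 1 = act h 1"
    using inv[OF h(1)] by (simp_all add: y_def)
  have "quantum_mult m (act h 1) (act h' 1) = act y v"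
    unfolding quantum_mult_def q_map_def y_def[symmetric]
    using inv[OF h(2)] y(1) by (simp add: act_mult Y_subalgebra_carrier v_def)
  also have "\<dots> = act h v"
  proof (rule cyclic_pairs_functional[OF v])
    show "(act h 1, act y v) \<in> cyclic_pairs v"
      using cyclic_pairs_Y_subalgebra[OF v y(1) cyclic_pairs.base] by (simp add: y(2))
    show "(act h 1, act h v) \<in> cyclic_pairs v"
      by (rule cyclic_pairs_hecke[OF v sym h(1)])
  qed
  finally show ?thesis by (simp add: v_def)
qed

section \<open>Truncated chromatic symmetric functions\<close>

definition S :: "int \<Rightarrow> int \<Rightarrow> lpoly \<Rightarrow> lpoly" where
  "S i e F = (if e \<ge> i - int m then \<Sum>k\<in>{0..int m + e - i}. foldr R (rev [i..i + k - 1]) F else 0)"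

text \<open>For \<open>m = 1\<close> the bound gives \<open>k \<le> 0\<close>, so the words in
  \<open>S i e\<close> are empty and no \<open>T\<close> occurs, as it must be when there are no
  generators \<open>GT\<close>.\<close>

lemma R_list_cases:
  assumes "e < i" "k \<le> int m + e - i"
  shows "[i..i + k - 1] = [] \<or> 2 \<le> m"
  using assms by (cases "m = 1") (use m_pos in auto)

lemma linear_foldr_R: "xs = [] \<or> 2 \<le> m \<Longrightarrow> linear_on L (foldr R xs)"
proof (cases "xs = []")
  case False
  assume "xs = [] \<or> 2 \<le> m"
  then interpret laurent_rep2 m using False by unfold_locales simp
  show ?thesis by (intro linear_on_foldr) (simp add: linear_on_def R_add R_lconst)
qed (simp add: linear_on_def)

lemma linear_on_sum:
  "(\<And>k. k \<in> K \<Longrightarrow> linear_on L (f k)) \<Longrightarrow> linear_on L (\<lambda>F. \<Sum>k\<in>K. f k F)"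
  by (induction K rule: infinite_finite_induct) (auto simp: linear_on_def distrib_left add_ac)

lemma linear_S: "e < i \<Longrightarrow> linear_on L (S i e)"
proof -
  assume e: "e < i"
  have "linear_on L (\<lambda>F. \<Sum>k\<in>{0..int m + e - i}. foldr R (rev [i..i + k - 1]) F)"
  proof (intro linear_on_sum linear_foldr_R)
    fix k assume "k \<in> {0..int m + e - i}"
    then show "rev [i..i + k - 1] = [] \<or> 2 \<le> m" using R_list_cases[OF e, of k] by simp
  qed
  then show ?thesis by (auto simp: S_def[abs_def] linear_on_def)
qed

lemma act_hS:
  assumes e: "e < i" and F: "F \<in> L"
  shows "hS m i e \<in> carrier (hecke m)" "act (hS m i e) F = S i e F"
proof -
  let ?f = "\<lambda>k. mult_list (hecke m) (map (hTinv m) (rev [i..i + k - 1]))"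
  have m2: "2 \<le> m" if "k \<in> {0..int m + e - i}" "x \<in> set [i..i + k - 1]" for k x
    using R_list_cases[OF e, of k] that by auto
  have f: "?f k \<in> carrier (hecke m)" if "k \<in> {0..int m + e - i}" for k
    using m2[OF that] by (intro mult_list_closed) (auto intro: hTinv_carrier)
  have act_f: "act (?f k) F = foldr R (rev [i..i + k - 1]) F" if k: "k \<in> {0..int m + e - i}" for k
  proof -
    have "act (?f k) F = foldr act (map (hTinv m) (rev [i..i + k - 1])) F"
      using m2[OF k] F by (intro act_mult_list) (auto intro: hTinv_carrier)
    moreover have "G \<in> L \<Longrightarrow> R x G \<in> L" if "2 \<le> m" for x G
      using laurent_rep2.R_laurent[of m G x] that by (simp add: laurent_rep2_def laurent_rep2_axioms_def laurent_rep_axioms)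
    moreover from this have "foldr act (map (hTinv m) (rev [i..i + k - 1])) F = foldr R (rev [i..i + k - 1]) F \<and>
        foldr R (rev [i..i + k - 1]) F \<in> L"
      using m2[OF k] F by (intro foldr_act) (auto simp: act_hTinv)
    ultimately show ?thesis by simp
  qed
  show "hS m i e \<in> carrier (hecke m)"
    unfolding hS_def using f by (auto intro!: H.finsum_closed)
  have "act (\<Oplus>\<^bsub>hecke m\<^esub>k\<in>K. ?f k) F = (\<Sum>k\<in>K. act (?f k) F)"
    if "finite K" "K \<subseteq> {0..int m + e - i}" for K
    using that
  proof (induction K)
    case (insert k K)
    have fK: "?f \<in> K \<rightarrow> carrier (hecke m)" using f insert.prems by auto
    then have "act (\<Oplus>\<^bsub>hecke m\<^esub>k\<in>insert k K. ?f k) F = act (?f k) F + act (\<Oplus>\<^bsub>hecke m\<^esub>k\<in>K. ?f k) F"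
      using insert f F by (simp add: H.finsum_insert act_add H.finsum_closed)
    then show ?case using insert by simp
  qed (simp add: act_zero F)
  from this[of "{0..int m + e - i}"] show "act (hS m i e) F = S i e F"
    using F by (simp add: hS_def S_def act_zero act_f)
qed

lemma P_foldr_R: "xs = [] \<or> 2 \<le> m \<Longrightarrow> F \<in> L \<Longrightarrow> P (foldr R xs F) = foldr R (map (\<lambda>j. j + 1) xs) (P F)"
proof (cases "xs = []")
  case False
  assume "xs = [] \<or> 2 \<le> m" and F: "F \<in> L"
  then interpret laurent_rep2 m using False by unfold_locales simp
  have "P (foldr R xs F) = foldr R (map (\<lambda>j. j + 1) xs) (P F) \<and> foldr R xs F \<in> L"
    by (induction xs) (simp_all add: P_R F)
  then show ?thesis ..
qed simp

lemma P_S: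
  assumes e: "e < i" and F: "F \<in> L" shows "P (S i e F) = S (i + 1) (e + 1) (P F)"
proof -
  have P0: "P 0 = 0" using P_lconst[of 0 0] by simp
  have sum: "P (\<Sum>k\<in>K. f k) = (\<Sum>k\<in>K. P (f k))" for f :: "int \<Rightarrow> lpoly" and K
    by (induction K rule: infinite_finite_induct) (simp_all add: P_add P0)
  have fold: "P (foldr R (rev [i..i + k - 1]) F) = foldr R (rev [i + 1..i + 1 + k - 1]) (P F)"
    if "k \<in> {0..int m + e - i}" for k
    using P_foldr_R[of "rev [i..i + k - 1]" F] R_list_cases[OF e, of k] that F
    by (simp add: rev_map[symmetric] map_plus_upto add_ac)
  show ?thesis
  proof (cases "i - int m \<le> e")
    case True
    then have "P (S i e F) = (\<Sum>k\<in>{0..int m + e - i}. P (foldr R (rev [i..i + k - 1]) F))"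
      by (simp add: S_def sum)
    also have "\<dots> = (\<Sum>k\<in>{0..int m + (e + 1) - (i + 1)}. foldr R (rev [i + 1..i + 1 + k - 1]) (P F))"
    proof (rule sum.cong)
      fix k assume "k \<in> {0..int m + (e + 1) - (i + 1)}"
      then have "k \<in> {0..int m + e - i}" by simp
      then show "P (foldr R (rev [i..i + k - 1]) F) = foldr R (rev [i + 1..i + 1 + k - 1]) (P F)"
        by (rule fold)
    qed simp
    also have "\<dots> = S (i + 1) (e + 1) (P F)"
      using True by (simp add: S_def)
    finally show ?thesis .
  qed (simp add: S_def P0)
qed

text \<open>
  \<open>T j\<close> multiplies every summand of \<open>S i e F\<close> by \<open>t\<close>, except for the adjacent summands \<open>j - i\<close> and
  \<open>j - i + 1\<close>, whose sum is an eigenvector by the quadratic relation.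
\<close>

lemma S_invariant:
  assumes e: "e < i" and F: "F \<in> L"
    and inv: "\<And>j. i < j \<Longrightarrow> j < int m + e \<Longrightarrow> T j F = t * F"
    and j: "i \<le> j" "j < int m + e"
  shows "T j (S i e F) = t * S i e F"
proof -
  have "2 \<le> m" using e j by linarith
  then interpret laurent_rep2 m by unfold_locales
  define K where "K = int m + e - i"
  define k0 where "k0 = j - i"
  define w where "w k = foldr R (rev [i..i + k - 1]) F" for k
  \<comment> \<open>\<open>K \<le> m - 1\<close> comes from \<open>e < i\<close>; it keeps the
    indices of each word from wrapping around, so the distances in \<open>T_fold\<close> stay at
    most \<open>m - 2\<close>.\<close>
  have K: "0 \<le> k0" "k0 < K" "K \<le> int m - 1" using e j by (auto simp: K_def k0_def)
  have RL: "foldr R xs G \<in> L" if "G \<in> L" for xs G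
    using that by (induction xs) simp_all
  have R_lin: "foldr R xs (t * G) = t * foldr R xs G" if "G \<in> L" for xs G
    using linear_onD(3)[OF linear_foldr_R[of xs] that] m2 by simp
  have w: "w k \<in> L" for k unfolding w_def by (rule RL[OF F])
  have w_Suc: "w (k0 + 1) = R j (w k0)"
    using K by (simp add: w_def k0_def upto_rec2[of i j])
  have pair: "T j (w k0) + T j (w (k0 + 1)) = t * (w k0 + w (k0 + 1))"
  proof -
    have e: "T j (w (k0 + 1)) = w k0" by (simp add: w_Suc T_R w)
    have "T j (w k0) = (t - 1) * T j (w (k0 + 1)) + t * w (k0 + 1)"
      using T_quadratic[OF w, of j "k0 + 1"] by (simp only: e)
    then show ?thesis by (simp only: e) (simp add: left_diff_distrib distrib_left)
  qed
  have T_fold: "T l (foldr R xs G) = foldr R xs (T l G)"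
    if "\<And>x. x \<in> set xs \<Longrightarrow> 2 \<le> \<bar>l - x\<bar> \<and> \<bar>l - x\<bar> \<le> int m - 2" "G \<in> L" for l xs G
  proof (rule foldr_commute[where V = L])
    fix x H assume "x \<in> set xs" "H \<in> L"
    then show "T l (R x H) = R x (T l H)"
      using that(1)[of x] T_R_comm[of x l H] R_T_comm[of l x H] by (cases "l \<le> x") auto
  qed (use that in simp_all)
  have low: "T j (w k) = t * w k" if "0 \<le> k" "k < k0" for k
  proof -
    have "T j (w k) = foldr R (rev [i..i + k - 1]) (T j F)"
      unfolding w_def by (rule T_fold[OF _ F]) (use that K in \<open>auto simp: k0_def\<close>)
    also have "T j F = t * F" using that j by (intro inv) (auto simp: k0_def)
    finally show ?thesis by (simp add: R_lin F w_def)
  qed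
  have high: "T j (w k) = t * w k" if k: "k0 + 1 < k" "k \<le> K" for k
  proof -
    have "[i..i + k - 1] = [i..j - 1] @ j # (j + 1) # [j + 2..i + k - 1]"
      using upto_split1[of i j "i + k - 1"] k K upto_rec1[of j "i + k - 1"] upto_rec1[of "j + 1" "i + k - 1"]
      by (simp add: k0_def add.commute[of 2])
    then have l: "w k = foldr R (rev [j + 2..i + k - 1]) (R (j + 1) (R j (foldr R (rev [i..j - 1]) F)))"
      by (simp add: w_def)
    define G where "G = foldr R (rev [i..j - 1]) F"
    have G: "G \<in> L" unfolding G_def by (rule RL[OF F])
    have m3: "3 \<le> m" using k K by linarith
    \<comment> \<open>By the braid relation \<open>T j\<close> emerges to the right of the two
      inverses as \<open>T (j + 1)\<close>. The hypothesis \<open>inv\<close> is available at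
      \<open>j + 1\<close> because \<open>k0 + 1 < k \<le> K\<close> gives
      \<open>j + 1 < m + e\<close>.\<close>
    have slide: "T j (R (j + 1) (R j G)) = R (j + 1) (R j (T (j + 1) G))"
    proof -
      define G' where "G' = R (j + 1) (R j G)"
      have G': "G' \<in> L" "G = T j (T (j + 1) G')" using G by (simp_all add: G'_def T_R)
      have "R (j + 1) (R j (T (j + 1) G)) = T j G'"
        unfolding G'(2) T_braid[OF m3 G'(1), symmetric] using G'(1) by (simp add: R_T)
      then show ?thesis by (simp add: G'_def)
    qed
    have "T j (w k) = foldr R (rev [j + 2..i + k - 1]) (T j (R (j + 1) (R j G)))"
      unfolding l G_def[symmetric] by (rule T_fold) (use k K G in \<open>auto simp: k0_def\<close>)
    also have "T (j + 1) G = foldr R (rev [i..j - 1]) (T (j + 1) F)"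
      unfolding G_def by (rule T_fold[OF _ F]) (use k K in \<open>auto simp: k0_def\<close>)
    then have "T (j + 1) G = t * G"
      using inv[of "j + 1"] j k by (simp add: R_lin F G_def K_def k0_def)
    then have "T j (R (j + 1) (R j G)) = t * R (j + 1) (R j G)"
      unfolding slide by (simp add: R_lconst G)
    finally show ?thesis by (simp add: l R_lin G flip: G_def)
  qed
  have S: "S i e F = (\<Sum>k\<in>{0..K}. w k)"
    using K by (simp add: S_def K_def w_def)
  have "T j (\<Sum>k\<in>A. w k) = (\<Sum>k\<in>A. T j (w k))" for A
    by (induction A rule: infinite_finite_induct) (use T_lconst[of 0 j 0] in \<open>simp_all add: T_add laurent_sum w\<close>)
  then have "T j (S i e F) = (\<Sum>k\<in>{0..K}. T j (w k))" by (simp add: S)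
  also have "\<dots> = (\<Sum>k\<in>{0..K} - {k0, k0 + 1}. T j (w k)) + (\<Sum>k\<in>{k0, k0 + 1}. T j (w k))"
    using K by (intro sum.subset_diff) auto
  also have "(\<Sum>k\<in>{0..K} - {k0, k0 + 1}. T j (w k)) = (\<Sum>k\<in>{0..K} - {k0, k0 + 1}. t * w k)"
  proof (rule sum.cong)
    fix k assume "k \<in> {0..K} - {k0, k0 + 1}"
    then have "0 \<le> k \<and> k < k0 \<or> k0 + 1 < k \<and> k \<le> K" by auto
    then show "T j (w k) = t * w k" using low high by blast
  qed simp
  also have "(\<Sum>k\<in>{k0, k0 + 1}. T j (w k)) = (\<Sum>k\<in>{k0, k0 + 1}. t * w k)"
    using pair by (simp add: distrib_left)
  also have "(\<Sum>k\<in>{0..K} - {k0, k0 + 1}. t * w k) + (\<Sum>k\<in>{k0, k0 + 1}. t * w k) = (\<Sum>k\<in>{0..K}. t * w k)"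
    using K by (intro sum.subset_diff[symmetric]) auto
  finally show ?thesis by (simp add: S sum_distrib_left)
qed

text \<open>Passing \<open>n\<close> factors \<open>P\<close> lowers \<open>j\<close> to
  \<open>j - n\<close>, which lies in \<open>1, ..., m - 1\<close>, where \<open>T\<close> acts on
  \<open>1\<close> by \<open>t\<close>. This is the initial interval for
  \<open>foldr_S_invariant\<close>.\<close>

lemma T_P_power:
  assumes j: "int n < j" "j < int n + int m"
  shows "T j ((P ^^ n) 1) = t * (P ^^ n) 1"
  using j
proof (induction n arbitrary: j)
  case 0
  then show ?case using T_one[of j] by simp
next
  case (Suc n)
  have "2 \<le> m" using Suc.prems by linarith
  then interpret laurent_rep2 m by unfold_locales
  have inL: "(P ^^ n) 1 \<in> L" by (cases n) simp_all
  have "T (j - 1 + 1) (P ((P ^^ n) 1)) = P (T (j - 1) ((P ^^ n) 1))"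
    by (rule P_T[OF inL, symmetric])
  also have "T (j - 1) ((P ^^ n) 1) = t * (P ^^ n) 1"
    using Suc.prems by (intro Suc.IH) auto
  finally show ?case by (simp add: P_lconst)
qed

text \<open>The chromatic function stripped of its scalar \<open>t^{n(m-1)}\<close>, which does not
  affect symmetry.\<close>

definition chromatic_vector :: "nat \<Rightarrow> (int \<Rightarrow> int) \<Rightarrow> lpoly" where
  "chromatic_vector n e = foldr (\<lambda>i. S i (e i)) [1..int n] ((P ^^ n) 1)"

context
  fixes n :: nat and e :: "int \<Rightarrow> int"
  assumes e: "e \<in> EE n"
begin

lemma EE_less: "1 \<le> i \<Longrightarrow> i \<le> int n \<Longrightarrow> e i < i"
  and EE_mono: "1 \<le> i \<Longrightarrow> i < int n \<Longrightarrow> e i \<le> e (i + 1)"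
  using e by (auto simp: EE_def)

lemma linear_foldr_S: "linear_on L (foldr (\<lambda>i. S i (e i)) [1..int n])"
  by (rule linear_on_foldr) (auto intro!: linear_S EE_less)

lemma P_power_in: "F \<in> L \<Longrightarrow> (P ^^ k) F \<in> L"
  by (induction k) simp_all

lemma foldr_S_in: "1 \<le> k \<Longrightarrow> F \<in> L \<Longrightarrow> foldr (\<lambda>i. S i (e i)) [k..int n] F \<in> L"
  by (rule linear_onD(1)[OF linear_on_foldr]) (auto intro!: linear_S EE_less)

lemma chromatic_vector_in: "chromatic_vector n e \<in> L"
  unfolding chromatic_vector_def by (intro foldr_S_in P_power_in) simp_all

text \<open>
  Monotonicity of \<open>e\<close> makes the window of \<open>k\<close> without its first element a part of the window of
  \<open>k + 1\<close>, as \<open>S_invariant\<close> requires.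
\<close>

lemma foldr_S_invariant:
  assumes "1 \<le> k" "k \<le> int n + 1" "k \<le> j" "j < int m + (if k \<le> int n then e k else k - 1)"
  shows "T j (foldr (\<lambda>i. S i (e i)) [k..int n] ((P ^^ n) 1)) = t * foldr (\<lambda>i. S i (e i)) [k..int n] ((P ^^ n) 1)"
  using assms(2,1,3,4)
proof (induction k arbitrary: j rule: int_le_induct)
  case base
  then show ?case using T_P_power[of n j] by simp
next
  case (step k)
  define l where "l = k - 1"
  have l: "1 \<le> l" "l \<le> int n" "k = l + 1" using step by (auto simp: l_def)
  let ?F = "foldr (\<lambda>i. S i (e i)) [l + 1..int n] ((P ^^ n) 1)"
  have "T j (S l (e l) ?F) = t * S l (e l) ?F"
  proof (rule S_invariant)
    show "e l < l" using l by (intro EE_less)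
    show "?F \<in> L" using l by (intro foldr_S_in P_power_in) auto
    show "l \<le> j" "j < int m + e l" using step.prems l by auto
    fix i assume i: "l < i" "i < int m + e l"
    have "e l \<le> (if l + 1 \<le> int n then e (l + 1) else l)"
      using EE_mono[of l] EE_less[of l] l by auto
    then have "i < int m + (if l + 1 \<le> int n then e (l + 1) else l + 1 - 1)"
      using i(2) by (auto split: if_splits)
    then show "T i ?F = t * ?F"
      using i(1) l(1) by (intro step.IH[of i, unfolded l(3)]) simp_all
  qed
  then show ?case using l by (simp add: upto_rec1[of l])
qed

lemma chromatic_vector_symmetric:
  assumes "1 \<le> j" "j < int m" shows "T j (chromatic_vector n e) = t * chromatic_vector n e"
  unfolding chromatic_vector_def
proof (rule foldr_S_invariant)
  \<comment> \<open>\<open>e 1 \<ge> 0\<close> makes the first interval reach \<open>m - 1\<close>;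
    for \<open>n = 0\<close> the default value \<open>1 - 1\<close> gives the same bound.\<close>
  show "j < int m + (if 1 \<le> int n then e 1 else 1 - 1)"
  proof (cases "1 \<le> int n")
    case True
    then have "0 \<le> e 1" using e by (simp add: EE_def)
    then show ?thesis using assms True by simp
  qed (use assms in simp)
qed (use assms in auto)

definition chromatic_element :: "falg set" where
  "chromatic_element = hconst m (tt ^ (n * (m - 1))) \<otimes>\<^bsub>hecke m\<^esub>
       mult_list (hecke m) (map (\<lambda>i. hS m i (e i)) [1..int n]) \<otimes>\<^bsub>hecke m\<^esub>
       hPi m [^]\<^bsub>hecke m\<^esub> n"

lemma chromatic_element_carrier: "chromatic_element \<in> carrier (hecke m)"
  unfolding chromatic_element_def
  by (intro H.m_closed hconst_carrier mult_list_closed H.nat_pow_closed hPi_carrier)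
     (auto intro!: act_hS(1)[OF EE_less laurent_0])

lemma act_chromatic_element:
  assumes F: "F \<in> L"
  shows "act chromatic_element F = lconst (tt ^ (n * (m - 1))) * foldr (\<lambda>i. S i (e i)) [1..int n] ((P ^^ n) F)"
proof -
  let ?xs = "map (\<lambda>i. hS m i (e i)) [1..int n]"
  have xs: "x \<in> carrier (hecke m)" if "x \<in> set ?xs" for x
    using that by (auto intro!: act_hS(1)[OF EE_less laurent_0])
  have pow: "act (hPi m [^]\<^bsub>hecke m\<^esub> k) G = (P ^^ k) G" if "G \<in> L" for k G
    using that by (induction k arbitrary: G) (simp_all add: act_one act_mult act_hPi funpow_swap1)
  have fold: "foldr act ?xs G = foldr (\<lambda>i. S i (e i)) [1..int n] G \<and> foldr (\<lambda>i. S i (e i)) [1..int n] G \<in> L"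
    if "G \<in> L" for G
    using that by (intro foldr_act) (auto simp: act_hS EE_less intro!: linear_onD(1)[OF linear_S])
  have ml: "mult_list (hecke m) ?xs \<in> carrier (hecke m)" by (rule mult_list_closed[OF xs])
  have "act chromatic_element F = act (hconst m (tt ^ (n * (m - 1)))) (act (mult_list (hecke m) ?xs) ((P ^^ n) F))"
    unfolding chromatic_element_def using F ml
    by (simp add: act_mult pow act_in P_power_in)
  also have "act (mult_list (hecke m) ?xs) ((P ^^ n) F) = foldr (\<lambda>i. S i (e i)) [1..int n] ((P ^^ n) F)"
    using act_mult_list[of ?xs, OF xs P_power_in[OF F]] fold[OF P_power_in[OF F]] by simp
  finally show ?thesis
    using fold[OF P_power_in[OF F]] by (simp add: act_hconst)
qed

lemma chromatic_fun_act: "chromatic_fun m n e = act chromatic_element 1"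
  by (simp add: chromatic_fun_def chromatic_element_def)

end

text \<open>Each \<open>P\<close> raises both indices of \<open>S\<close> by one, and after
  \<open>n\<close> of them \<open>e'\<close> has become the second branch of
  \<open>union_fun\<close>.\<close>

lemma P_power_foldr_S:
  assumes "\<And>i. i \<in> set xs \<Longrightarrow> f i < i" "F \<in> L"
  shows "(P ^^ n) (foldr (\<lambda>i. S i (f i)) xs F) =
    foldr (\<lambda>i. S i (int n + f (i - int n))) (map (\<lambda>i. i + int n) xs) ((P ^^ n) F)"
proof -
  have step: "(P ^^ n) (S i c G) = S (i + int n) (int n + c) ((P ^^ n) G)" if "c < i" "G \<in> L" for i c G
    using that
  proof (induction n)
    case (Suc n)
    have "(P ^^ n) G \<in> L" using Suc.prems by (induction n) simp_all
    then show ?case using Suc P_S[of "int n + c" "i + int n" "(P ^^ n) G"] by (simp add: add_ac)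
  qed simp
  have "(P ^^ n) (foldr (\<lambda>i. S i (f i)) xs F) =
    foldr (\<lambda>i. S i (int n + f (i - int n))) (map (\<lambda>i. i + int n) xs) ((P ^^ n) F)
    \<and> foldr (\<lambda>i. S i (f i)) xs F \<in> L"
    using assms(1) by (induction xs) (auto simp: assms(2) step intro: linear_onD(1)[OF linear_S])
  then show ?thesis ..
qed

section \<open>Multiplicativity under ordered disjoint union\<close>

lemma EE_union:
  assumes e: "e \<in> EE n" and e': "e' \<in> EE n'"
  shows "union_fun n e n' e' \<in> EE (n + n')"
proof -
  have "union_fun n e n' e' i \<le> union_fun n e n' e' (i + 1)" if i: "1 \<le> i" "i < int (n + n')" for i
  proof -
    consider "i < int n" | "i = int n" | "int n < i" by linarith
    then show ?thesis
    proof cases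
      case 1
      then show ?thesis using e i by (auto simp: union_fun_def EE_def)
    next
      case 2
      then have "e i < i" "0 \<le> e' 1" using e e' i by (auto simp: EE_def)
      then show ?thesis using 2 i by (simp add: union_fun_def)
    next
      case 3
      then have "e' (i - int n) \<le> e' (i - int n + 1)" using e' i by (auto simp: EE_def)
      then show ?thesis using 3 i by (simp add: union_fun_def algebra_simps)
    qed
  qed
  moreover have "0 \<le> union_fun n e n' e' i \<and> union_fun n e n' e' i < i" if i: "1 \<le> i" "i \<le> int (n + n')" for i
  proof (cases "i \<le> int n")
    case True
    then show ?thesis using e i by (auto simp: union_fun_def EE_def)
  next
    case False
    then have "0 \<le> e' (i - int n) \<and> e' (i - int n) < i - int n" using e' i by (auto simp: EE_def)
    then show ?thesis using False i by (simp add: union_fun_def)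
  qed
  ultimately show ?thesis
    by (auto simp: EE_def) (simp add: union_fun_def)
qed

theorem chromatic_fun_union:
  assumes e: "e \<in> EE n" and e': "e' \<in> EE n'"
  shows "chromatic_fun m (n + n') (union_fun n e n' e') = quantum_mult m (chromatic_fun m n e) (chromatic_fun m n' e')"
proof -
  let ?c = "lconst (tt ^ (n * (m - 1)))" and ?c' = "lconst (tt ^ (n' * (m - 1)))"
  define h h' where "h = chromatic_element n e" and "h' = chromatic_element n' e'"
  have h: "h \<in> carrier (hecke m)" "h' \<in> carrier (hecke m)"
    by (simp_all add: h_def h'_def chromatic_element_carrier e e')
  have v': "act h' 1 = ?c' * chromatic_vector n' e'"
    by (simp add: h'_def act_chromatic_element[OF e'] chromatic_vector_def)
  have sym: "T i (act h' 1) = t * act h' 1" if "1 \<le> i" "i < int m" for i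
    unfolding v' using that chromatic_vector_in[OF e'] chromatic_vector_symmetric[OF e' that]
    by (simp add: linear_onD(3)[OF linear_T] mult.left_commute)
  let ?e = "union_fun n e n' e'"
  have split: "[1..int (n + n')] = [1..int n] @ map (\<lambda>i. i + int n) [1..int n']"
    using upto_split2[of 1 "int n" "int n + int n'"] by (cases "n = 0") (simp_all add: map_plus_upto add_ac)
  have low: "foldr (\<lambda>i. S i (?e i)) [1..int n] F = foldr (\<lambda>i. S i (e i)) [1..int n] F" for F
    by (rule foldr_cong) (auto simp: union_fun_def)
  have high: "foldr (\<lambda>i. S i (?e i)) (map (\<lambda>i. i + int n) [1..int n']) F =
    foldr (\<lambda>i. S i (int n + e' (i - int n))) (map (\<lambda>i. i + int n) [1..int n']) F" for F
    by (rule foldr_cong) (auto simp: union_fun_def)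
  \<comment> \<open>Of the \<open>n + n'\<close> factors \<open>P\<close>, the outer
    \<open>n\<close> are moved left across the operators of the second graph, undoing the shift of
    its indices.\<close>
  have "chromatic_vector (n + n') ?e = foldr (\<lambda>i. S i (e i)) [1..int n] ((P ^^ n) (chromatic_vector n' e'))"
    unfolding chromatic_vector_def split foldr_append low high funpow_add comp_apply
    using EE_less[OF e'] P_power_in[OF e']
    by (subst P_power_foldr_S) (auto simp: laurent_1)
  then have "chromatic_fun m (n + n') ?e = ?c * (?c' * foldr (\<lambda>i. S i (e i)) [1..int n] ((P ^^ n) (chromatic_vector n' e')))"
    using chromatic_fun_act[OF EE_union[OF e e']] act_chromatic_element[OF EE_union[OF e e'] laurent_1]
    by (simp add: chromatic_vector_def distrib_right power_add lconst_mult mult.assoc)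
  also have "\<dots> = act h (act h' 1)"
  proof -
    have lin: "linear_on L (P ^^ n)"
      by (induction n) (use linear_P in \<open>auto simp: linear_on_def\<close>)
    show ?thesis
      unfolding h_def v' using chromatic_vector_in[OF e']
      by (simp add: act_chromatic_element[OF e] linear_onD[OF lin] linear_onD(3)[OF linear_foldr_S[OF e]])
  qed
  also have "\<dots> = quantum_mult m (act h 1) (act h' 1)"
    by (rule quantum_mult_symmetric[symmetric, OF h sym])
  finally show ?thesis
    by (simp add: h_def h'_def chromatic_fun_act e e')
qed

end

section \<open>Unit interval graphs\<close>

text \<open>The vertex set gives \<open>n\<close>. If \<open>e i < e' i\<close>, the arc from
  \<open>e' i\<close> to \<open>i\<close> belongs to the first graph and not to the second; it has a
  vertex as its source because \<open>e i \<ge> 0\<close>. Outside \<open>1, ..., n\<close> the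
  functions agree by extensionality.\<close>

lemma ui_graph_inject:
  assumes e: "e \<in> EE n" and e': "e' \<in> EE n'" and eq: "ui_graph n e = ui_graph n' e'"
  shows "n = n' \<and> e = e'"
proof -
  have "{1..int n} = {1..int n'}" using eq by (simp add: ui_graph_def)
  then have n: "n = n'" by (metis card_atLeastAtMost_int diff_add_cancel nat_int)
  have arcs: "(j, i) \<in> parcs (ui_graph n e) \<longleftrightarrow> (j, i) \<in> parcs (ui_graph n e')" for i j
    using eq n by simp
  have "e i = e' i" if i: "i \<in> {1..int n}" for i
  proof -
    have "0 \<le> e i" "e i < i" "0 \<le> e' i" "e' i < i" using i e e' n by (auto simp: EE_def)
    then have "\<not> e i < e' i" "\<not> e' i < e i"
      using arcs[of "e' i" i] arcs[of "e i" i] i by (auto simp: ui_graph_def)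
    then show ?thesis by linarith
  qed
  then have "e = e'"
    using e e' n by (intro extensionalityI[of e "{1..int n}" e']) (auto simp: EE_def)
  with n show ?thesis by blast
qed

lemma chromatic_ui_graph:
  assumes "e \<in> EE n"
  shows "chromatic m (ui_graph n e) = chromatic_fun m n e"
  unfolding chromatic_def
proof (rule the_equality)
  show "\<exists>n'. \<exists>e'\<in>EE n'. ui_graph n e = ui_graph n' e' \<and> chromatic_fun m n e = chromatic_fun m n' e'"
    using assms by blast
qed (use ui_graph_inject[OF assms] in blast)

lemma ordered_union_ui_graph:
  assumes "e \<in> EE n" "e' \<in> EE n'"
  shows "ordered_union (ui_graph n e) (ui_graph n' e') = ui_graph (n + n') (union_fun n e n' e')"
  unfolding ordered_union_def
proof (rule the_equality)
  show "\<exists>k k'. \<exists>f\<in>EE k. \<exists>f'\<in>EE k'. ui_graph n e = ui_graph k f \<and> ui_graph n' e' = ui_graph k' f' \<and>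
      ui_graph (n + n') (union_fun n e n' e') = ui_graph (k + k') (union_fun k f k' f')"
    using assms by blast
qed (use ui_graph_inject[OF assms(1)] ui_graph_inject[OF assms(2)] in blast)

theorem corollary4p10:
  fixes m :: nat and \<Gamma> \<Gamma>' :: "int pair_pre_digraph"
  assumes "m \<ge> 1"
    and "unit_interval_graph \<Gamma>"
    and "unit_interval_graph \<Gamma>'"
  shows "chromatic m (ordered_union \<Gamma> \<Gamma>') = quantum_mult m (chromatic m \<Gamma>) (chromatic m \<Gamma>')"
proof -
  interpret laurent_rep m using assms(1) by unfold_locales
  obtain n e n' e' where "e \<in> EE n" "e' \<in> EE n'" "\<Gamma> = ui_graph n e" "\<Gamma>' = ui_graph n' e'"
    using assms(2,3) unfolding unit_interval_graph_def by blast
  then show ?thesis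
    by (simp add: ordered_union_ui_graph chromatic_ui_graph EE_union chromatic_fun_union)
qed

end
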